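(* Let $(M^2,g)$ be a surface whose projective symmetry algebra satisfies $\dim\mathfrak p(g)=3$, with local coordinates $(z,y)$ chosen so that the equation of unparametrized geodesics is $z^3\frac{d^2y}{dz^2}=\epsilon\left(\frac{dy}{dz}\right)^3$, $\epsilon=\pm1$. Then a geodesic 3-web $\mathcal G_3$ on $M^2$ is hexagonal if and only if one of its dual focal curves is an arc of the conic $c_0=\{AC-B^2+\epsilon D^2=0\}\cap\{D=0\}\subset\mathbb{RP}^3$ and the other two dual focal curves are arcs of the section of the quadric $\{AC-B^2+\epsilon D^2=0\}\subset\mathbb{RP}^3$ by some fixed plane, different from the plane $D=0$.
   Context: All considerations are local. A vector field on $(M^2,g)$ is projective if its local flow maps unparametrized geodesics to unparametrized geodesics; all such fields form the Lie algebra $\mathfrak p(g)$. If $\dim\mathfrak p(g)=3$, there are local coordinates $(z,y)$, $z\neq0$, in which the unparametrized geodesics are the solutions of $z^3\frac{d^2y}{dz^2}=\epsilon\left(\frac{dy}{dz}\right)^3$ with $\epsilon=1$ or $\epsilon=-1$, and $\mathfrak p(g)$ is spanned by $\partial_y,\ z\partial_z+2y\partial_y,\ zy\partial_z+y^2\partial_y$. Each geodesic lies on a conic $Ay^2+2By+C+Dz^2=0$ with $[A:B:C:D]\in\mathbb{RP}^3$ on the quadric $AC-B^2+\epsilon D^2=0$ (the general solution is $k^2(y-l)^2-kz^2=\epsilon$ with constants $k,l$; this family is completed by its closure, the special geodesics $y=l$ corresponding to the double lines $(y-l)^2=0$, i.e. to the points of the quadric with $D=0$). Thus geodesics are represented by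 points of this quadric (the dual space). A 3-web is a configuration of three pairwise transverse one-dimensional foliations; it is geodesic if all leaves are geodesics of $g$; it is hexagonal if locally there are smooth functions $u_1,u_2,u_3$ with nonvanishing differentials, $u_i$ constant along the leaves of the $i$-th foliation, with $u_1+u_2+u_3\equiv0$. For a geodesic 3-web, the leaves of each of the three foliations form a one-parameter family of geodesics, hence an arc $\gamma_i$ ($i=1,2,3$) on the quadric; the arcs $\gamma_1,\gamma_2,\gamma_3$ are called the dual focal curves of the web. *)

theory Defs
  imports "HOL-Analysis.Analysis" "HOL-Library.Function_Algebras"
begin

section \<open>Smooth maps and metrics on plane domains\<close>

primrec Ck_on :: "nat \<Rightarrow> 'a::real_normed_vector set \<Rightarrow> ('a \<Rightarrow> 'b::real_normed_vector) \<Rightarrow> bool" where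
  "Ck_on 0 S f \<longleftrightarrow> continuous_on S f"
| "Ck_on (Suc k) S f \<longleftrightarrow>
     (\<forall>x\<in>S. f differentiable (at x)) \<and>
     (\<forall>v. Ck_on k S (\<lambda>x. frechet_derivative f (at x) v))"

text \<open>Only used for open sets \<open>S\<close>.\<close>

definition smooth_on :: "'a::real_normed_vector set \<Rightarrow> ('a \<Rightarrow> 'b::real_normed_vector) \<Rightarrow> bool" where
  "smooth_on S f \<longleftrightarrow> (\<forall>k. Ck_on k S f)"

text \<open>A point \<open>p\<close> of the plane has coordinates \<open>z = p $ 1\<close> and \<open>y = p $ 2\<close>.
  Metrics are given by their Gram matrix; the signature is arbitrary, so Riemannian and
  pseudo-Riemannian metrics are both covered.\<close>

definition metric_on :: "(real^2) set \<Rightarrow> (real^2 \<Rightarrow> real^2^2) \<Rightarrow> bool" where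
  "metric_on U g \<longleftrightarrow>
     smooth_on U g \<and> (\<forall>p\<in>U. transpose (g p) = g p \<and> det (g p) \<noteq> 0)"

definition partial :: "2 \<Rightarrow> (real^2 \<Rightarrow> real) \<Rightarrow> real^2 \<Rightarrow> real" where
  "partial i f p = frechet_derivative f (at p) (axis i 1)"

definition christoffel :: "(real^2 \<Rightarrow> real^2^2) \<Rightarrow> real^2 \<Rightarrow> 2 \<Rightarrow> 2 \<Rightarrow> 2 \<Rightarrow> real" where
  "christoffel g p k i j =
     1/2 * (\<Sum>l\<in>UNIV. matrix_inv (g p) $ k $ l *
       (partial i (\<lambda>q. g q $ l $ j) p + partial j (\<lambda>q. g q $ l $ i) p - partial l (\<lambda>q. g q $ i $ j) p))"


section \<open>Geodesics and projective vector fields\<close>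

definition open_interval :: "real set \<Rightarrow> bool" where
  "open_interval I \<longleftrightarrow> open I \<and> is_interval I \<and> I \<noteq> {}"

text \<open>Nonconstant, affinely parametrized geodesics in \<open>U\<close>.\<close>

definition geodesic :: "(real^2 \<Rightarrow> real^2^2) \<Rightarrow> (real^2) set \<Rightarrow> real set \<Rightarrow> (real \<Rightarrow> real^2) \<Rightarrow> bool" where
  "geodesic g U I c \<longleftrightarrow>
     open_interval I \<and> smooth_on I c \<and> c ` I \<subseteq> U \<and>
     (\<forall>t\<in>I. let v = vector_derivative c (at t);
                a = vector_derivative (\<lambda>s. vector_derivative c (at s)) (at t)
            in v \<noteq> 0 \<and>
               (\<forall>k. a $ k + (\<Sum>i\<in>UNIV. \<Sum>j\<in>UNIV. christoffel g (c t) k i j * v $ i * v $ j) = 0))"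

text \<open>An unparametrized geodesic is the trace of a geodesic. It need not be maximal.\<close>

definition unparam_geodesic :: "(real^2 \<Rightarrow> real^2^2) \<Rightarrow> (real^2) set \<Rightarrow> (real^2) set \<Rightarrow> bool" where
  "unparam_geodesic g U S \<longleftrightarrow> (\<exists>I c. geodesic g U I c \<and> S = c ` I)"

definition local_flow ::
  "(real^2) set \<Rightarrow> (real^2 \<Rightarrow> real^2) \<Rightarrow> (real^2) set \<Rightarrow> real \<Rightarrow> (real \<Rightarrow> real^2 \<Rightarrow> real^2) \<Rightarrow> bool" where
  "local_flow U X V \<delta> \<phi> \<longleftrightarrow>
     open V \<and> V \<subseteq> U \<and> 0 < \<delta> \<and>
     (\<forall>p\<in>V. \<phi> 0 p = p \<and>
       (\<forall>t. \<bar>t\<bar> < \<delta> \<longrightarrow> \<phi> t p \<in> U \<and> ((\<lambda>s. \<phi> s p) has_vector_derivative X (\<phi> t p)) (at t)))"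

text \<open>Vector fields on \<open>U\<close> are extended by \<open>0\<close> outside \<open>U\<close>, so that equality of fields
  on \<open>U\<close> is equality of functions and the dimension below is that of a space of fields on \<open>U\<close>.\<close>

definition projective_fields :: "(real^2 \<Rightarrow> real^2^2) \<Rightarrow> (real^2) set \<Rightarrow> (real^2 \<Rightarrow> real^2) set" where
  "projective_fields g U =
     {X. smooth_on U X \<and> (\<forall>p. p \<notin> U \<longrightarrow> X p = 0) \<and>
         (\<forall>V \<delta> \<phi>. local_flow U X V \<delta> \<phi> \<longrightarrow>
            (\<forall>t S. \<bar>t\<bar> < \<delta> \<and> S \<subseteq> V \<and> unparam_geodesic g U S \<longrightarrow> unparam_geodesic g U (\<phi> t ` S)))}"

definition scale_field :: "real \<Rightarrow> (real^2 \<Rightarrow> real^2) \<Rightarrow> real^2 \<Rightarrow> real^2" where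
  "scale_field r X = (\<lambda>p. r *\<^sub>R X p)"

lemma vector_space_scale_field: "vector_space scale_field"
  by unfold_locales (auto simp: scale_field_def fun_eq_iff scaleR_add_right scaleR_add_left)

definition dim_projective :: "(real^2 \<Rightarrow> real^2^2) \<Rightarrow> (real^2) set \<Rightarrow> nat" where
  "dim_projective g U = vector_space.dim scale_field (projective_fields g U)"

text \<open>In the coordinates \<open>(z, y)\<close>, the unparametrized geodesics that are graphs over the
  \<open>z\<close>-axis are exactly the solutions of \<open>z\<^sup>3 y'' = \<epsilon> y'\<^sup>3\<close>.\<close>

definition geodesics_given_by_ode :: "real \<Rightarrow> (real^2 \<Rightarrow> real^2^2) \<Rightarrow> (real^2) set \<Rightarrow> bool" where
  "geodesics_given_by_ode \<epsilon> g U \<longleftrightarrow>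
     (\<forall>I f. open_interval I \<and> smooth_on I f \<and> (\<forall>z\<in>I. vector [z, f z] \<in> U) \<longrightarrow>
        (unparam_geodesic g U ((\<lambda>z. vector [z, f z]) ` I) \<longleftrightarrow>
         (\<forall>z\<in>I. z ^ 3 * deriv (deriv f) z = \<epsilon> * (deriv f z) ^ 3)))"


section \<open>Foliations and 3-webs\<close>

text \<open>A one-dimensional foliation of a plane domain is given by its smooth tangent line field.\<close>

definition foliation_on :: "(real^2) set \<Rightarrow> (real^2 \<Rightarrow> (real^2) set) \<Rightarrow> bool" where
  "foliation_on U L \<longleftrightarrow>
     (\<forall>p\<in>U. \<exists>V X. open V \<and> p \<in> V \<and> V \<subseteq> U \<and> smooth_on V X \<and>
        (\<forall>q\<in>V. X q \<noteq> 0 \<and> L q = span {X q}))"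

text \<open>The leaf through \<open>p\<close> consists of the points that can be reached from \<open>p\<close> inside \<open>V\<close>
  along curves tangent to the line field. For smaller \<open>V\<close> these are the plaques in \<open>V\<close>.\<close>

definition leaf :: "(real^2) set \<Rightarrow> (real^2 \<Rightarrow> (real^2) set) \<Rightarrow> real^2 \<Rightarrow> (real^2) set" where
  "leaf V L p =
     {q. \<exists>c. c C1_differentiable_on {0..1} \<and> path_image c \<subseteq> V \<and>
             pathstart c = p \<and> pathfinish c = q \<and>
             (\<forall>t\<in>{0..1}. vector_derivative c (at t) \<in> L (c t))}"

definition three_web :: "(real^2) set \<Rightarrow> (3 \<Rightarrow> real^2 \<Rightarrow> (real^2) set) \<Rightarrow> bool" where
  "three_web U W \<longleftrightarrow>
     (\<forall>i. foliation_on U (W i)) \<and>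
     (\<forall>i j. i \<noteq> j \<longrightarrow> (\<forall>p\<in>U. W i p \<inter> W j p = {0}))"

definition geodesic_web ::
  "(real^2 \<Rightarrow> real^2^2) \<Rightarrow> (real^2) set \<Rightarrow> (3 \<Rightarrow> real^2 \<Rightarrow> (real^2) set) \<Rightarrow> bool" where
  "geodesic_web g U W \<longleftrightarrow>
     three_web U W \<and> (\<forall>i. \<forall>p\<in>U. unparam_geodesic g U (leaf U (W i) p))"

definition hexagonal :: "(real^2) set \<Rightarrow> (3 \<Rightarrow> real^2 \<Rightarrow> (real^2) set) \<Rightarrow> bool" where
  "hexagonal U W \<longleftrightarrow>
     (\<forall>p\<in>U. \<exists>V (u :: 3 \<Rightarrow> real^2 \<Rightarrow> real). open V \<and> p \<in> V \<and> V \<subseteq> U \<and>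
        (\<forall>i. smooth_on V (u i) \<and>
             (\<forall>q\<in>V. frechet_derivative (u i) (at q) \<noteq> (\<lambda>v. 0)) \<and>
             (\<forall>q\<in>V. \<forall>r\<in>leaf V (W i) q. u i r = u i q)) \<and>
        (\<forall>q\<in>V. (\<Sum>i\<in>UNIV. u i q) = 0))"


section \<open>The dual quadric\<close>

text \<open>Points of \<open>\<real>P\<^sup>3\<close> are lines through the origin of \<open>real^4\<close>; the homogeneous
  coordinates \<open>[A:B:C:D]\<close> are \<open>v $ 1, \<dots>, v $ 4\<close>.\<close>

type_synonym proj_point = "(real^4) set"

definition quadric :: "real \<Rightarrow> proj_point set" where
  "quadric \<epsilon> = {span {v} | v. v \<noteq> 0 \<and> v $ 1 * v $ 3 - (v $ 2)\<^sup>2 + \<epsilon> * (v $ 4)\<^sup>2 = 0}"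

definition proj_plane :: "real^4 \<Rightarrow> proj_point set" where
  "proj_plane n = {span {v} | v. v \<noteq> 0 \<and> n \<bullet> v = 0}"

definition plane_D0 :: "proj_point set" where
  "plane_D0 = proj_plane (axis 4 1)"

definition conic :: "real^4 \<Rightarrow> (real^2) set" where
  "conic v = {p. v $ 1 * (p $ 2)\<^sup>2 + 2 * v $ 2 * p $ 2 + v $ 3 + v $ 4 * (p $ 1)\<^sup>2 = 0}"

text \<open>The set of points of the quadric that represent the leaves of a geodesic foliation.\<close>

definition dual_focal_curve :: "real \<Rightarrow> (real^2) set \<Rightarrow> (real^2 \<Rightarrow> (real^2) set) \<Rightarrow> proj_point set" where
  "dual_focal_curve \<epsilon> U L =
     {span {v} | v. v \<noteq> 0 \<and> span {v} \<in> quadric \<epsilon> \<and> (\<exists>p\<in>U. leaf U L p \<subseteq> conic v)}"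

text \<open>An arc of a projective curve \<open>S\<close> is a path-connected piece of it that is not a single
  point. Paths in projective space are described by continuous lifts to \<open>real^4\<close>.\<close>

definition arc_of :: "proj_point set \<Rightarrow> proj_point set \<Rightarrow> bool" where
  "arc_of \<gamma> S \<longleftrightarrow>
     \<gamma> \<subseteq> S \<and> (\<exists>P\<in>\<gamma>. \<exists>Q\<in>\<gamma>. P \<noteq> Q) \<and>
     (\<forall>P\<in>\<gamma>. \<forall>Q\<in>\<gamma>. \<exists>w :: real \<Rightarrow> real^4. path w \<and>
        (\<forall>t\<in>{0..1}. w t \<noteq> 0 \<and> span {w t} \<in> \<gamma>) \<and>
        span {pathstart w} = P \<and> span {pathfinish w} = Q)"

definition conic_c0 :: "real \<Rightarrow> proj_point set" where
  "conic_c0 \<epsilon> = quadric \<epsilon> \<inter> plane_D0"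

end

theory Submission
  imports Defs
begin

text \<open>Let \<open>S = dz/dy\<close> denote the slope of a foliation by geodesics. Leaves being geodesics means
  \<open>S\<^sub>y + S S\<^sub>z = - \<epsilon> / z\<^sup>3\<close>, and then the projective coefficient vector of the conic through a point in the
  direction of the foliation is constant along leaves, so that the dual focal curve consists of the classes of these vectors.

  Hexagonality gives functions \<open>f\<^sub>i = (u\<^sub>i)\<^sub>z\<close> with \<open>\<Sum> f\<^sub>i = \<Sum> S\<^sub>i f\<^sub>i = 0\<close> and \<open>(f\<^sub>i)\<^sub>y + (S\<^sub>i f\<^sub>i)\<^sub>z = 0\<close>. As in
  the proof of the Graf-Sauer theorem, the moments \<open>\<Sum> S\<^sub>i\<^sup>k f\<^sub>i\<close> then satisfy a recursion which forces the sum of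
  the slopes to be affine in \<open>z\<close>; the other elementary symmetric functions follow as Laurent polynomials in \<open>z\<close>.
  For three slopes the resulting system is contradictory, so one foliation is \<open>y = const\<close>. For the remaining two slopes
  it says that they are the roots of \<open>\<rho> S\<^sup>2 - \<rho>' z S + \<rho>'' z\<^sup>2 / 2 - \<lambda> - \<epsilon> \<rho> / z\<^sup>2\<close> with a constant \<open>\<lambda>\<close> and a quadratic
  polynomial \<open>\<rho>(y)\<close>, which is the equation of a plane section of the quadric.\<close>

section \<open>Calculus of smooth functions\<close>

text \<open>Geodesics enter in a weak form. The differential equation is given only for graphs over
  the \<open>z\<close>-axis, and a leaf is a set of end points of C1 paths that happens to be the
  trace of a geodesic, whose parametrization is unrelated to those paths and which may return to
  itself. Two devices bridge the gap: an infinite family of explicit conics through each point,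
  which fixes the cubic form of the connection in all directions, and a category argument that finds
  an interval on which a path and the geodesic run together.

  The slope is \<open>dz/dy\<close> so that the foliation to be isolated, \<open>y = const\<close>,
  is exactly the one of infinite slope. For the moments \<open>T_k\<close> the recursion reads
  \<open>(T_k)_y + (T_(k+1))_z = - k \<epsilon> T_(k-1) / z^3\<close>. Since
  \<open>T_0 = T_1 = 0\<close>, the moment \<open>T_2\<close> is free of \<open>z\<close> and
  \<open>T_3\<close> is the sum of the slopes times \<open>T_2\<close>; equality of the mixed
  derivatives of \<open>T_2\<close> makes that sum affine. The pole of the source term then decides
  the matter: the compatibility conditions equate terms without a pole at \<open>z = 0\<close> with
  terms that have one.\<close>

declare Ck_on.simps(2) [simp del]

section \<open>Closure properties of functions of class C^k and of smooth functions\<close>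

lemma Ck_on_has_derivative:
  "Ck_on (Suc k) S f \<Longrightarrow> x \<in> S \<Longrightarrow> (f has_derivative frechet_derivative f (at x)) (at x)"
  using frechet_derivative_works by (auto simp: Ck_on.simps(2))

lemma Ck_on_frechet_derivative: "Ck_on (Suc k) S f \<Longrightarrow> Ck_on k S (\<lambda>x. frechet_derivative f (at x) v)"
  by (simp add: Ck_on.simps(2))

lemma Ck_on_cong:
  assumes "open S" "\<And>x. x \<in> S \<Longrightarrow> f x = g x" "Ck_on k S f"
  shows "Ck_on k S g"
  using assms(2,3)
proof (induction k arbitrary: f g)
  case 0
  then show ?case by (simp cong: continuous_on_cong)
next
  case (Suc k)
  have d: "(g has_derivative frechet_derivative f (at x)) (at x)" if "x \<in> S" for x
  proof -
    have "(f has_derivative frechet_derivative f (at x)) (at x)"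
      using Suc.prems(2) that Ck_on_has_derivative by blast
    then show ?thesis
      by (rule has_derivative_transform_within_open[OF _ assms(1) that]) (use Suc.prems(1) in auto)
  qed
  have "frechet_derivative f (at x) = frechet_derivative g (at x)" if "x \<in> S" for x
    using frechet_derivative_at[OF d[OF that]] .
  moreover have "Ck_on k S (\<lambda>x. frechet_derivative f (at x) v)" for v
    using Suc.prems(2) Ck_on_frechet_derivative by blast
  ultimately have "Ck_on k S (\<lambda>x. frechet_derivative g (at x) v)" for v
    using Suc.IH[of "\<lambda>x. frechet_derivative f (at x) v" "\<lambda>x. frechet_derivative g (at x) v"] by metis
  with d show ?case by (auto simp: differentiable_def Ck_on.simps(2))
qed

text \<open>\<open>Ck_on\<close> names derivatives through \<open>frechet_derivative\<close>; here
  any family of derivatives may be presented, so that the closure lemmas below can use the product,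
  quotient and chain rules in closed form.\<close>

lemma Ck_on_Suc_I:
  assumes "open S" "\<And>x. x \<in> S \<Longrightarrow> (f has_derivative f' x) (at x)" "\<And>v. Ck_on k S (\<lambda>x. f' x v)"
  shows "Ck_on (Suc k) S f"
proof -
  have "Ck_on k S (\<lambda>x. frechet_derivative f (at x) v)" for v
    by (rule Ck_on_cong[OF assms(1) _ assms(3)[of v]]) (use assms(2) frechet_derivative_at in metis)
  then show ?thesis using assms(2) by (auto simp: differentiable_def Ck_on.simps(2))
qed

lemma Ck_on_Suc_D: "Ck_on (Suc k) S f \<Longrightarrow> Ck_on k S f"
proof (induction k arbitrary: f)
  case 0
  then show ?case
    by (simp add: Ck_on.simps(2) differentiable_imp_continuous_on differentiable_on_def differentiable_at_withinI)
next
  case (Suc k)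
  then show ?case by (metis Ck_on.simps(2))
qed

lemma Ck_on_subset: "Ck_on k S f \<Longrightarrow> T \<subseteq> S \<Longrightarrow> Ck_on k T f"
  by (induction k arbitrary: f) (auto simp: Ck_on.simps(2) intro: continuous_on_subset)

lemma Ck_on_local:
  assumes "\<And>x. x \<in> S \<Longrightarrow> \<exists>T. open T \<and> x \<in> T \<and> Ck_on k T f"
  shows "Ck_on k S f"
  using assms
proof (induction k arbitrary: f)
  case 0
  then show ?case
    by (metis Ck_on.simps(1) continuous_on_eq_continuous_at continuous_at_imp_continuous_on)
next
  case (Suc k)
  have "f differentiable (at x)" if "x \<in> S" for x
    using Suc.prems[OF that] by (auto simp: Ck_on.simps(2))
  moreover have "Ck_on k S (\<lambda>x. frechet_derivative f (at x) v)" for v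
    by (rule Suc.IH) (use Suc.prems in \<open>metis Ck_on.simps(2)\<close>)
  ultimately show ?case by (simp add: Ck_on.simps(2))
qed

lemma Ck_on_const: "Ck_on k S (\<lambda>x. c)"
  by (induction k arbitrary: c) (auto simp: Ck_on.simps(2))

lemma Ck_on_bounded_linear:
  assumes "open S" "bounded_linear h" "Ck_on k S f"
  shows "Ck_on k S (\<lambda>x. h (f x))"
  using assms(3)
proof (induction k arbitrary: f)
  case 0
  then show ?case
    using bounded_linear.continuous_on[OF assms(2)] by auto
next
  case (Suc k)
  have "((\<lambda>x. h (f x)) has_derivative (\<lambda>v. h (frechet_derivative f (at x) v))) (at x)" if "x \<in> S" for x
    by (intro bounded_linear.has_derivative[OF assms(2)] Ck_on_has_derivative[OF Suc.prems that])
  then show ?case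
    by (rule Ck_on_Suc_I[OF assms(1)]) (auto intro: Suc.IH Ck_on_frechet_derivative[OF Suc.prems])
qed

lemma Ck_on_add:
  assumes "open S" "Ck_on k S f" "Ck_on k S g"
  shows "Ck_on k S (\<lambda>x. f x + g x)"
  using assms(2,3)
proof (induction k arbitrary: f g)
  case 0
  then show ?case by (auto intro: continuous_intros)
next
  case (Suc k)
  have "((\<lambda>x. f x + g x) has_derivative
      (\<lambda>v. frechet_derivative f (at x) v + frechet_derivative g (at x) v)) (at x)" if "x \<in> S" for x
    by (rule has_derivative_add[OF Ck_on_has_derivative[OF Suc.prems(1) that] Ck_on_has_derivative[OF Suc.prems(2) that]])
  then show ?case
    by (rule Ck_on_Suc_I[OF assms(1)]) (auto intro!: Suc.IH intro: Ck_on_frechet_derivative Suc.prems)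
qed

lemma Ck_on_mult:
  fixes f g :: "'a::real_normed_vector \<Rightarrow> real"
  assumes "open S" "Ck_on k S f" "Ck_on k S g"
  shows "Ck_on k S (\<lambda>x. f x * g x)"
  using assms(2,3)
proof (induction k arbitrary: f g)
  case 0
  then show ?case by (auto intro: continuous_intros)
next
  case (Suc k)
  have "Ck_on k S (\<lambda>x. f x * frechet_derivative g (at x) v + frechet_derivative f (at x) v * g x)" for v
    by (intro Ck_on_add[OF assms(1)] Suc.IH Ck_on_frechet_derivative[OF Suc.prems(1)]
        Ck_on_frechet_derivative[OF Suc.prems(2)] Ck_on_Suc_D[OF Suc.prems(1)] Ck_on_Suc_D[OF Suc.prems(2)])
  moreover have "((\<lambda>x. f x * g x) has_derivative
      (\<lambda>v. f x * frechet_derivative g (at x) v + frechet_derivative f (at x) v * g x)) (at x)" if "x \<in> S" for x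
    by (rule has_derivative_mult[OF Ck_on_has_derivative[OF Suc.prems(1) that] Ck_on_has_derivative[OF Suc.prems(2) that]])
  ultimately show ?case
    by (intro Ck_on_Suc_I[OF assms(1)]) auto
qed

lemma Ck_on_inverse:
  fixes f :: "'a::real_normed_vector \<Rightarrow> real"
  assumes "open S" "\<And>x. x \<in> S \<Longrightarrow> f x \<noteq> 0" "Ck_on k S f"
  shows "Ck_on k S (\<lambda>x. inverse (f x))"
  using assms(3)
proof (induction k)
  case 0
  then show ?case using assms(2) by (auto intro: continuous_intros)
next
  case (Suc k)
  \<comment> \<open>The derivative of \<open>1/f\<close> contains \<open>1/f\<close> again, but only
    one order lower, where the induction hypothesis supplies it.\<close>
  have ih: "Ck_on k S (\<lambda>x. inverse (f x))" using Suc Ck_on_Suc_D by blast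
  have "Ck_on k S (\<lambda>x. (-1) * (inverse (f x) * frechet_derivative f (at x) v * inverse (f x)))" for v
    by (intro Ck_on_mult Ck_on_const assms(1) Ck_on_frechet_derivative[OF Suc.prems] ih)
  moreover have "((\<lambda>x. inverse (f x)) has_derivative
      (\<lambda>v. (-1) * (inverse (f x) * frechet_derivative f (at x) v * inverse (f x)))) (at x)" if "x \<in> S" for x
    by (rule has_derivative_eq_rhs[OF Deriv.has_derivative_inverse[OF assms(2)[OF that]
            Ck_on_has_derivative[OF Suc.prems that]]]) auto
  ultimately show ?case
    by (intro Ck_on_Suc_I[OF assms(1)]) auto
qed

lemma Ck_on_sqrt:
  fixes f :: "'a::real_normed_vector \<Rightarrow> real"
  assumes "open S" "\<And>x. x \<in> S \<Longrightarrow> f x > 0" "Ck_on k S f"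
  shows "Ck_on k S (\<lambda>x. sqrt (f x))"
  using assms(3)
proof (induction k)
  case 0
  then show ?case by (auto intro: continuous_intros)
next
  case (Suc k)
  have ih: "Ck_on k S (\<lambda>x. inverse (sqrt (f x)))"
    by (intro Ck_on_inverse assms(1) Suc.IH Ck_on_Suc_D[OF Suc.prems]) (use assms(2) in fastforce)
  have "Ck_on k S (\<lambda>x. frechet_derivative f (at x) v * (1/2 * inverse (sqrt (f x))))" for v
    by (intro Ck_on_mult Ck_on_const assms(1) Ck_on_frechet_derivative[OF Suc.prems] ih)
  moreover have "((\<lambda>x. sqrt (f x)) has_derivative
      (\<lambda>v. frechet_derivative f (at x) v * (1/2 * inverse (sqrt (f x))))) (at x)" if "x \<in> S" for x
    by (rule has_derivative_eq_rhs[OF has_derivative_real_sqrt[OF assms(2)[OF that]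
            Ck_on_has_derivative[OF Suc.prems that]]]) (auto simp: divide_simps)
  ultimately show ?case
    by (intro Ck_on_Suc_I[OF assms(1)]) auto
qed

lemma smooth_on_cong:
  "open S \<Longrightarrow> (\<And>x. x \<in> S \<Longrightarrow> f x = g x) \<Longrightarrow> smooth_on S f \<Longrightarrow> smooth_on S g"
  unfolding smooth_on_def using Ck_on_cong by blast

lemma smooth_on_subset: "smooth_on S f \<Longrightarrow> T \<subseteq> S \<Longrightarrow> smooth_on T f"
  unfolding smooth_on_def using Ck_on_subset by blast

lemma smooth_on_local:
  "(\<And>x. x \<in> S \<Longrightarrow> \<exists>T. open T \<and> x \<in> T \<and> smooth_on T f) \<Longrightarrow> smooth_on S f"
  unfolding smooth_on_def by (auto intro!: Ck_on_local)

lemma smooth_on_const: "smooth_on S (\<lambda>x. c)"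
  by (simp add: smooth_on_def Ck_on_const)

lemma smooth_on_has_derivative:
  "smooth_on S f \<Longrightarrow> x \<in> S \<Longrightarrow> (f has_derivative frechet_derivative f (at x)) (at x)"
  unfolding smooth_on_def using Ck_on_has_derivative by blast

lemma smooth_on_frechet_derivative: "smooth_on S f \<Longrightarrow> smooth_on S (\<lambda>x. frechet_derivative f (at x) v)"
  unfolding smooth_on_def by (metis Ck_on_frechet_derivative)

lemma smooth_on_continuous_on: "smooth_on S f \<Longrightarrow> continuous_on S f"
  unfolding smooth_on_def using Ck_on.simps(1) by blast

lemma smooth_onI:
  assumes "open S" "\<And>x. x \<in> S \<Longrightarrow> (f has_derivative f' x) (at x)" "\<And>v. smooth_on S (\<lambda>x. f' x v)"
  shows "smooth_on S f"
  unfolding smooth_on_def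
proof
  fix k show "Ck_on k S f"
    using Ck_on_Suc_D Ck_on_Suc_I[OF assms(1,2)] assms(3) unfolding smooth_on_def by blast
qed

lemma smooth_on_bounded_linear:
  "open S \<Longrightarrow> bounded_linear h \<Longrightarrow> smooth_on S f \<Longrightarrow> smooth_on S (\<lambda>x. h (f x))"
  unfolding smooth_on_def using Ck_on_bounded_linear by blast

lemma smooth_on_ident: "open S \<Longrightarrow> smooth_on S (\<lambda>x. x)"
  by (rule smooth_onI[where f' = "\<lambda>x v. v"]) (auto intro: smooth_on_const)

lemma smooth_on_nth: "open S \<Longrightarrow> smooth_on S f \<Longrightarrow> smooth_on S (\<lambda>x. f x $ i)"
  by (rule smooth_on_bounded_linear[OF _ bounded_linear_vec_nth])

lemma smooth_on_coord: "open S \<Longrightarrow> smooth_on S (\<lambda>x. x $ i)"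
  by (intro smooth_on_nth smooth_on_ident)

lemma smooth_on_add: "open S \<Longrightarrow> smooth_on S f \<Longrightarrow> smooth_on S g \<Longrightarrow> smooth_on S (\<lambda>x. f x + g x)"
  unfolding smooth_on_def using Ck_on_add by blast

lemma smooth_on_mult:
  fixes f g :: "'a::real_normed_vector \<Rightarrow> real"
  shows "open S \<Longrightarrow> smooth_on S f \<Longrightarrow> smooth_on S g \<Longrightarrow> smooth_on S (\<lambda>x. f x * g x)"
  unfolding smooth_on_def using Ck_on_mult by blast

lemma smooth_on_uminus:
  fixes f :: "'a::real_normed_vector \<Rightarrow> real"
  shows "open S \<Longrightarrow> smooth_on S f \<Longrightarrow> smooth_on S (\<lambda>x. - f x)"
  using smooth_on_mult[of S "\<lambda>x. -1" f] smooth_on_const by auto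

lemma smooth_on_diff:
  fixes f g :: "'a::real_normed_vector \<Rightarrow> real"
  shows "open S \<Longrightarrow> smooth_on S f \<Longrightarrow> smooth_on S g \<Longrightarrow> smooth_on S (\<lambda>x. f x - g x)"
  using smooth_on_add[of S f "\<lambda>x. - g x"] smooth_on_uminus by auto

lemma smooth_on_inverse:
  fixes f :: "'a::real_normed_vector \<Rightarrow> real"
  shows "open S \<Longrightarrow> (\<And>x. x \<in> S \<Longrightarrow> f x \<noteq> 0) \<Longrightarrow> smooth_on S f \<Longrightarrow> smooth_on S (\<lambda>x. inverse (f x))"
  unfolding smooth_on_def using Ck_on_inverse by blast

lemma smooth_on_divide:
  fixes f g :: "'a::real_normed_vector \<Rightarrow> real"
  shows "open S \<Longrightarrow> smooth_on S f \<Longrightarrow> smooth_on S g \<Longrightarrow> (\<And>x. x \<in> S \<Longrightarrow> g x \<noteq> 0) \<Longrightarrow>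
    smooth_on S (\<lambda>x. f x / g x)"
  using smooth_on_mult[of S f "\<lambda>x. inverse (g x)"] smooth_on_inverse by (auto simp: divide_inverse)

lemma smooth_on_sqrt:
  fixes f :: "'a::real_normed_vector \<Rightarrow> real"
  shows "open S \<Longrightarrow> (\<And>x. x \<in> S \<Longrightarrow> f x > 0) \<Longrightarrow> smooth_on S f \<Longrightarrow> smooth_on S (\<lambda>x. sqrt (f x))"
  unfolding smooth_on_def using Ck_on_sqrt by blast

lemma smooth_on_power:
  fixes f :: "'a::real_normed_vector \<Rightarrow> real"
  shows "open S \<Longrightarrow> smooth_on S f \<Longrightarrow> smooth_on S (\<lambda>x. f x ^ n)"
  by (induction n) (auto intro: smooth_on_const smooth_on_mult)

lemmas smooth_on_intros = smooth_on_const smooth_on_coord smooth_on_add smooth_on_mult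
  smooth_on_uminus smooth_on_diff smooth_on_divide smooth_on_inverse smooth_on_power

section \<open>Symmetry of second derivatives\<close>

text \<open>The mean value theorem is applied twice: in direction \<open>v\<close> to the difference
  of \<open>F\<close> at \<open>x + s v + h w\<close> and \<open>x + s v\<close>, then in direction
  \<open>w\<close> to the derivative so obtained. The second difference is symmetric in
  \<open>v\<close> and \<open>w\<close>, which is what the symmetry of second derivatives rests
  on.\<close>

lemma second_difference:
  fixes F :: "'a::real_normed_vector \<Rightarrow> real"
  assumes "smooth_on V F" "0 < h"
    and V: "\<And>s t. 0 \<le> s \<Longrightarrow> s \<le> h \<Longrightarrow> 0 \<le> t \<Longrightarrow> t \<le> h \<Longrightarrow> x + s *\<^sub>R v + t *\<^sub>R w \<in> V"
  obtains s t where "0 < s" "s < h" "0 < t" "t < h"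
    "F (x + h *\<^sub>R v + h *\<^sub>R w) - F (x + h *\<^sub>R v) - F (x + h *\<^sub>R w) + F x =
      h * h * frechet_derivative (\<lambda>q. frechet_derivative F (at q) v) (at (x + s *\<^sub>R v + t *\<^sub>R w)) w"
proof -
  let ?Fv = "\<lambda>q. frechet_derivative F (at q) v"
  have d: "((\<lambda>s. G (q + s *\<^sub>R u)) has_real_derivative frechet_derivative G (at (q + s *\<^sub>R u)) u) (at s)"
    if "smooth_on V G" "q + s *\<^sub>R u \<in> V" for G :: "'a \<Rightarrow> real" and q u s
  proof -
    have "(G has_derivative frechet_derivative G (at (q + s *\<^sub>R u))) (at (q + s *\<^sub>R u))"
      using smooth_on_has_derivative that by blast
    moreover have "((\<lambda>s. q + s *\<^sub>R u) has_derivative (\<lambda>r. r *\<^sub>R u)) (at s)"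
      by (auto intro!: derivative_eq_intros)
    ultimately have "((\<lambda>s. G (q + s *\<^sub>R u)) has_derivative
        (\<lambda>r. frechet_derivative G (at (q + s *\<^sub>R u)) (r *\<^sub>R u))) (at s)"
      using has_derivative_compose by blast
    moreover have "linear (frechet_derivative G (at (q + s *\<^sub>R u)))"
      using smooth_on_has_derivative[OF that] has_derivative_linear by blast
    then have "frechet_derivative G (at (q + s *\<^sub>R u)) (r *\<^sub>R u) =
        frechet_derivative G (at (q + s *\<^sub>R u)) u * r" for r
      by (simp only: linear_scale real_scaleR_def mult.commute)
    ultimately show ?thesis
      by (simp only: has_field_derivative_def)
  qed
  have "\<exists>s>0. s < h \<and> (F (x + h *\<^sub>R w + h *\<^sub>R v) - F (x + h *\<^sub>R v)) - (F (x + h *\<^sub>R w + 0 *\<^sub>R v) - F (x + 0 *\<^sub>R v)) =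
      (h - 0) * (?Fv (x + h *\<^sub>R w + s *\<^sub>R v) - ?Fv (x + s *\<^sub>R v))"
    using V[of _ h] V[of _ 0] assms(2)
    by (intro MVT2 DERIV_diff d[OF assms(1)]) (auto simp: algebra_simps)
  then obtain s where s: "0 < s" "s < h"
    "F (x + h *\<^sub>R v + h *\<^sub>R w) - F (x + h *\<^sub>R v) - F (x + h *\<^sub>R w) + F x
      = h * (?Fv (x + s *\<^sub>R v + h *\<^sub>R w) - ?Fv (x + s *\<^sub>R v))"
    by (auto simp: algebra_simps)
  have "\<exists>t>0. t < h \<and> ?Fv (x + s *\<^sub>R v + h *\<^sub>R w) - ?Fv (x + s *\<^sub>R v + 0 *\<^sub>R w) =
      (h - 0) * frechet_derivative ?Fv (at (x + s *\<^sub>R v + t *\<^sub>R w)) w"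
    using V[of s] s assms(2)
    by (intro MVT2 d[OF smooth_on_frechet_derivative[OF assms(1)]]) auto
  then obtain t where "0 < t" "t < h" "?Fv (x + s *\<^sub>R v + h *\<^sub>R w) - ?Fv (x + s *\<^sub>R v) =
      h * frechet_derivative ?Fv (at (x + s *\<^sub>R v + t *\<^sub>R w)) w" by auto
  with s show ?thesis using that by simp
qed

text \<open>Both mixed derivatives, each taken at some point of a small parallelogram, equal the
  same second difference divided by \<open>h * h\<close>; continuity at \<open>x\<close> then forces
  them to agree.\<close>

lemma frechet_derivative_commute:
  fixes F :: "'a::real_normed_vector \<Rightarrow> real"
  assumes "open V" "smooth_on V F" "x \<in> V"
  shows "frechet_derivative (\<lambda>q. frechet_derivative F (at q) v) (at x) w =
    frechet_derivative (\<lambda>q. frechet_derivative F (at q) w) (at x) v" (is "?A x = ?B x")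
proof (rule ccontr)
  assume ne: "?A x \<noteq> ?B x"
  define e where "e = \<bar>?A x - ?B x\<bar> / 2"
  have e: "e > 0" using ne by (simp add: e_def)
  have cA: "isCont ?A x" and cB: "isCont ?B x"
    using assms smooth_on_continuous_on[OF smooth_on_frechet_derivative[OF smooth_on_frechet_derivative[OF assms(2)]]]
    by (auto simp: continuous_on_eq_continuous_at)
  obtain r where r: "r > 0" "ball x r \<subseteq> V" "\<And>q. dist q x < r \<Longrightarrow> \<bar>?A q - ?A x\<bar> < e" "\<And>q. dist q x < r \<Longrightarrow> \<bar>?B q - ?B x\<bar> < e"
  proof -
    obtain r1 where "r1 > 0" "ball x r1 \<subseteq> V" using assms openE by blast
    moreover obtain r2 where "r2 > 0" "\<And>q. dist q x < r2 \<Longrightarrow> \<bar>?A q - ?A x\<bar> < e"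
      using cA e unfolding continuous_at_eps_delta dist_real_def by metis
    moreover obtain r3 where "r3 > 0" "\<And>q. dist q x < r3 \<Longrightarrow> \<bar>?B q - ?B x\<bar> < e"
      using cB e unfolding continuous_at_eps_delta dist_real_def by metis
    ultimately show ?thesis by (intro that[of "min r1 (min r2 r3)"]) auto
  qed
  \<comment> \<open>With this \<open>h\<close> every point of the parallelogram with sides
    \<open>h v\<close> and \<open>h w\<close> is closer than \<open>r\<close> to \<open>x\<close>;
    the summand 1 covers \<open>v = w = 0\<close>.\<close>
  define h where "h = r / (2 * (norm v + norm w + 1))"
  have nn: "norm v + norm w + 1 > 0" by (simp add: add_nonneg_pos)
  have h: "h > 0" using r nn by (simp add: h_def)
  have near: "dist (x + s *\<^sub>R v + t *\<^sub>R w) x < r" "dist (x + t *\<^sub>R w + s *\<^sub>R v) x < r"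
    if "0 \<le> s" "s \<le> h" "0 \<le> t" "t \<le> h" for s t
  proof -
    have "norm (s *\<^sub>R v + t *\<^sub>R w) \<le> s * norm v + t * norm w"
      using norm_triangle_ineq[of "s *\<^sub>R v" "t *\<^sub>R w"] that by simp
    also have "\<dots> \<le> h * norm v + h * norm w" using that by (intro add_mono mult_right_mono) auto
    also have "\<dots> < h * (2 * (norm v + norm w + 1))"
      using h mult_pos_pos[OF h nn] by (simp add: distrib_left)
    also have "\<dots> = r" using nn by (simp add: h_def)
    finally show "dist (x + s *\<^sub>R v + t *\<^sub>R w) x < r" "dist (x + t *\<^sub>R w + s *\<^sub>R v) x < r"
      by (auto simp: dist_norm algebra_simps)
  qed
  have inV: "x + s *\<^sub>R v + t *\<^sub>R w \<in> V" "x + t *\<^sub>R w + s *\<^sub>R v \<in> V"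
    if "0 \<le> s" "s \<le> h" "0 \<le> t" "t \<le> h" for s t
    using near[OF that] r(2) by (auto simp: dist_commute)
  obtain s t where st: "0 < s" "s < h" "0 < t" "t < h"
    "F (x + h *\<^sub>R v + h *\<^sub>R w) - F (x + h *\<^sub>R v) - F (x + h *\<^sub>R w) + F x = h * h * ?A (x + s *\<^sub>R v + t *\<^sub>R w)"
    by (rule second_difference[OF assms(2) h inV(1)])
  obtain s' t' where st': "0 < s'" "s' < h" "0 < t'" "t' < h"
    "F (x + h *\<^sub>R w + h *\<^sub>R v) - F (x + h *\<^sub>R w) - F (x + h *\<^sub>R v) + F x = h * h * ?B (x + s' *\<^sub>R w + t' *\<^sub>R v)"
    by (rule second_difference[OF assms(2) h inV(2)])
  have "x + h *\<^sub>R w + h *\<^sub>R v = x + h *\<^sub>R v + h *\<^sub>R w" by simp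
  then have "h * h * ?A (x + s *\<^sub>R v + t *\<^sub>R w) = h * h * ?B (x + s' *\<^sub>R w + t' *\<^sub>R v)"
    using st(5) st'(5) by (simp add: algebra_simps)
  then have "?A (x + s *\<^sub>R v + t *\<^sub>R w) = ?B (x + s' *\<^sub>R w + t' *\<^sub>R v)" using h by simp
  moreover have "\<bar>?A (x + s *\<^sub>R v + t *\<^sub>R w) - ?A x\<bar> < e" using near[of s t] st r(3) by simp
  moreover have "\<bar>?B (x + s' *\<^sub>R w + t' *\<^sub>R v) - ?B x\<bar> < e" using near[of t' s'] st' r(4) by simp
  \<comment> \<open>One number cannot be closer than half of \<open>\<bar>A - B\<bar>\<close> to
    both \<open>A\<close> and \<open>B\<close>.\<close>
  moreover have False if "a = b" "\<bar>a - A\<bar> < \<bar>A - B\<bar> / 2" "\<bar>b - B\<bar> < \<bar>A - B\<bar> / 2" for a b A B :: real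
    using that by (simp add: abs_if split: if_splits)
  ultimately show False unfolding e_def by blast
qed

section \<open>Gradients in the plane\<close>

text \<open>Frechet differentiability with gradient \<open>(a, b)\<close>, which is more than
  existence of the two partial derivatives; this form admits the chain rule along curves.\<close>

definition has_partials :: "(real^2 \<Rightarrow> real) \<Rightarrow> real \<Rightarrow> real \<Rightarrow> real^2 \<Rightarrow> bool" where
  "has_partials F a b p \<longleftrightarrow> (F has_derivative (\<lambda>h. a * h $ 1 + b * h $ 2)) (at p)"

lemma has_partials_unique:
  assumes "has_partials F a b p" "has_partials F a' b' p"
  shows "a = a'" "b = b'"
proof -
  have "(\<lambda>h::real^2. a * h $ 1 + b * h $ 2) = (\<lambda>h. a' * h $ 1 + b' * h $ 2)"
    using assms has_derivative_unique unfolding has_partials_def by blast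
  from fun_cong[OF this, of "axis 1 1"] fun_cong[OF this, of "axis 2 1"]
  show "a = a'" "b = b'" by (auto simp: axis_def)
qed

lemma has_partials_partial:
  assumes "F differentiable (at p)"
  shows "has_partials F (partial 1 F p) (partial 2 F p) p"
proof -
  have d: "(F has_derivative frechet_derivative F (at p)) (at p)"
    using assms frechet_derivative_works by blast
  then have l: "linear (frechet_derivative F (at p))" using has_derivative_linear by blast
  have "frechet_derivative F (at p) h = partial 1 F p * h $ 1 + partial 2 F p * h $ 2" for h
  proof -
    have "h = h $ 1 *\<^sub>R axis 1 1 + h $ 2 *\<^sub>R axis 2 1"
      by (simp add: vec_eq_iff forall_2 axis_def)
    then have "frechet_derivative F (at p) h
        = frechet_derivative F (at p) (h $ 1 *\<^sub>R axis 1 1 + h $ 2 *\<^sub>R axis 2 1)" by simp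
    also have "\<dots> = partial 1 F p * h $ 1 + partial 2 F p * h $ 2"
      using l by (simp add: linear_add linear_scale partial_def)
    finally show ?thesis .
  qed
  then have "frechet_derivative F (at p) = (\<lambda>h. partial 1 F p * h $ 1 + partial 2 F p * h $ 2)"
    by (rule ext)
  then show ?thesis using d unfolding has_partials_def by simp
qed

lemma has_partials_differentiable: "has_partials F a b p \<Longrightarrow> F differentiable (at p)"
  unfolding has_partials_def differentiable_def by blast

text \<open>Later computations follow one scheme: \<open>has_partials_intros\<close> assembles the
  gradient with schematic coefficients, and this lemma reads off the values of
  \<open>partial\<close>.\<close>

lemma partial_eq: 
  assumes "has_partials F a b p"
  shows "partial 1 F p = a" "partial 2 F p = b"
  using has_partials_unique[OF has_partials_partial[OF has_partials_differentiable] assms] assms by auto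

lemma smooth_on_differentiable: "smooth_on V F \<Longrightarrow> p \<in> V \<Longrightarrow> F differentiable (at p)"
  using smooth_on_has_derivative differentiable_def by blast

lemma smooth_on_has_partials: "smooth_on V F \<Longrightarrow> p \<in> V \<Longrightarrow> has_partials F (partial 1 F p) (partial 2 F p) p"
  by (intro has_partials_partial smooth_on_differentiable)

lemma smooth_on_partial: "smooth_on V F \<Longrightarrow> smooth_on V (partial i F)"
  using smooth_on_frechet_derivative[of V F "axis i 1"] by (simp add: partial_def[abs_def])

lemma partial_commute:
  "open V \<Longrightarrow> smooth_on V F \<Longrightarrow> p \<in> V \<Longrightarrow> partial i (partial j F) p = partial j (partial i F) p"
  using frechet_derivative_commute[of V F p "axis j 1" "axis i 1"] by (simp add: partial_def[abs_def])

lemma has_partials_cong: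
  assumes "has_partials F a b p" "open V" "p \<in> V" "\<And>q. q \<in> V \<Longrightarrow> F q = G q"
  shows "has_partials G a b p"
  using has_derivative_transform_within_open assms unfolding has_partials_def by blast

lemma partial_cong:
  assumes "smooth_on V F" "open V" "p \<in> V" "\<And>q. q \<in> V \<Longrightarrow> F q = G q"
  shows "partial i G p = partial i F p"
proof -
  have "has_partials G (partial 1 F p) (partial 2 F p) p"
    using has_partials_cong[OF smooth_on_has_partials] assms by blast
  from partial_eq[OF this] show ?thesis using exhaust_2[of i] by auto
qed

lemma has_partials_const: "has_partials (\<lambda>q. c) 0 0 p"
  by (simp add: has_partials_def)

lemma has_partials_coord1: "has_partials (\<lambda>q. q $ 1) 1 0 p"
  and has_partials_coord2: "has_partials (\<lambda>q. q $ 2) 0 1 p"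
  by (auto simp: has_partials_def intro: bounded_linear_imp_has_derivative bounded_linear_vec_nth)

lemma has_partials_add:
  "has_partials F a b p \<Longrightarrow> has_partials G a' b' p \<Longrightarrow> has_partials (\<lambda>q. F q + G q) (a + a') (b + b') p"
  unfolding has_partials_def by (drule (1) has_derivative_add) (simp add: algebra_simps)

lemma has_partials_diff:
  "has_partials F a b p \<Longrightarrow> has_partials G a' b' p \<Longrightarrow> has_partials (\<lambda>q. F q - G q) (a - a') (b - b') p"
  unfolding has_partials_def by (drule (1) has_derivative_diff) (simp add: algebra_simps)

lemma has_partials_uminus: "has_partials F a b p \<Longrightarrow> has_partials (\<lambda>q. - F q) (- a) (- b) p"
  unfolding has_partials_def by (drule has_derivative_minus) (simp add: algebra_simps)

lemma has_partials_mult: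
  "has_partials F a b p \<Longrightarrow> has_partials G a' b' p \<Longrightarrow>
    has_partials (\<lambda>q. F q * G q) (F p * a' + a * G p) (F p * b' + b * G p) p"
  unfolding has_partials_def by (drule (1) has_derivative_mult) (simp add: algebra_simps)

lemma has_partials_compose:
  assumes "has_partials F a b p" "(f has_real_derivative d) (at (F p))"
  shows "has_partials (\<lambda>q. f (F q)) (d * a) (d * b) p"
  using has_derivative_compose[OF assms(1)[unfolded has_partials_def] assms(2)[unfolded has_field_derivative_def]]
  unfolding has_partials_def by (simp add: algebra_simps)

lemma has_partials_power:
  "has_partials F a b p \<Longrightarrow> has_partials (\<lambda>q. F q ^ n) (n * F p ^ (n - 1) * a) (n * F p ^ (n - 1) * b) p"
  by (rule has_partials_compose) (auto intro!: derivative_eq_intros)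

lemma has_partials_divide:
  assumes "has_partials F a b p" "has_partials G a' b' p" "G p \<noteq> 0"
  shows "has_partials (\<lambda>q. F q / G q) ((a * G p - F p * a') / (G p)\<^sup>2) ((b * G p - F p * b') / (G p)\<^sup>2) p"
proof -
  have "has_partials (\<lambda>q. inverse (G q)) (- (inverse (G p))\<^sup>2 * a') (- (inverse (G p))\<^sup>2 * b') p"
    by (rule has_partials_compose[OF assms(2)]) (use assms(3) in \<open>auto intro!: derivative_eq_intros simp: power2_eq_square\<close>)
  from has_partials_mult[OF assms(1) this] show ?thesis
    using assms(3) by (simp add: divide_simps power2_eq_square algebra_simps)
qed

lemmas has_partials_intros = has_partials_const has_partials_coord1 has_partials_coord2 has_partials_add
  has_partials_diff has_partials_uminus has_partials_mult has_partials_power has_partials_divide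

text \<open>Meant for functions built from antiderivatives, which are accessible only through their
  gradient.\<close>

lemma smooth_on_from_partials:
  assumes "open V" "\<And>p. p \<in> V \<Longrightarrow> has_partials F (a p) (b p) p" "smooth_on V a" "smooth_on V b"
  shows "smooth_on V F"
  by (rule smooth_onI[OF assms(1), where f' = "\<lambda>p h. a p * h $ 1 + b p * h $ 2"])
    (use assms in \<open>auto simp: has_partials_def intro!: smooth_on_intros\<close>)

section \<open>The geodesic equation\<close>

lemma smooth_on_has_vector_derivative:
  "smooth_on I c \<Longrightarrow> t \<in> I \<Longrightarrow> (c has_vector_derivative vector_derivative c (at t)) (at t)"
  for c :: "real \<Rightarrow> 'a::real_normed_vector"
  using smooth_on_differentiable[of I c t] vector_derivative_works by blast

lemma smooth_on_vector_derivative: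
  fixes c :: "real \<Rightarrow> 'a::real_normed_vector"
  assumes "open I" "smooth_on I c"
  shows "smooth_on I (\<lambda>t. vector_derivative c (at t))"
proof (rule smooth_on_cong[OF assms(1) _ smooth_on_frechet_derivative[OF assms(2), of 1]])
  fix t assume "t \<in> I"
  from smooth_on_has_vector_derivative[OF assms(2) this]
  have "(c has_derivative (\<lambda>x. x *\<^sub>R vector_derivative c (at t))) (at t)"
    by (simp add: has_vector_derivative_def)
  from frechet_derivative_at[OF this]
  show "frechet_derivative c (at t) 1 = vector_derivative c (at t)" by (metis scaleR_one)
qed

lemma smooth_on_deriv:
  fixes f :: "real \<Rightarrow> real"
  assumes "open I" "smooth_on I f"
  shows "smooth_on I (deriv f)" "t \<in> I \<Longrightarrow> (f has_real_derivative deriv f t) (at t)"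
proof -
  have *: "(f has_real_derivative deriv f t) (at t) \<and> frechet_derivative f (at t) 1 = deriv f t" if "t \<in> I" for t
  proof -
    have "(f has_real_derivative deriv f t) (at t)"
      using smooth_on_differentiable[OF assms(2) that] DERIV_deriv_iff_real_differentiable by blast
    moreover from this have "frechet_derivative f (at t) = (*) (deriv f t)"
      using frechet_derivative_at unfolding has_field_derivative_def by metis
    ultimately show ?thesis by simp
  qed
  then show "t \<in> I \<Longrightarrow> (f has_real_derivative deriv f t) (at t)" by blast
  show "smooth_on I (deriv f)"
    by (rule smooth_on_cong[OF assms(1) _ smooth_on_frechet_derivative[OF assms(2), of 1]]) (use * in blast)
qed

lemma has_vector_derivative_nth:
  fixes c :: "real \<Rightarrow> real^'n"
  shows "(c has_vector_derivative v) F \<Longrightarrow> ((\<lambda>t. c t $ k) has_real_derivative v $ k) F"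
  unfolding has_real_derivative_iff_has_vector_derivative
  by (rule bounded_linear.has_vector_derivative[OF bounded_linear_vec_nth])

text \<open>The quadratic form \<Gamma>^k(v, v) at v = (x, y), written out so that the geodesic
  equation becomes polynomial in the velocity.\<close>

definition christoffel_form :: "(real^2 \<Rightarrow> real^2^2) \<Rightarrow> real^2 \<Rightarrow> 2 \<Rightarrow> real \<Rightarrow> real \<Rightarrow> real" where
  "christoffel_form g p k x y = christoffel g p k 1 1 * x\<^sup>2 +
     (christoffel g p k 1 2 + christoffel g p k 2 1) * x * y + christoffel g p k 2 2 * y\<^sup>2"

lemma geodesicD:
  assumes "geodesic g U I c" "t \<in> I"
  shows "open I" "smooth_on I c" "c t \<in> U" "vector_derivative c (at t) \<noteq> 0"
    "(c has_vector_derivative vector_derivative c (at t)) (at t)"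
    "((\<lambda>s. vector_derivative c (at s)) has_vector_derivative
      vector_derivative (\<lambda>s. vector_derivative c (at s)) (at t)) (at t)"
    "vector_derivative (\<lambda>s. vector_derivative c (at s)) (at t) $ k =
      - christoffel_form g (c t) k (vector_derivative c (at t) $ 1) (vector_derivative c (at t) $ 2)"
proof -
  show o: "open I" and s: "smooth_on I c" and "c t \<in> U" and "vector_derivative c (at t) \<noteq> 0"
    using assms by (auto simp: geodesic_def open_interval_def Let_def)
  show "(c has_vector_derivative vector_derivative c (at t)) (at t)"
    by (rule smooth_on_has_vector_derivative[OF s assms(2)])
  show "((\<lambda>s. vector_derivative c (at s)) has_vector_derivative
      vector_derivative (\<lambda>s. vector_derivative c (at s)) (at t)) (at t)"
    by (rule smooth_on_has_vector_derivative[OF smooth_on_vector_derivative[OF o s] assms(2)])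
  let ?v = "vector_derivative c (at t)"
  have "vector_derivative (\<lambda>s. vector_derivative c (at s)) (at t) $ k
      + (\<Sum>i\<in>UNIV. \<Sum>j\<in>UNIV. christoffel g (c t) k i j * ?v $ i * ?v $ j) = 0"
    using assms unfolding geodesic_def Let_def by blast
  then show "vector_derivative (\<lambda>s. vector_derivative c (at s)) (at t) $ k =
      - christoffel_form g (c t) k (?v $ 1) (?v $ 2)"
    unfolding christoffel_form_def by (simp add: sum_2 power2_eq_square algebra_simps)
qed

text \<open>Elimination of the parameter: differentiating \<open>c\<^sub>2 = f(c\<^sub>1)\<close>
  twice brings in \<open>f''\<close>, and the geodesic equation divided by the square of the first
  velocity component remains. Only the traces of \<open>c\<close> and of the graph are related, so
  the parameter \<open>t0\<close> over \<open>z0\<close> comes from membership in the image.\<close>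

lemma geodesic_graph_equation:
  assumes geo: "geodesic g U J c" and img: "c ` J = (\<lambda>z. vector [z, f z]) ` I"
    and I: "open I" "smooth_on I f" "z0 \<in> I"
  shows "deriv (deriv f) z0 = deriv f z0 * christoffel_form g (vector [z0, f z0]) 1 1 (deriv f z0)
    - christoffel_form g (vector [z0, f z0]) 2 1 (deriv f z0)"
proof -
  define v where "v t = vector_derivative c (at t)" for t
  define a where "a t = vector_derivative v (at t)" for t
  have vfun: "v = (\<lambda>t. vector_derivative c (at t))" by (simp add: v_def fun_eq_iff)
  have "vector [z0, f z0] \<in> c ` J" unfolding img using I(3) by (rule imageI)
  then obtain t0 where t0: "t0 \<in> J" "c t0 = vector [z0, f z0]" by (metis imageE)
  have J: "open J" using geodesicD(1)[OF geo t0(1)] .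
  have gr: "c t $ 1 \<in> I \<and> c t $ 2 = f (c t $ 1)" if "t \<in> J" for t
  proof -
    have "c t \<in> (\<lambda>z. vector [z, f z]) ` I" using img that by blast
    then show ?thesis by auto
  qed
  have dc: "((\<lambda>t. c t $ k) has_real_derivative v t $ k) (at t)"
    and dv: "((\<lambda>t. v t $ k) has_real_derivative a t $ k) (at t)" if "t \<in> J" for t k
    using geodesicD(5,6)[OF geo that] has_vector_derivative_nth unfolding a_def vfun by blast+
  have df: "(f has_real_derivative deriv f z) (at z)" "(deriv f has_real_derivative deriv (deriv f) z) (at z)"
    if "z \<in> I" for z
    using smooth_on_deriv[OF I(1,2)] smooth_on_deriv(2)[OF I(1) smooth_on_deriv(1)[OF I(1,2)]] that by auto
  have v2: "v t $ 2 = deriv f (c t $ 1) * v t $ 1" if "t \<in> J" for t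
  proof -
    have "((\<lambda>t. f (c t $ 1)) has_real_derivative deriv f (c t $ 1) * v t $ 1) (at t)"
      using DERIV_chain2[OF df(1) dc[OF that, of 1]] gr[OF that] by simp
    then have "((\<lambda>t. c t $ 2) has_real_derivative deriv f (c t $ 1) * v t $ 1) (at t)"
      by (rule has_field_derivative_transform_within_open[OF _ J that]) (use gr in auto)
    then show ?thesis using dc[OF that, of 2] DERIV_unique by blast
  qed
  let ?z = "\<lambda>t. c t $ 1"
  have "((\<lambda>t. deriv f (?z t) * v t $ 1) has_real_derivative
      deriv f (?z t0) * a t0 $ 1 + deriv (deriv f) (?z t0) * v t0 $ 1 * v t0 $ 1) (at t0)"
    using DERIV_mult'[OF DERIV_chain2[OF df(2) dc[OF t0(1), of 1]] dv[OF t0(1), of 1]] gr[OF t0(1)] by simp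
  then have "((\<lambda>t. v t $ 2) has_real_derivative
      deriv f (?z t0) * a t0 $ 1 + deriv (deriv f) (?z t0) * v t0 $ 1 * v t0 $ 1) (at t0)"
    by (rule has_field_derivative_transform_within_open[OF _ J t0(1)]) (use v2 in auto)
  then have a2: "a t0 $ 2 = deriv f z0 * a t0 $ 1 + deriv (deriv f) z0 * (v t0 $ 1)\<^sup>2"
    using dv[OF t0(1), of 2] DERIV_unique t0(2) by (fastforce simp: power2_eq_square)
  \<comment> \<open>The velocity is nonzero and its second component is \<open>f'\<close> times the
    first, so the first cannot vanish.\<close>
  have "v t0 $ 1 \<noteq> 0"
  proof
    assume "v t0 $ 1 = 0"
    then have "v t0 = 0" using v2[OF t0(1)] by (simp add: vec_eq_iff forall_2)
    then show False using geodesicD(4)[OF geo t0(1)] v_def by simp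
  qed
  moreover have "a t0 $ k = - christoffel_form g (vector [z0, f z0]) k 1 (deriv f z0) * (v t0 $ 1)\<^sup>2" for k
    using geodesicD(7)[OF geo t0(1), of k] v2[OF t0(1)] t0(2)
    by (simp add: a_def vfun christoffel_form_def power2_eq_square algebra_simps)
  moreover from this have "(v t0 $ 1)\<^sup>2 * (deriv (deriv f) z0 - (deriv f z0 * christoffel_form g (vector [z0, f z0]) 1 1 (deriv f z0)
      - christoffel_form g (vector [z0, f z0]) 2 1 (deriv f z0))) = 0"
    using a2 by (simp add: algebra_simps)
  ultimately show ?thesis by simp
qed

lemma vector_2_eq_axis: "(vector [x, y] :: real^2) = x *\<^sub>R axis 1 1 + y *\<^sub>R axis 2 1"
  by (simp add: vec_eq_iff forall_2 axis_def)

text \<open>For every \<open>k > 0\<close> with \<open>\<epsilon> + k z\<^sub>0\<^sup>2 > 0\<close>, the conic \<open>k\<^sup>2 (y - l)\<^sup>2 - k z\<^sup>2 = \<epsilon>\<close> is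
  a geodesic through a given point with slope \<open>z\<^sub>0 / sqrt (\<epsilon> + k z\<^sub>0\<^sup>2)\<close>. This provides enough slopes
  to determine the cubic form of the geodesic equation.\<close>

lemma christoffel_cubic_at_slope:
  fixes p :: "real^2"
  assumes U: "open U" "p \<in> U" and ode: "geodesics_given_by_ode \<epsilon> g U"
    and k: "k > 0" "\<epsilon> + k * (p $ 1)\<^sup>2 > 0" and z: "p $ 1 \<noteq> 0"
    and q: "q = p $ 1 / sqrt (\<epsilon> + k * (p $ 1)\<^sup>2)"
  shows "christoffel_form g p 2 1 q - q * christoffel_form g p 1 1 q = - \<epsilon> * q ^ 3 / (p $ 1) ^ 3"
proof -
  define z0 where "z0 = p $ 1"
  define r where "r z = sqrt (\<epsilon> + k * z\<^sup>2)" for z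
  \<comment> \<open>The branch \<open>y = l + sqrt (\<epsilon> + k z\<^sup>2) / k\<close> of the
    conic, with \<open>l\<close> chosen so that it passes through \<open>p\<close>; then
    \<open>f' = z / r\<close> and \<open>f'' = \<epsilon> / r\<^sup>3\<close>.\<close>
  define f where "f z = p $ 2 + (r z - r z0) / k" for z
  have p: "vector [z0, f z0] = p" by (simp add: vec_eq_iff forall_2 f_def z0_def)
  have "open {z. 0 < \<epsilon> + k * z\<^sup>2}" by (intro open_Collect_less continuous_intros)
  then have ev1: "\<forall>\<^sub>F z in nhds z0. \<epsilon> + k * z\<^sup>2 > 0"
    using eventually_nhds_in_open[of "{z. 0 < \<epsilon> + k * z\<^sup>2}" z0] k(2) by (simp add: z0_def)
  have "isCont (\<lambda>z. vector [z, f z] :: real^2) z0"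
    unfolding vector_2_eq_axis f_def r_def using k by (intro continuous_intros) auto
  then have "((\<lambda>z. vector [z, f z] :: real^2) \<longlongrightarrow> vector [z0, f z0]) (nhds z0)"
    using tendsto_at_iff_tendsto_nhds[of "\<lambda>z. vector [z, f z] :: real^2" z0] by (simp add: isCont_def)
  then have "\<forall>\<^sub>F z in nhds z0. vector [z, f z] \<in> U"
    using U by (intro topological_tendstoD) (auto simp: p)
  with ev1 have "\<forall>\<^sub>F z in nhds z0. \<epsilon> + k * z\<^sup>2 > 0 \<and> vector [z, f z] \<in> U" by (rule eventually_conj)
  then obtain d where d: "d > 0" "\<And>z. dist z z0 < d \<Longrightarrow> \<epsilon> + k * z\<^sup>2 > 0 \<and> vector [z, f z] \<in> U"
    unfolding eventually_nhds_metric by blast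
  define I where "I = ball z0 d"
  have I: "open I" "z0 \<in> I" "open_interval I" "\<And>z. z \<in> I \<Longrightarrow> \<epsilon> + k * z\<^sup>2 > 0 \<and> vector [z, f z] \<in> U"
    using d by (auto simp: I_def open_interval_def dist_commute is_interval_ball_real)
  have rpos: "r z > 0" if "z \<in> I" for z using I(4)[OF that] by (simp add: r_def)
  have sm: "smooth_on I f"
    unfolding f_def[abs_def] r_def[abs_def]
    using I k(1) by (intro smooth_on_intros smooth_on_sqrt smooth_on_ident) auto
  have df: "(f has_real_derivative z / r z) (at z)" if "z \<in> I" for z
    unfolding f_def[abs_def] r_def using I(4)[OF that] k(1)
    by (auto intro!: derivative_eq_intros simp: field_simps)
  then have f1: "deriv f z = z / r z" if "z \<in> I" for z using that DERIV_imp_deriv by blast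
  have d2: "(deriv f has_real_derivative \<epsilon> / r z ^ 3) (at z)" if "z \<in> I" for z
  proof -
    have sq: "(sqrt (\<epsilon> + k * z\<^sup>2))\<^sup>2 = \<epsilon> + k * z\<^sup>2" using I(4)[OF that] by simp
    have "((\<lambda>z. z / r z) has_real_derivative (r z - z * (k * z / r z)) / (r z * r z)) (at z)"
      unfolding r_def using I(4)[OF that]
      by (auto intro!: derivative_eq_intros simp: field_simps)
    also have "(r z - z * (k * z / r z)) / (r z * r z) = \<epsilon> / r z ^ 3"
      using rpos[OF that] sq unfolding r_def
      by (simp add: divide_simps power2_eq_square power3_eq_cube)
    finally show ?thesis
      by (rule has_field_derivative_transform_within_open[OF _ I(1) that]) (simp add: f1)
  qed
  have f2: "deriv (deriv f) z = \<epsilon> / r z ^ 3" if "z \<in> I" for z using d2[OF that] DERIV_imp_deriv by blast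
  have "unparam_geodesic g U ((\<lambda>z. vector [z, f z]) ` I)"
    using ode I sm f1 f2 unfolding geodesics_given_by_ode_def by (auto simp: power_divide)
  then obtain J c where "geodesic g U J c" "c ` J = (\<lambda>z. vector [z, f z]) ` I"
    unfolding unparam_geodesic_def by metis
  from geodesic_graph_equation[OF this I(1) sm I(2)]
  have "deriv (deriv f) z0 = deriv f z0 * christoffel_form g p 1 1 (deriv f z0)
    - christoffel_form g p 2 1 (deriv f z0)" by (simp add: p)
  moreover have "deriv f z0 = q" using f1[OF I(2)] by (simp add: q z0_def r_def)
  moreover have "deriv (deriv f) z0 = \<epsilon> * q ^ 3 / z0 ^ 3"
    using f2[OF I(2)] z by (simp add: q z0_def r_def power_divide)
  ultimately show ?thesis by (simp add: z0_def)
qed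

text \<open>As a condition on the slope the identity is a polynomial equation of degree at most 3
  with infinitely many known roots, so it holds coefficientwise. This also settles the direction
  \<open>x = 0\<close>, which no graph over the \<open>z\<close>-axis shows.\<close>

lemma christoffel_cubic:
  fixes p :: "real^2"
  assumes U: "open U" "p \<in> U" and ode: "geodesics_given_by_ode \<epsilon> g U" and z: "p $ 1 \<noteq> 0"
    and eps: "\<epsilon> = 1 \<or> \<epsilon> = -1"
  shows "x * christoffel_form g p 2 x y - y * christoffel_form g p 1 x y = - \<epsilon> * y ^ 3 / (p $ 1) ^ 3"
proof -
  define G where "G k i j = christoffel g p k i j" for k i j
  define P where "P = [: G 2 1 1, G 2 1 2 + G 2 2 1 - G 1 1 1, G 2 2 2 - G 1 1 2 - G 1 2 1,
     \<epsilon> / (p $ 1) ^ 3 - G 1 2 2 :]"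
  \<comment> \<open>The bound gives \<open>k z\<^sup>2 > 1\<close>, so that
    \<open>\<epsilon> + k z\<^sup>2\<close> is positive for either sign of \<epsilon>.\<close>
  define K where "K = {1 / (p $ 1)\<^sup>2 <..}"
  let ?q = "\<lambda>k. p $ 1 / sqrt (\<epsilon> + k * (p $ 1)\<^sup>2)"
  have K: "k > 0" "\<epsilon> + k * (p $ 1)\<^sup>2 > 0" if "k \<in> K" for k
  proof -
    have k: "1 / (p $ 1)\<^sup>2 < k" using that by (simp add: K_def)
    have "0 < 1 / (p $ 1)\<^sup>2" using z by simp
    then show "k > 0" using k by linarith
    have "1 < k * (p $ 1)\<^sup>2" using k z by (simp add: divide_less_eq)
    then show "\<epsilon> + k * (p $ 1)\<^sup>2 > 0" using eps by auto
  qed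
  have "poly P q = 0"
    if "christoffel_form g p 2 1 q - q * christoffel_form g p 1 1 q = - \<epsilon> * q ^ 3 / (p $ 1) ^ 3" for q
    using that by (simp add: P_def G_def christoffel_form_def power2_eq_square power3_eq_cube algebra_simps)
  then have "poly P (?q k) = 0" if "k \<in> K" for k
    using christoffel_cubic_at_slope[OF U ode K[OF that] z refl] by blast
  then have "?q ` K \<subseteq> {x. poly P x = 0}" by blast
  moreover have "inj_on ?q K"
    using K(2) z by (intro inj_onI) (simp add: frac_eq_eq)
  moreover have "infinite K" unfolding K_def by (rule infinite_Ioi)
  ultimately have "infinite {x. poly P x = 0}" by (meson finite_imageD finite_subset)
  then have "P = 0" using poly_roots_finite by blast
  then have "G 2 1 1 = 0" "G 2 1 2 + G 2 2 1 = G 1 1 1" "G 2 2 2 = G 1 1 2 + G 1 2 1" "G 1 2 2 = \<epsilon> / (p $ 1) ^ 3"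
    by (auto simp: P_def)
  then show ?thesis unfolding christoffel_form_def G_def[symmetric]
    by (simp add: power2_eq_square power3_eq_cube algebra_simps)
qed

text \<open>The determinant of velocity and acceleration ignores the tangential part of the
  acceleration, and both sides scale by the cube of the speed under a change of parameter.
  Christoffel symbols do not occur beyond this point.\<close>

lemma geodesic_cross:
  assumes U: "open U" "\<forall>p\<in>U. p $ 1 \<noteq> 0" and ode: "geodesics_given_by_ode \<epsilon> g U"
    and eps: "\<epsilon> = 1 \<or> \<epsilon> = -1" and geo: "geodesic g U I c" "t \<in> I"
    and v: "v = vector_derivative c (at t)" and a: "a = vector_derivative (\<lambda>s. vector_derivative c (at s)) (at t)"
  shows "v $ 1 * a $ 2 - v $ 2 * a $ 1 = \<epsilon> * (v $ 2) ^ 3 / (c t $ 1) ^ 3"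
  using christoffel_cubic[OF U(1) geodesicD(3)[OF geo] ode _ eps, of "v $ 1" "v $ 2"]
    geodesicD(7)[OF geo, of 1] geodesicD(7)[OF geo, of 2] U(2) geodesicD(3)[OF geo]
  by (simp add: a v)

section \<open>Leaves that are geodesics\<close>

text \<open>A path witnessing membership in a leaf. Lines contain 0, so such a path may pause or
  turn back; the lemmas below extract regular pieces from it.\<close>

definition tangent_path :: "(real^2) set \<Rightarrow> (real^2 \<Rightarrow> (real^2) set) \<Rightarrow> real^2 \<Rightarrow> (real \<Rightarrow> real^2) \<Rightarrow> bool" where
  "tangent_path V L p c \<longleftrightarrow> c C1_differentiable_on {0..1} \<and> path_image c \<subseteq> V \<and> pathstart c = p \<and>
     (\<forall>t\<in>{0..1}. vector_derivative c (at t) \<in> L (c t))"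

lemma leaf_altdef: "leaf V L p = {q. \<exists>c. tangent_path V L p c \<and> pathfinish c = q}"
  unfolding leaf_def tangent_path_def by blast

lemma tangent_pathD:
  assumes "tangent_path V L p c" "t \<in> {0..1}"
  shows "(c has_vector_derivative vector_derivative c (at t)) (at t)" "c t \<in> V"
    "vector_derivative c (at t) \<in> L (c t)"
    "continuous_on {0..1} (\<lambda>t. vector_derivative c (at t))" "continuous_on {0..1} c" "c 0 = p"
  using assms unfolding tangent_path_def C1_differentiable_on_eq path_image_def pathstart_def
  by (auto simp: vector_derivative_works[symmetric] intro!: continuous_at_imp_continuous_on differentiable_imp_continuous_within)

text \<open>Running only up to time \<open>b\<close> multiplies velocities by \<open>b\<close>,
  which keeps them in the subspaces \<open>L q\<close>; so an initial piece is again a tangent path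
  on \<open>{0..1}\<close>, now inside \<open>V\<close>.\<close>

lemma tangent_path_initial:
  assumes c: "tangent_path U L p c" and b: "0 \<le> b" "b \<le> 1" and V: "c ` {0..b} \<subseteq> V"
    and L: "\<And>q. q \<in> V \<Longrightarrow> subspace (L q)"
  shows "tangent_path V L p (\<lambda>t. c (b * t))"
proof -
  have in01: "b * t \<in> {0..b} \<and> b * t \<in> {0..1}" if "t \<in> {0..1}" for t
  proof -
    have "b * t \<le> b * 1" using that b by (intro mult_left_mono) auto
    then show ?thesis using that b by auto
  qed
  have d: "((\<lambda>t. c (b * t)) has_vector_derivative b *\<^sub>R vector_derivative c (at (b * t))) (at t)"
    if "t \<in> {0..1}" for t
  proof -
    have 1: "((\<lambda>t. b * t) has_vector_derivative b) (at t)"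
      unfolding has_real_derivative_iff_has_vector_derivative[symmetric] by (auto intro!: derivative_eq_intros)
    have 2: "(c has_vector_derivative vector_derivative c (at (b * t))) (at (b * t))"
      using tangent_pathD(1)[OF c] in01[OF that] by blast
    from vector_diff_chain_at[OF 1 2] show ?thesis by (simp only: o_def)
  qed
  have cc: "continuous_on {0..1} (\<lambda>t. vector_derivative c (at t))"
    using tangent_pathD(4)[OF c, of 0] by simp
  have "continuous_on {0..1} (\<lambda>t. vector_derivative c (at (b * t)))"
  proof (rule continuous_on_compose2[OF cc])
    show "continuous_on {0..1} (\<lambda>t. b * t)" by (intro continuous_intros)
    show "(\<lambda>t. b * t) ` {0..1} \<subseteq> {0..1}" using in01 by blast
  qed
  then have "continuous_on {0..1} (\<lambda>t. b *\<^sub>R vector_derivative c (at (b * t)))"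
    by (rule continuous_on_scaleR[OF continuous_on_const])
  with d have "(\<lambda>t. c (b * t)) C1_differentiable_on {0..1}"
    unfolding C1_differentiable_on_def by (intro exI conjI ballI)
  moreover have "vector_derivative (\<lambda>t. c (b * t)) (at t) \<in> L (c (b * t))" if "t \<in> {0..1}" for t
  proof -
    have "c (b * t) \<in> V" using in01[OF that] V by blast
    from subspace_scale[OF L[OF this] tangent_pathD(3)[OF c]] in01[OF that] show ?thesis
      unfolding vector_derivative_at[OF d[OF that]] by blast
  qed
  moreover have "path_image (\<lambda>t. c (b * t)) \<subseteq> V"
    using in01 V by (auto simp: path_image_def)
  ultimately show ?thesis
    using tangent_pathD(6)[OF c, of 0] by (simp add: tangent_path_def pathstart_def)
qed

lemma tangent_path_in_leaf:
  assumes c: "tangent_path U L p c" and b: "0 \<le> b" "b \<le> 1" and V: "c ` {0..b} \<subseteq> V"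
    and L: "\<And>q. q \<in> V \<Longrightarrow> subspace (L q)"
  shows "c b \<in> leaf V L p"
  unfolding leaf_altdef using tangent_path_initial[OF assms] by (auto simp: pathfinish_def)

text \<open>The path may rest at \<open>p\<close> for a while. At the infimum \<open>t0\<close> of
  the times with \<open>c t \<noteq> p\<close> it is still at \<open>p\<close>, hence in
  \<open>N\<close> shortly afterwards. It differs from \<open>p\<close> at times arbitrarily soon
  after \<open>t0\<close>, so its velocity is nonzero somewhere in that short span, and by
  continuity on an interval.\<close>

lemma tangent_path_escape:
  assumes c: "tangent_path U L p c" and ne: "c 1 \<noteq> p" and N: "open N" "p \<in> N"
  obtains \<alpha> \<beta> where "0 \<le> \<alpha>" "\<alpha> < \<beta>" "\<beta> \<le> 1" "c ` {0..\<beta>} \<subseteq> N"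
    "\<And>t. t \<in> {\<alpha>..\<beta>} \<Longrightarrow> vector_derivative c (at t) \<noteq> 0"
proof -
  define A where "A = {t \<in> {0..1}. c t \<noteq> p}"
  define t0 where "t0 = Inf A"
  have cc: "continuous_on {0..1} c" using tangent_pathD(5)[OF c, of 0] by simp
  have A: "1 \<in> A" "bdd_below A" using ne unfolding A_def by (auto intro!: bdd_belowI[of _ 0])
  have t0: "0 \<le> t0" "t0 \<le> 1"
    using A unfolding t0_def by (auto intro!: cInf_greatest cInf_lower) (auto simp: A_def)
  have before: "c t = p" if "0 \<le> t" "t < t0" for t
    using cInf_lower[OF _ A(2), of t] that t0 unfolding t0_def[symmetric] by (auto simp: A_def)
  have ct0: "c t0 = p"
  proof (cases "t0 = 0")
    case True
    then show ?thesis using tangent_pathD(6)[OF c, of 0] by simp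
  next
    case False
    have "{t \<in> {0..1}. c t = p} = {0..1} \<inter> c -` {p}" by auto
    then have "closed {t \<in> {0..1}. c t = p}"
      using continuous_closed_preimage[OF cc, of "{p}"] by simp
    moreover have "{0..<t0} \<subseteq> {t \<in> {0..1}. c t = p}" using before t0 by auto
    ultimately have "closure {0..<t0} \<subseteq> {t \<in> {0..1}. c t = p}" by (rule closure_minimal[rotated])
    then show ?thesis using False t0 by (auto simp: closure_atLeastLessThan)
  qed
  have "t0 < 1" using ct0 ne t0(2) by (cases "t0 = 1") auto
  have "isCont c t0"
    using tangent_pathD(1)[OF c, of t0] t0 has_vector_derivative_continuous[of c _ t0 UNIV] by auto
  moreover obtain r where r: "r > 0" "ball p r \<subseteq> N" using N openE by blast
  ultimately obtain d where d: "d > 0" "\<And>t. dist t t0 < d \<Longrightarrow> dist (c t) p < r"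
    unfolding continuous_at_eps_delta ct0 by blast
  then have d: "d > 0" "\<And>t. dist t t0 < d \<Longrightarrow> c t \<in> N"
    using r(2) by (auto simp: dist_commute subset_iff)
  define s where "s = min 1 (t0 + d / 2)"
  have s: "t0 < s" "s \<le> 1" using d \<open>t0 < 1\<close> by (auto simp: s_def)
  have cs: "c t \<in> N" if "0 \<le> t" "t \<le> s" for t
    using before[of t] N d(1) d(2)[of t] that by (cases "t < t0") (auto simp: s_def dist_real_def)
  obtain t1 where t1: "t1 \<in> A" "t1 < s" using cInf_lessD[of A s] A s unfolding t0_def by blast
  have t1': "t0 < t1" "t1 \<le> 1"
  proof -
    have "t0 \<le> t1" using t1 A unfolding t0_def by (intro cInf_lower)
    moreover have "t0 \<noteq> t1" using ct0 t1 by (auto simp: A_def)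
    ultimately show "t0 < t1" by simp
    show "t1 \<le> 1" using t1 by (simp add: A_def)
  qed
  \<comment> \<open>Zero velocity on all of \<open>{t0..t1}\<close> would give
    \<open>c t1 = c t0 = p\<close>.\<close>
  obtain t2 where t2: "t2 \<in> {t0..t1}" "vector_derivative c (at t2) \<noteq> 0"
  proof (rule ccontr)
    assume "\<not> thesis"
    then have z: "\<And>t. t \<in> {t0..t1} \<Longrightarrow> vector_derivative c (at t) = 0" using that by blast
    have "(c has_vector_derivative 0) (at t within {t0..t1})" if "t \<in> {t0..t1}" for t
      using tangent_pathD(1)[OF c, of t] z[OF that] that t0 t1' has_vector_derivative_at_within by fastforce
    then obtain k where "\<And>t. t \<in> {t0..t1} \<Longrightarrow> c t = k"
      using has_vector_derivative_zero_constant[of "{t0..t1}" c] by (metis convex_real_interval(5))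
    then have "c t0 = c t1" using t1' by simp
    then show False using ct0 t1 by (simp add: A_def)
  qed
  have "continuous_on {t0..t1} (\<lambda>t. vector_derivative c (at t))"
    using tangent_pathD(4)[OF c, of 0] t0 t1' by (auto intro: continuous_on_subset)
  then obtain e where e: "e > 0"
    "\<And>t. t \<in> {t0..t1} \<Longrightarrow> dist t t2 < e \<Longrightarrow> dist (vector_derivative c (at t)) (vector_derivative c (at t2)) < norm (vector_derivative c (at t2))"
    using t2 unfolding continuous_on_iff by (metis zero_less_norm_iff)
  have nz: "vector_derivative c (at t) \<noteq> 0" if "t \<in> {t0..t1}" "dist t t2 < e" for t
    using e(2)[OF that] by (auto simp: dist_norm)
  define \<alpha> where "\<alpha> = max t0 (t2 - e / 2)"
  define \<beta> where "\<beta> = min t1 (t2 + e / 2)"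
  show ?thesis
  proof (rule that[of \<alpha> \<beta>])
    show "0 \<le> \<alpha>" "\<alpha> < \<beta>" "\<beta> \<le> 1" using t0 t1' t2 e by (auto simp: \<alpha>_def \<beta>_def)
    show "c ` {0..\<beta>} \<subseteq> N" using cs t1 by (auto simp: \<beta>_def)
    show "vector_derivative c (at t) \<noteq> 0" if "t \<in> {\<alpha>..\<beta>}" for t
      using that e t2 by (intro nz) (auto simp: \<alpha>_def \<beta>_def dist_real_def)
  qed
qed

lemma unparam_geodesic_nontrivial:
  assumes "unparam_geodesic g U S"
  shows "\<exists>q\<in>S. q \<noteq> p"
proof (rule ccontr)
  assume "\<not> ?thesis"
  moreover obtain I c where c: "geodesic g U I c" "S = c ` I" using assms unfolding unparam_geodesic_def by blast
  ultimately have const: "\<And>t. t \<in> I \<Longrightarrow> c t = p" by blast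
  obtain t where t: "t \<in> I" using c(1) unfolding geodesic_def open_interval_def by blast
  have "((\<lambda>_. p) has_vector_derivative vector_derivative c (at t)) (at t)"
    by (rule has_vector_derivative_transform_within_open[OF geodesicD(5)[OF c(1) t] geodesicD(1)[OF c(1) t] t])
      (use const in auto)
  then have "vector_derivative c (at t) = 0"
    using vector_derivative_unique_at has_vector_derivative_const by blast
  then show False using geodesicD(4)[OF c(1) t] by simp
qed

text \<open>Used in proofs by contradiction: a pointwise identity that fails at \<open>p\<close>
  fails on a neighbourhood \<open>N\<close>, and this regular arc of the leaf inside
  \<open>N\<close> is where the failure is refuted.\<close>

lemma geodesic_leaf_path:
  assumes "unparam_geodesic g U (leaf U L p)" "open N" "p \<in> N"
  obtains c \<alpha> \<beta> where "tangent_path U L p c" "0 \<le> \<alpha>" "\<alpha> < \<beta>" "\<beta> \<le> 1" "c ` {0..\<beta>} \<subseteq> N"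
    "\<And>t. t \<in> {\<alpha>..\<beta>} \<Longrightarrow> vector_derivative c (at t) \<noteq> 0"
proof -
  obtain c where c: "tangent_path U L p c" "c 1 \<noteq> p"
    using unparam_geodesic_nontrivial[OF assms(1), of p] unfolding leaf_altdef pathfinish_def by blast
  from tangent_path_escape[OF c assms(2,3)] c(1) that show ?thesis by metis
qed

section \<open>Derivatives along curves, and curves with overlapping traces\<close>

lemma has_partials_curve:
  assumes "has_partials F a b (c t)" "(c has_vector_derivative v) (at t within T)"
  shows "((\<lambda>t. F (c t)) has_real_derivative a * v $ 1 + b * v $ 2) (at t within T)"
  unfolding has_field_derivative_def
  by (rule has_derivative_eq_rhs[OF has_derivative_compose[OF assms(2)[unfolded has_vector_derivative_def]
        assms(1)[unfolded has_partials_def]]]) (simp add: fun_eq_iff algebra_simps)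

lemma inj_on_nonzero_deriv:
  fixes f :: "real \<Rightarrow> real"
  assumes "\<And>x. x \<in> {a<..<b} \<Longrightarrow> (f has_real_derivative f' x) (at x)" "\<And>x. x \<in> {a<..<b} \<Longrightarrow> f' x \<noteq> 0"
  shows "inj_on f {a<..<b}"
proof -
  have lt: "f x \<noteq> f y" if "x < y" "x \<in> {a<..<b}" "y \<in> {a<..<b}" for x y
  proof
    assume "f x = f y"
    have "\<exists>z. x < z \<and> z < y \<and> f y - f x = (y - x) * f' z"
      by (rule MVT2[OF that(1)]) (use assms(1) that in auto)
    then obtain z where z: "x < z" "z < y" "f y - f x = (y - x) * f' z" by blast
    have "f' z \<noteq> 0" using z that assms(2)[of z] by auto
    then show False using z that \<open>f x = f y\<close> by simp
  qed
  show ?thesis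
  proof (rule inj_onI)
    fix x y assume "x \<in> {a<..<b}" "y \<in> {a<..<b}" "f x = f y"
    then show "x = y" using lt[of x y] lt[of y x] by (cases x y rule: linorder_cases) auto
  qed
qed

lemma DERIV_local_inverse:
  fixes f g :: "real \<Rightarrow> real"
  assumes "open S" "x \<in> S" "continuous_on S f" "\<And>z. z \<in> S \<Longrightarrow> g (f z) = z"
    "(f has_real_derivative d) (at x)" "d \<noteq> 0"
  shows "(g has_real_derivative inverse d) (at (f x))"
  unfolding has_field_derivative_def
  by (rule has_derivative_inverse_strong [of S x f g "(*) d"])
    (use assms in \<open>auto simp: has_field_derivative_def\<close>)

text \<open>By Baire's theorem some subinterval of \<open>{\<alpha>..\<beta>}\<close> is mapped by \<open>\<gamma>\<close> into an embedded compact
  piece of \<open>c\<close>. The trace of \<open>c\<close> itself may be self-intersecting or even dense.\<close>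

lemma curve_overlap:
  fixes \<gamma> c :: "real \<Rightarrow> real^2"
  assumes ab: "\<alpha> < \<beta>"
    and \<gamma>: "\<And>t. t \<in> {\<alpha>..\<beta>} \<Longrightarrow> (\<gamma> has_vector_derivative \<gamma>' t) (at t)" "\<And>t. t \<in> {\<alpha>..\<beta>} \<Longrightarrow> \<gamma>' t \<noteq> 0"
    and I: "open I"
    and c: "\<And>s. s \<in> I \<Longrightarrow> (c has_vector_derivative c' s) (at s)" "\<And>s. s \<in> I \<Longrightarrow> c' s \<noteq> 0" "continuous_on I c'"
    and sub: "\<gamma> ` {\<alpha>..\<beta>} \<subseteq> c ` I"
  shows "\<exists>s1 s2. s1 < s2 \<and> {s1<..<s2} \<subseteq> I \<and>
    (\<forall>s\<in>{s1<..<s2}. \<exists>t\<in>{\<alpha>..\<beta>}. \<exists>r. \<gamma> t = c s \<and> c' s = r *\<^sub>R \<gamma>' t)"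
proof -
  \<comment> \<open>On an interval larger than \<open>{a..b}\<close> the coordinate \<open>m\<close>
    of \<open>c\<close> has nonzero derivative, so it can serve as a parameter there. Rational end
    points keep the family of such pieces countable.\<close>
  define good where "good m a b \<longleftrightarrow> (\<exists>r1 r2. r1 < a \<and> b < r2 \<and> {r1<..<r2} \<subseteq> I \<and>
    (\<forall>s\<in>{r1<..<r2}. c' s $ m \<noteq> 0))" for m :: 2 and a b
  define idx where "idx = {(m, a, b). a \<in> \<rat> \<and> b \<in> \<rat> \<and> good m a b}"
  define T where "T x = {t \<in> {\<alpha>..\<beta>}. \<gamma> t \<in> c ` {fst (snd x)..snd (snd x)}}" for x :: "2 \<times> real \<times> real"
  define S where "S = {\<alpha>..\<beta>}"
  have "countable (UNIV \<times> \<rat> \<times> \<rat> :: (2 \<times> real \<times> real) set)"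
    by (intro countable_SIGMA countable_rat countable_finite finite)
  then have "countable idx" by (rule countable_subset[rotated]) (auto simp: idx_def)
  have contc: "continuous_on A c" if "A \<subseteq> I" for A
  proof (intro continuous_at_imp_continuous_on ballI)
    fix x assume "x \<in> A"
    then show "isCont c x" using has_vector_derivative_continuous[OF c(1)] that by blast
  qed
  have contg: "continuous_on S \<gamma>"
    unfolding S_def
  proof (intro continuous_at_imp_continuous_on ballI)
    fix x assume "x \<in> {\<alpha>..\<beta>}"
    then show "isCont \<gamma> x" using has_vector_derivative_continuous[OF \<gamma>(1)] by blast
  qed
  have closedT: "closed (T x)" if "x \<in> idx" for x
  proof -
    obtain m a b where x: "x = (m, a, b)" by (cases x) auto
    with that obtain r1 r2 where "r1 < a" "b < r2" "{r1<..<r2} \<subseteq> I" by (auto simp: idx_def good_def)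
    then have "{a..b} \<subseteq> I" by force
    then have "closed (c ` {a..b})" by (intro compact_imp_closed compact_continuous_image contc) auto
    then have "closed (S \<inter> \<gamma> -` (c ` {a..b}))"
      using continuous_closed_preimage[OF contg] by (simp add: S_def)
    moreover have "T x = S \<inter> \<gamma> -` (c ` {a..b})" by (auto simp: T_def S_def x)
    ultimately show ?thesis by simp
  qed
  have cover: "\<exists>x\<in>idx. t \<in> T x" if t: "t \<in> S" for t
  proof -
    obtain s where s: "s \<in> I" "\<gamma> t = c s" using sub t unfolding S_def by blast
    have "\<exists>m. c' s $ m \<noteq> 0" using c(2)[OF s(1)] by (auto simp: vec_eq_iff)
    then obtain m where m: "c' s $ m \<noteq> 0" ..
    have "continuous_on I (\<lambda>s. c' s $ m)" using c(3) by (intro continuous_intros)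
    then have "open {s \<in> I. c' s $ m \<noteq> 0}"
      using continuous_open_preimage[OF _ I, of "\<lambda>s. c' s $ m" "- {0}"] by (simp add: vimage_def Int_def open_Compl)
    then obtain d where d: "d > 0" "ball s d \<subseteq> {s \<in> I. c' s $ m \<noteq> 0}"
      using s m openE[of "{s \<in> I. c' s $ m \<noteq> 0}" s] by blast
    obtain a where a: "a \<in> \<rat>" "s - d < a" "a < s" using Rats_dense_in_real[of "s - d" s] d by auto
    obtain b where b: "b \<in> \<rat>" "s < b" "b < s + d" using Rats_dense_in_real[of s "s + d"] d by auto
    have "{s - d<..<s + d} \<subseteq> {s \<in> I. c' s $ m \<noteq> 0}" using d(2) by (simp add: ball_eq_greaterThanLessThan)
    then have "good m a b" unfolding good_def using a b by (intro exI[of _ "s - d"] exI[of _ "s + d"]) auto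
    then have "(m, a, b) \<in> idx" using a b by (simp add: idx_def)
    moreover have "t \<in> T (m, a, b)" using t s a b by (auto simp: T_def S_def)
    ultimately show ?thesis by blast
  qed
  \<comment> \<open>Otherwise the sets \<open>S - T x\<close> are countably many dense relatively
    open subsets of \<open>S\<close>, with empty intersection because the \<open>T x\<close> cover
    \<open>S\<close>.\<close>
  have "\<exists>x\<in>idx. \<not> S \<subseteq> closure (S - T x)"
  proof (rule ccontr)
    assume "\<not> ?thesis"
    then have dense: "S \<subseteq> closure (S - T x)" if "x \<in> idx" for x using that by blast
    have "S \<subseteq> closure (\<Inter>((\<lambda>x. S - T x) ` idx))"
    proof (rule Baire)
      show "closed S" by (simp add: S_def)
      show "countable ((\<lambda>x. S - T x) ` idx)" using \<open>countable idx\<close> by simp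
      fix G assume "G \<in> (\<lambda>x. S - T x) ` idx"
      then obtain x where x: "x \<in> idx" "G = S - T x" by blast
      have "G = S \<inter> - T x" using x by auto
      then show "openin (top_of_set S) G \<and> S \<subseteq> closure G"
        using closedT[OF x(1)] dense[OF x(1)] x(2) by (metis openin_open open_Compl)
    qed
    moreover obtain x where "x \<in> idx" using cover[of \<alpha>] ab by (auto simp: S_def)
    then have "\<Inter>((\<lambda>x. S - T x) ` idx) = {}" using cover by blast
    ultimately show False using ab by (simp add: S_def)
  qed
  then obtain m a b where x: "(m, a, b) \<in> idx" "\<not> S \<subseteq> closure (S - T (m, a, b))" by auto
  then obtain t0 where t0: "t0 \<in> S" "t0 \<notin> closure (S - T (m, a, b))" by blast
  then obtain e where e: "e > 0" "\<And>y. y \<in> S - T (m, a, b) \<Longrightarrow> \<not> dist y t0 < e"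
    unfolding closure_approachable by blast
  define u where "u = max \<alpha> (t0 - e)"
  define w where "w = min \<beta> (t0 + e)"
  have uw: "u < w" using e ab t0 by (auto simp: u_def w_def S_def)
  have uwS: "{u<..<w} \<subseteq> S" by (auto simp: u_def w_def S_def)
  have inT: "t \<in> T (m, a, b)" if "t \<in> {u<..<w}" for t
  proof -
    have "dist t t0 < e" using that by (auto simp: u_def w_def dist_real_def)
    then show ?thesis using e(2)[of t] uwS that by blast
  qed
  obtain r1 r2 where r: "r1 < a" "b < r2" "{r1<..<r2} \<subseteq> I" "\<And>s. s \<in> {r1<..<r2} \<Longrightarrow> c' s $ m \<noteq> 0"
    using x(1) by (auto simp: idx_def good_def)
  define J where "J = {r1<..<r2}"
  define \<phi> where "\<phi> s = c s $ m" for s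
  have d\<phi>: "(\<phi> has_real_derivative c' s $ m) (at s)" if "s \<in> J" for s
    unfolding \<phi>_def[abs_def] by (rule has_vector_derivative_nth[OF c(1)]) (use r that in \<open>auto simp: J_def\<close>)
  have inj: "inj_on \<phi> J"
    unfolding J_def by (rule inj_on_nonzero_deriv[of _ _ \<phi> "\<lambda>s. c' s $ m"]) (use d\<phi> r in \<open>auto simp: J_def\<close>)
  define \<psi> where "\<psi> = inv_into J \<phi>"
  have \<psi>: "\<psi> (\<phi> s) = s" if "s \<in> J" for s unfolding \<psi>_def using inv_into_f_f[OF inj that] .
  have cont\<phi>: "continuous_on J \<phi>" using d\<phi> DERIV_isCont by (blast intro: continuous_at_imp_continuous_on)
  \<comment> \<open>The transition map: \<open>\<theta> t\<close> is the parameter at which this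
    piece of \<open>c\<close> passes through \<open>\<gamma> t\<close>, found from the coordinate
    \<open>m\<close> alone.\<close>
  define \<theta> where "\<theta> t = \<psi> (\<gamma> t $ m)" for t
  have \<theta>: "\<theta> t \<in> J" "c (\<theta> t) = \<gamma> t" if t: "t \<in> {u<..<w}" for t
  proof -
    obtain s where s: "s \<in> {a..b}" "\<gamma> t = c s" using inT[OF t] by (auto simp: T_def)
    then have "s \<in> J" using r by (auto simp: J_def)
    then have "\<theta> t = s" using \<psi> s by (simp add: \<theta>_def \<phi>_def)
    then show "\<theta> t \<in> J" "c (\<theta> t) = \<gamma> t" using s \<open>s \<in> J\<close> by auto
  qed
  define \<theta>' where "\<theta>' t = inverse (c' (\<theta> t) $ m) * \<gamma>' t $ m" for t
  have d\<theta>: "(\<theta> has_real_derivative \<theta>' t) (at t)" if t: "t \<in> {u<..<w}" for t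
  proof -
    have "open J" by (simp add: J_def)
    moreover have "c' (\<theta> t) $ m \<noteq> 0" using r(4) \<theta>(1)[OF t] unfolding J_def by blast
    ultimately have "(\<psi> has_real_derivative inverse (c' (\<theta> t) $ m)) (at (\<phi> (\<theta> t)))"
      using DERIV_local_inverse[OF _ \<theta>(1)[OF t] cont\<phi> \<psi> d\<phi>[OF \<theta>(1)[OF t]]] by blast
    moreover have "\<phi> (\<theta> t) = \<gamma> t $ m" using \<theta>(2)[OF t] by (simp add: \<phi>_def)
    moreover have "((\<lambda>t. \<gamma> t $ m) has_real_derivative \<gamma>' t $ m) (at t)"
      by (rule has_vector_derivative_nth[OF \<gamma>(1)]) (use uwS t in \<open>auto simp: S_def\<close>)
    ultimately show ?thesis
      unfolding \<theta>_def[abs_def] \<theta>'_def using DERIV_chain2[of \<psi> _ "\<lambda>t. \<gamma> t $ m" t] by (simp add: \<theta>_def)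
  qed
  have g': "\<gamma>' t = \<theta>' t *\<^sub>R c' (\<theta> t)" if t: "t \<in> {u<..<w}" for t
  proof -
    have 1: "(\<theta> has_vector_derivative \<theta>' t) (at t)"
      using d\<theta>[OF t] by (simp add: has_real_derivative_iff_has_vector_derivative)
    have 2: "(c has_vector_derivative c' (\<theta> t)) (at (\<theta> t))"
      using c(1) r(3) \<theta>(1)[OF t] unfolding J_def by blast
    have "((\<lambda>t. c (\<theta> t)) has_vector_derivative \<theta>' t *\<^sub>R c' (\<theta> t)) (at t)"
      using vector_diff_chain_at[OF 1 2] by (simp only: o_def)
    then have "(\<gamma> has_vector_derivative \<theta>' t *\<^sub>R c' (\<theta> t)) (at t)"
      by (rule has_vector_derivative_transform_within_open[of _ _ _ "{u<..<w}"]) (use t \<theta>(2) in auto)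
    moreover have "(\<gamma> has_vector_derivative \<gamma>' t) (at t)" using \<gamma>(1) uwS t unfolding S_def by blast
    ultimately show ?thesis using vector_derivative_unique_at by blast
  qed
  have \<theta>'0: "\<theta>' t \<noteq> 0" if t: "t \<in> {u<..<w}" for t
  proof
    assume "\<theta>' t = 0"
    then have "\<gamma>' t = 0" using g'[OF t] by simp
    then show False using \<gamma>(2) uwS t unfolding S_def by blast
  qed
  \<comment> \<open>Two interior points suffice: \<open>\<theta>\<close> is injective, so their
    values differ, and its connected image contains everything between them.\<close>
  define u1 where "u1 = (2 * u + w) / 3"
  define w1 where "w1 = (u + 2 * w) / 3"
  have u1w1: "u1 \<in> {u<..<w}" "w1 \<in> {u<..<w}" "u1 < w1" using uw by (auto simp: u1_def w1_def)
  have "inj_on \<theta> {u<..<w}" by (rule inj_on_nonzero_deriv[OF d\<theta> \<theta>'0])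
  then have ne: "\<theta> u1 \<noteq> \<theta> w1" using u1w1 by (metis inj_on_contraD less_irrefl)
  have "continuous_on {u<..<w} \<theta>" using d\<theta> DERIV_isCont by (blast intro: continuous_at_imp_continuous_on)
  then have conn: "connected (\<theta> ` {u<..<w})" by (rule connected_continuous_image) simp
  define s1 where "s1 = min (\<theta> u1) (\<theta> w1)"
  define s2 where "s2 = max (\<theta> u1) (\<theta> w1)"
  have s12: "s1 \<in> \<theta> ` {u<..<w}" "s2 \<in> \<theta> ` {u<..<w}" using u1w1 by (auto simp: s1_def s2_def min_def max_def)
  have img: "\<exists>t\<in>{u<..<w}. \<theta> t = s" if "s \<in> {s1<..<s2}" for s
    using connectedD_interval[OF conn s12, of s] that by auto
  show ?thesis
  proof (intro exI conjI ballI)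
    show "s1 < s2" using ne by (auto simp: s1_def s2_def)
    show "{s1<..<s2} \<subseteq> I" using img \<theta>(1) r(3) unfolding J_def by blast
    fix s assume "s \<in> {s1<..<s2}"
    then obtain t where t: "t \<in> {u<..<w}" "\<theta> t = s" using img by blast
    have "\<gamma> t = c s" using \<theta>(2)[OF t(1)] t(2) by simp
    moreover have "c' s = inverse (\<theta>' t) *\<^sub>R \<gamma>' t" using g'[OF t(1)] t(2) \<theta>'0[OF t(1)] by simp
    moreover have "t \<in> {\<alpha>..\<beta>}" using uwS t(1) unfolding S_def by blast
    ultimately show "\<exists>t\<in>{\<alpha>..\<beta>}. \<exists>r. \<gamma> t = c s \<and> c' s = r *\<^sub>R \<gamma>' t" by blast
  qed
qed

section \<open>The geodesic equation of a foliation\<close>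

text \<open>Component \<open>k\<close> of the derivative of \<open>X\<close> along itself, that is,
  of the acceleration of an integral curve of \<open>X\<close>.\<close>

definition field_deriv :: "(real^2 \<Rightarrow> real^2) \<Rightarrow> 2 \<Rightarrow> real^2 \<Rightarrow> real" where
  "field_deriv X k p = partial 1 (\<lambda>q. X q $ k) p * X p $ 1 + partial 2 (\<lambda>q. X q $ k) p * X p $ 2"

text \<open>The leaf equals the trace of a geodesic \<open>c\<close>, but its tangent paths and
  \<open>c\<close> are parametrized independently. If the equation failed at \<open>p\<close>, it
  would fail along a regular piece \<open>\<gamma>\<close> of the leaf; \<open>curve_overlap\<close>
  yields an interval on which \<open>c\<close> stays on \<open>\<gamma>\<close> with velocity
  proportional to \<open>X\<close>, and there the geodesic equation of \<open>c\<close> becomes the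
  claimed one.\<close>

lemma geodesic_foliation_equation:
  assumes U: "open U" "\<forall>p\<in>U. p $ 1 \<noteq> 0" and ode: "geodesics_given_by_ode \<epsilon> g U"
    and eps: "\<epsilon> = 1 \<or> \<epsilon> = -1"
    and geo: "\<And>p. p \<in> U \<Longrightarrow> unparam_geodesic g U (leaf U L p)"
    and V: "open V" "V \<subseteq> U" "smooth_on V X" "\<And>q. q \<in> V \<Longrightarrow> X q \<noteq> 0 \<and> L q = span {X q}" and p: "p \<in> V"
    and sub: "\<And>q. q \<in> U \<Longrightarrow> subspace (L q)"
  shows "X p $ 1 * field_deriv X 2 p - X p $ 2 * field_deriv X 1 p = \<epsilon> * (X p $ 2) ^ 3 / (p $ 1) ^ 3"
proof (rule ccontr)
  assume ne: "\<not> ?thesis"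
  define H where "H q = X q $ 1 * field_deriv X 2 q - X q $ 2 * field_deriv X 1 q - \<epsilon> * (X q $ 2) ^ 3 / (q $ 1) ^ 3" for q
  have sX: "smooth_on V (\<lambda>q. X q $ k)" for k by (rule smooth_on_nth[OF V(1,3)])
  have "smooth_on V H"
    unfolding H_def[abs_def] field_deriv_def
    by (intro smooth_on_intros V(1) sX smooth_on_partial) (use U V in auto)
  then have "continuous_on V H" by (rule smooth_on_continuous_on)
  then have "open (V \<inter> H -` (- {0}))" using V(1) by (rule continuous_open_preimage) auto
  moreover have "p \<in> V \<inter> H -` (- {0})" using ne p by (simp add: H_def)
  moreover have pU: "p \<in> U" using p V by blast
  ultimately obtain \<gamma> \<alpha> \<beta> where \<gamma>: "tangent_path U L p \<gamma>" "0 \<le> \<alpha>" "\<alpha> < \<beta>" "\<beta> \<le> 1"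
    "\<gamma> ` {0..\<beta>} \<subseteq> V \<inter> H -` (- {0})" "\<And>t. t \<in> {\<alpha>..\<beta>} \<Longrightarrow> vector_derivative \<gamma> (at t) \<noteq> 0"
    using geodesic_leaf_path[OF geo[OF pU]] by metis
  obtain I c where c: "geodesic g U I c" "leaf U L p = c ` I"
    using geo[OF pU] unfolding unparam_geodesic_def by blast
  obtain i0 where i0: "i0 \<in> I" using c(1) unfolding geodesic_def open_interval_def by blast
  note oI = geodesicD(1)[OF c(1) i0]
  let ?v = "\<lambda>s. vector_derivative c (at s)"
  let ?a = "\<lambda>s. vector_derivative ?v (at s)"
  have sub1: "\<gamma> ` {\<alpha>..\<beta>} \<subseteq> c ` I"
  proof
    fix q assume "q \<in> \<gamma> ` {\<alpha>..\<beta>}"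
    then obtain t where t: "t \<in> {\<alpha>..\<beta>}" "q = \<gamma> t" by blast
    have "\<gamma> t \<in> leaf U L p"
    proof (rule tangent_path_in_leaf[OF \<gamma>(1)])
      show "\<gamma> ` {0..t} \<subseteq> U" using tangent_pathD(2)[OF \<gamma>(1)] t \<gamma>(4) by auto
    qed (use t \<gamma> sub in auto)
    then show "q \<in> c ` I" using c(2) t by simp
  qed
  have dg: "(\<gamma> has_vector_derivative vector_derivative \<gamma> (at t)) (at t)" if "t \<in> {\<alpha>..\<beta>}" for t
    by (rule tangent_pathD(1)[OF \<gamma>(1)]) (use that \<gamma> in auto)
  have cv: "continuous_on I ?v"
    by (rule smooth_on_continuous_on[OF smooth_on_vector_derivative[OF oI geodesicD(2)[OF c(1) i0]]])
  obtain s1 s2 where s: "s1 < s2" "{s1<..<s2} \<subseteq> I"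
    "\<And>s. s \<in> {s1<..<s2} \<Longrightarrow> \<exists>t\<in>{\<alpha>..\<beta>}. \<exists>r. \<gamma> t = c s \<and> ?v s = r *\<^sub>R vector_derivative \<gamma> (at t)"
    using curve_overlap[OF \<gamma>(3) dg \<gamma>(6) oI geodesicD(5)[OF c(1)] geodesicD(4)[OF c(1)] cv sub1] by auto
  have on: "c s \<in> V \<and> H (c s) \<noteq> 0 \<and> (\<exists>l. ?v s = l *\<^sub>R X (c s))" if "s \<in> {s1<..<s2}" for s
  proof -
    obtain t r where t: "t \<in> {\<alpha>..\<beta>}" "\<gamma> t = c s" "?v s = r *\<^sub>R vector_derivative \<gamma> (at t)" using s(3) \<open>s \<in> {s1<..<s2}\<close> by blast
    have inV: "c s \<in> V \<inter> H -` (- {0})" using \<gamma>(2,5) t(1,2) by (metis atLeastAtMost_iff image_subset_iff order.trans)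
    have "vector_derivative \<gamma> (at t) \<in> L (c s)" using tangent_pathD(3)[OF \<gamma>(1), of t] t \<gamma>(2,4) by auto
    then have "?v s \<in> span {X (c s)}" using t(3) V(4)[of "c s"] inV span_mul by fastforce
    then show ?thesis using inV by (auto simp: span_singleton)
  qed
  define s where "s = (s1 + s2) / 2"
  have sin: "s \<in> {s1<..<s2}" using s(1) by (simp add: s_def)
  then have sI: "s \<in> I" using s(2) by blast
  obtain l where l: "?v s = l *\<^sub>R X (c s)" using on[OF sin] by blast
  have l0: "l \<noteq> 0" using geodesicD(4)[OF c(1) sI] l by auto
  let ?q = "c s"
  have dX: "((\<lambda>t. X (c t) $ k) has_real_derivative l * field_deriv X k ?q) (at s)" for k
    using has_partials_curve[OF smooth_on_has_partials[OF sX] geodesicD(5)[OF c(1) sI], of k] on[OF sin] l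
    by (simp add: field_deriv_def algebra_simps)
  have dv: "((\<lambda>t. ?v t $ k) has_real_derivative ?a s $ k) (at s)" for k
    by (rule has_vector_derivative_nth[OF geodesicD(6)[OF c(1) sI]])
  \<comment> \<open>Velocity and \<open>X\<close> are parallel. Differentiating their determinant
    relates the acceleration to the derivative of \<open>X\<close> without differentiating the
    factor \<open>l\<close>, whose regularity has not been established.\<close>
  have "((\<lambda>t. ?v t $ 1 * X (c t) $ 2 - ?v t $ 2 * X (c t) $ 1) has_real_derivative
      (?v s $ 1 * (l * field_deriv X 2 ?q) + ?a s $ 1 * X ?q $ 2)
      - (?v s $ 2 * (l * field_deriv X 1 ?q) + ?a s $ 2 * X ?q $ 1)) (at s)"
    by (intro DERIV_diff DERIV_mult' dX dv)
  moreover have "((\<lambda>t. ?v t $ 1 * X (c t) $ 2 - ?v t $ 2 * X (c t) $ 1) has_real_derivative 0) (at s)"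
  proof (rule has_field_derivative_transform_within_open[OF DERIV_const[of 0] _ sin])
    fix t assume "t \<in> {s1<..<s2}"
    then obtain l' where "?v t = l' *\<^sub>R X (c t)" using on by blast
    then show "0 = ?v t $ 1 * X (c t) $ 2 - ?v t $ 2 * X (c t) $ 1" by simp
  qed simp
  ultimately have "(?v s $ 1 * (l * field_deriv X 2 ?q) + ?a s $ 1 * X ?q $ 2)
      - (?v s $ 2 * (l * field_deriv X 1 ?q) + ?a s $ 2 * X ?q $ 1) = 0" by (rule DERIV_unique)
  then have e1: "l * l * (X ?q $ 1 * field_deriv X 2 ?q - X ?q $ 2 * field_deriv X 1 ?q)
      = ?a s $ 2 * X ?q $ 1 - ?a s $ 1 * X ?q $ 2"
    using l by (simp add: algebra_simps)
  have "?v s $ 1 * ?a s $ 2 - ?v s $ 2 * ?a s $ 1 = \<epsilon> * (?v s $ 2) ^ 3 / (?q $ 1) ^ 3"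
    by (rule geodesic_cross[OF U ode eps c(1) sI refl refl])
  then have e2: "l * (?a s $ 2 * X ?q $ 1 - ?a s $ 1 * X ?q $ 2) = l * l * l * (\<epsilon> * (X ?q $ 2) ^ 3 / (?q $ 1) ^ 3)"
    using l by (simp add: algebra_simps power3_eq_cube)
  have "l * (l * l * (X ?q $ 1 * field_deriv X 2 ?q - X ?q $ 2 * field_deriv X 1 ?q))
      = l * l * l * (\<epsilon> * (X ?q $ 2) ^ 3 / (?q $ 1) ^ 3)"
    unfolding e1 by (rule e2)
  then have "l * l * l * (X ?q $ 1 * field_deriv X 2 ?q - X ?q $ 2 * field_deriv X 1 ?q)
      = l * l * l * (\<epsilon> * (X ?q $ 2) ^ 3 / (?q $ 1) ^ 3)"
    by (simp only: mult.assoc)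
  moreover have "l * l * l \<noteq> 0" using l0 by simp
  ultimately have "H ?q = 0" unfolding H_def mult_left_cancel[OF \<open>l * l * l \<noteq> 0\<close>] by simp
  then show False using on[OF sin] by simp
qed

section \<open>Dual focal curves\<close>

text \<open>The conic \<open>A y\<^sup>2 + 2 B y + C + D z\<^sup>2 = 0\<close> carrying the geodesic that leaves \<open>p\<close> in the direction \<open>X\<close>.
  For slope \<open>S = dz/dy\<close> and \<open>D = -1\<close> one has \<open>A = S\<^sup>2 - \<epsilon> / z\<^sup>2\<close> and \<open>A y + B = z S\<close>; homogenizing makes
  the coefficients quadratic in \<open>X\<close>.\<close>

definition dual_vector :: "real \<Rightarrow> real^2 \<Rightarrow> real^2 \<Rightarrow> real^4" where
  "dual_vector \<epsilon> p X = (\<chi> i.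
     let A = (X $ 1)\<^sup>2 - \<epsilon> * (X $ 2 / p $ 1)\<^sup>2 in
     if i = 1 then A
     else if i = 2 then p $ 1 * X $ 1 * X $ 2 - p $ 2 * A
     else if i = 3 then (p $ 1)\<^sup>2 * (X $ 2)\<^sup>2 - 2 * p $ 2 * (p $ 1 * X $ 1 * X $ 2) + (p $ 2)\<^sup>2 * A
     else - (X $ 2)\<^sup>2)"

lemma dual_vector_nth:
  "dual_vector \<epsilon> p X $ 1 = (X $ 1)\<^sup>2 - \<epsilon> * (X $ 2 / p $ 1)\<^sup>2"
  "dual_vector \<epsilon> p X $ 2 = p $ 1 * X $ 1 * X $ 2 - p $ 2 * dual_vector \<epsilon> p X $ 1"
  "dual_vector \<epsilon> p X $ 3 = (p $ 1)\<^sup>2 * (X $ 2)\<^sup>2 - 2 * p $ 2 * (p $ 1 * X $ 1 * X $ 2) + (p $ 2)\<^sup>2 * dual_vector \<epsilon> p X $ 1"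
  "dual_vector \<epsilon> p X $ 4 = - (X $ 2)\<^sup>2"
  by (simp_all add: dual_vector_def)

text \<open>The factor is a square, so proportional directions give the same projective point and
  opposite ones even the same vector.\<close>

lemma dual_vector_scale: "dual_vector \<epsilon> p (r *\<^sub>R X) = r\<^sup>2 *\<^sub>R dual_vector \<epsilon> p X"
  by (simp add: vec_eq_iff forall_4 dual_vector_nth power_mult_distrib power2_eq_square algebra_simps)

lemma vec2_nonzero: "(X :: real^2) \<noteq> 0 \<longleftrightarrow> X $ 1 \<noteq> 0 \<or> X $ 2 \<noteq> 0"
  by (auto simp: vec_eq_iff forall_2)

lemma dual_vector_nonzero: "X \<noteq> 0 \<Longrightarrow> dual_vector \<epsilon> p X \<noteq> 0"
  using vec2_nonzero[of X] by (auto simp: vec_eq_iff[of "dual_vector \<epsilon> p X"] forall_4 dual_vector_nth)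

lemma span_singleton_scale: "r \<noteq> 0 \<Longrightarrow> span {r *\<^sub>R v} = span {v}"
  for v :: "'a::real_vector"
proof (intro subset_antisym span_minimal)
  assume "r \<noteq> 0"
  then have "v = inverse r *\<^sub>R (r *\<^sub>R v)" by simp
  moreover have "inverse r *\<^sub>R (r *\<^sub>R v) \<in> span {r *\<^sub>R v}" by (intro span_mul span_base) simp
  ultimately show "{v} \<subseteq> span {r *\<^sub>R v}" by simp
qed (auto intro: span_mul span_base)

lemma span_singleton_eqD:
  fixes v w :: "'a::real_vector"
  assumes "span {v} = span {w}" "v \<noteq> 0"
  obtains k where "k \<noteq> 0" "v = k *\<^sub>R w"
proof -
  have "v \<in> span {w}" using assms(1) span_base[of v "{v}"] by simp
  then obtain k where k: "v = k *\<^sub>R w" by (auto simp: span_singleton)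
  with assms(2) have "k \<noteq> 0" by auto
  with k that show ?thesis by blast
qed

lemma quadric_span_iff:
  assumes "v \<noteq> 0"
  shows "span {v} \<in> quadric \<epsilon> \<longleftrightarrow> v $ 1 * v $ 3 - (v $ 2)\<^sup>2 + \<epsilon> * (v $ 4)\<^sup>2 = 0"
proof
  assume "span {v} \<in> quadric \<epsilon>"
  then obtain w where w: "span {v} = span {w}" "w $ 1 * w $ 3 - (w $ 2)\<^sup>2 + \<epsilon> * (w $ 4)\<^sup>2 = 0"
    unfolding quadric_def by blast
  then obtain k where "v = k *\<^sub>R w" using span_singleton_eqD[OF w(1) assms] by blast
  then have "v $ 1 * v $ 3 - (v $ 2)\<^sup>2 + \<epsilon> * (v $ 4)\<^sup>2 = k\<^sup>2 * (w $ 1 * w $ 3 - (w $ 2)\<^sup>2 + \<epsilon> * (w $ 4)\<^sup>2)"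
    by (simp add: power2_eq_square algebra_simps)
  then show "v $ 1 * v $ 3 - (v $ 2)\<^sup>2 + \<epsilon> * (v $ 4)\<^sup>2 = 0" using w(2) by simp
qed (use assms in \<open>auto simp: quadric_def\<close>)

lemma proj_plane_span_iff:
  assumes "v \<noteq> 0"
  shows "span {v} \<in> proj_plane n \<longleftrightarrow> n \<bullet> v = 0"
proof
  assume "span {v} \<in> proj_plane n"
  then obtain w where w: "span {v} = span {w}" "n \<bullet> w = 0"
    unfolding proj_plane_def by blast
  then obtain k where "v = k *\<^sub>R w" using span_singleton_eqD[OF w(1) assms] by blast
  then show "n \<bullet> v = 0" using w(2) by simp
qed (use assms in \<open>auto simp: proj_plane_def\<close>)

lemma conic_span_cong:
  assumes "span {v} = span {w}" "v \<noteq> 0"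
  shows "conic v = conic w"
proof -
  obtain k where k: "k \<noteq> 0" "v = k *\<^sub>R w" using span_singleton_eqD[OF assms] .
  have "v $ 1 * (p $ 2)\<^sup>2 + 2 * v $ 2 * p $ 2 + v $ 3 + v $ 4 * (p $ 1)\<^sup>2 =
    k * (w $ 1 * (p $ 2)\<^sup>2 + 2 * w $ 2 * p $ 2 + w $ 3 + w $ 4 * (p $ 1)\<^sup>2)" for p :: "real^2"
    using k by (simp add: algebra_simps)
  then show ?thesis using k by (simp add: conic_def)
qed

lemma dual_vector_quadric:
  assumes "p $ 1 \<noteq> 0"
  shows "dual_vector \<epsilon> p X $ 1 * dual_vector \<epsilon> p X $ 3 - (dual_vector \<epsilon> p X $ 2)\<^sup>2 + \<epsilon> * (dual_vector \<epsilon> p X $ 4)\<^sup>2 = 0"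
proof -
  define A where "A = dual_vector \<epsilon> p X $ 1"
  have "\<epsilon> * (X $ 2)\<^sup>2 = (p $ 1)\<^sup>2 * ((X $ 1)\<^sup>2 - A)"
    using assms by (simp add: A_def dual_vector_nth field_simps)
  moreover have "dual_vector \<epsilon> p X $ 1 * dual_vector \<epsilon> p X $ 3 - (dual_vector \<epsilon> p X $ 2)\<^sup>2 + \<epsilon> * (dual_vector \<epsilon> p X $ 4)\<^sup>2
    = (X $ 2)\<^sup>2 * ((p $ 1)\<^sup>2 * (A - (X $ 1)\<^sup>2) + \<epsilon> * (X $ 2)\<^sup>2)"
    unfolding dual_vector_nth(2-4) A_def[symmetric] by (simp add: power2_eq_square algebra_simps)
  ultimately show ?thesis by (simp add: algebra_simps)
qed

lemma conic_dual_vector: "p \<in> conic (dual_vector \<epsilon> p X)"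
  unfolding conic_def dual_vector_nth(2-4) by (simp add: power2_eq_square algebra_simps)

text \<open>The pregeodesic equation is equivalent to the existence of \<open>\<eta>\<close> below, which
  also covers the direction \<open>X $ 2 = 0\<close>.\<close>

lemma dual_vector_derivative:
  fixes q X :: "real \<Rightarrow> real^2"
  assumes q: "(q has_vector_derivative r *\<^sub>R X t) (at t within T)"
    and X: "\<And>k. ((\<lambda>s. X s $ k) has_real_derivative r * Y k) (at t within T)"
    and z: "q t $ 1 \<noteq> 0" and nz: "X t \<noteq> 0"
    and E: "X t $ 1 * Y 2 - X t $ 2 * Y 1 = \<epsilon> * (X t $ 2) ^ 3 / (q t $ 1) ^ 3"
  shows "\<exists>\<kappa>. \<forall>i. ((\<lambda>s. dual_vector \<epsilon> (q s) (X s) $ i) has_real_derivative \<kappa> * dual_vector \<epsilon> (q t) (X t) $ i) (at t within T)"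
proof -
  define z y x1 x2 where "z = q t $ 1" and "y = q t $ 2" and "x1 = X t $ 1" and "x2 = X t $ 2"
  note vals = z_def[symmetric] y_def[symmetric] x1_def[symmetric] x2_def[symmetric]
  have z0: "z \<noteq> 0" using z by (simp add: z_def)
  \<comment> \<open>The acceleration is \<open>\<eta> X\<close> plus the vector
    \<open>(- \<epsilon> x2\<^sup>2 / z\<^sup>3, 0)\<close>. The factor is read off from the second
    component, or from the first one if \<open>x2 = 0\<close>, where the extra vector
    vanishes.\<close>
  obtain \<eta> where \<eta>: "Y 2 = \<eta> * x2" "Y 1 = x1 * \<eta> - \<epsilon> * (x2 / z)\<^sup>2 / z"
  proof (cases "x2 = 0")
    case True
    then have "x1 \<noteq> 0" using nz by (auto simp: vec2_nonzero x1_def x2_def)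
    moreover have "x1 * Y 2 = 0" using E True by (simp add: x1_def x2_def)
    ultimately show ?thesis using True by (intro that[of "Y 1 / x1"]) auto
  next
    case False
    have "x2 * Y 1 = x1 * Y 2 - \<epsilon> * x2 ^ 3 / z ^ 3" using E by (simp add: x1_def x2_def z_def)
    then have "Y 1 = (x1 * Y 2 - \<epsilon> * x2 ^ 3 / z ^ 3) / x2" using False by (simp add: field_simps)
    also have "\<dots> = x1 * (Y 2 / x2) - \<epsilon> * (x2 / z)\<^sup>2 / z"
      using False z0 by (simp add: divide_simps power2_eq_square power3_eq_cube)
    finally show ?thesis using False by (intro that[of "Y 2 / x2"]) auto
  qed
  have dz: "((\<lambda>s. q s $ 1) has_real_derivative r * x1) (at t within T)"
    and dy: "((\<lambda>s. q s $ 2) has_real_derivative r * x2) (at t within T)"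
    using has_vector_derivative_nth[OF q, of 1] has_vector_derivative_nth[OF q, of 2] by (simp_all add: x1_def x2_def)
  have d1: "((\<lambda>s. X s $ 1) has_real_derivative r * Y 1) (at t within T)"
    and d2: "((\<lambda>s. X s $ 2) has_real_derivative r * Y 2) (at t within T)" by (rule X)+
  define \<sigma> where "\<sigma> = x2 / z"
  have d\<sigma>: "((\<lambda>s. X s $ 2 / q s $ 1) has_real_derivative r * (\<eta> * \<sigma> - \<sigma> * x1 / z)) (at t within T)"
    by (rule DERIV_cong[OF DERIV_divide[OF d2 dz z]])
      (use z0 in \<open>simp add: vals \<eta> \<sigma>_def field_simps power2_eq_square\<close>)
  define A where "A = x1\<^sup>2 - \<epsilon> * \<sigma>\<^sup>2"
  have dA: "((\<lambda>s. dual_vector \<epsilon> (q s) (X s) $ 1) has_real_derivative 2 * r * \<eta> * A) (at t within T)"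
    unfolding dual_vector_nth(1)
    by (rule DERIV_cong[OF DERIV_diff[OF DERIV_power[OF d1, of 2] DERIV_cmult[OF DERIV_power[OF d\<sigma>, of 2]]]])
      (simp add: vals A_def \<eta> \<sigma>_def[symmetric] algebra_simps power2_eq_square)
  have At: "dual_vector \<epsilon> (q t) (X t) $ 1 = A" by (simp add: dual_vector_nth A_def vals \<sigma>_def)
  define P where "P = z * x1 * x2"
  have dP: "((\<lambda>s. q s $ 1 * X s $ 1 * X s $ 2) has_real_derivative 2 * r * \<eta> * P + r * x2 * A) (at t within T)"
    by (rule DERIV_cong[OF DERIV_mult'[OF DERIV_mult'[OF dz d1] d2]])
      (use z0 in \<open>simp add: vals A_def P_def \<eta> \<sigma>_def field_simps power2_eq_square\<close>)
  have dB: "((\<lambda>s. dual_vector \<epsilon> (q s) (X s) $ 2) has_real_derivative 2 * r * \<eta> * (P - y * A)) (at t within T)"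
    unfolding dual_vector_nth(2)
    by (rule DERIV_cong[OF DERIV_diff[OF dP DERIV_mult'[OF dy dA]]])
      (simp add: At vals algebra_simps)
  have dC: "((\<lambda>s. dual_vector \<epsilon> (q s) (X s) $ 3) has_real_derivative
      2 * r * \<eta> * (z\<^sup>2 * x2\<^sup>2 - 2 * y * P + y\<^sup>2 * A)) (at t within T)"
    unfolding dual_vector_nth(3)
    by (rule DERIV_cong[OF DERIV_add[OF DERIV_diff[OF DERIV_mult'[OF DERIV_power[OF dz, of 2] DERIV_power[OF d2, of 2]]
          DERIV_mult'[OF DERIV_cmult[OF dy] dP]] DERIV_mult'[OF DERIV_power[OF dy, of 2] dA]]])
      (simp add: At vals P_def \<eta> power2_eq_square algebra_simps)
  have dD: "((\<lambda>s. dual_vector \<epsilon> (q s) (X s) $ 4) has_real_derivative 2 * r * \<eta> * (- x2\<^sup>2)) (at t within T)"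
    unfolding dual_vector_nth(4)
    by (rule DERIV_cong[OF DERIV_minus[OF DERIV_power[OF d2, of 2]]]) (simp add: vals \<eta> power2_eq_square)
  \<comment> \<open>All four components satisfy the linear equation with factor
    \<open>2 r \<eta>\<close>: the vector is quadratic in \<open>X\<close>, and whatever is not due
    to the rescaling of \<open>X\<close> cancels.\<close>
  have "((\<lambda>s. dual_vector \<epsilon> (q s) (X s) $ i) has_real_derivative (2 * r * \<eta>) * dual_vector \<epsilon> (q t) (X t) $ i) (at t within T)" for i
    using exhaust_4[of i] dA dB dC dD
    unfolding dual_vector_nth(2-4)[of \<epsilon> "q t"] vals At P_def[symmetric]
    by (auto simp: dual_vector_nth(2-4)[of \<epsilon> "q t"] At vals P_def)
  then show ?thesis by blast
qed

text \<open>If all components obey the same equation \<open>F' = \<kappa> F\<close>, their quotients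
  by a component that is nonzero near \<open>t\<close> have derivative zero. The factor \<kappa> is
  given point by point only, so quotients are used rather than an integrating factor.\<close>

lemma span_locally_const:
  fixes F :: "real \<Rightarrow> real^'n"
  assumes T: "convex T" "t \<in> T" and d: "d > 0" and nz: "F t \<noteq> 0"
    and F: "\<And>s. s \<in> T \<inter> ball t d \<Longrightarrow> \<exists>\<kappa>. \<forall>i. ((\<lambda>s. F s $ i) has_real_derivative \<kappa> * F s $ i) (at s within T)"
  shows "\<exists>e>0. \<forall>s\<in>T \<inter> ball t e. span {F s} = span {F t}"
proof -
  obtain k where k: "F t $ k \<noteq> 0" using nz by (auto simp: vec_eq_iff)
  have "t \<in> T \<inter> ball t d" using T d by simp
  then have "continuous (at t within T) (\<lambda>s. F s $ k)"
    using F DERIV_continuous by blast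
  then obtain e0 where e0: "e0 > 0" "\<And>s. s \<in> T \<Longrightarrow> dist s t < e0 \<Longrightarrow> dist (F s $ k) (F t $ k) < \<bar>F t $ k\<bar>"
    using k unfolding continuous_within_eps_delta by (metis zero_less_abs_iff)
  define e where "e = min d e0"
  define T' where "T' = T \<inter> ball t e"
  have e: "e > 0" using d e0 by (simp add: e_def)
  have Fk: "F s $ k \<noteq> 0" if "s \<in> T'" for s
    using e0(2)[of s] that by (auto simp: T'_def e_def dist_commute dist_real_def)
  have "convex T'" unfolding T'_def by (intro convex_Int T convex_ball)
  have ratio: "F s $ j / F s $ k = F t $ j / F t $ k" if "s \<in> T'" for s j
  proof -
    have "\<exists>c. \<forall>s\<in>T'. F s $ j / F s $ k = c"
    proof (rule has_field_derivative_zero_constant[OF \<open>convex T'\<close>])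
      fix s assume s: "s \<in> T'"
      then have "s \<in> T \<inter> ball t d" by (auto simp: T'_def e_def)
      then obtain \<kappa> where \<kappa>: "\<And>i. ((\<lambda>s. F s $ i) has_real_derivative \<kappa> * F s $ i) (at s within T)"
        using F by blast
      have "((\<lambda>s. F s $ j / F s $ k) has_real_derivative 0) (at s within T)"
        by (rule DERIV_cong[OF DERIV_divide[OF \<kappa>[of j] \<kappa>[of k] Fk[OF s]]]) simp
      then show "((\<lambda>s. F s $ j / F s $ k) has_real_derivative 0) (at s within T')"
        by (rule DERIV_subset) (simp add: T'_def)
    qed
    moreover have "t \<in> T'" using T e by (simp add: T'_def)
    ultimately show ?thesis using that by metis
  qed
  have "span {F s} = span {F t}" if s: "s \<in> T'" for s
  proof -
    have "F s = (F s $ k / F t $ k) *\<^sub>R F t"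
      using ratio[OF s] k Fk[OF s] by (simp add: vec_eq_iff frac_eq_eq mult.commute divide_simps)
    moreover have "F s $ k / F t $ k \<noteq> 0" using k Fk[OF s] by simp
    ultimately show ?thesis using span_singleton_scale[of "F s $ k / F t $ k" "F t"] by metis
  qed
  then show ?thesis using e unfolding T'_def by blast
qed

section \<open>The dual point of a foliation and its constancy along leaves\<close>

text \<open>Spanned by the dual vectors of the whole line, so that no generator has to be
  chosen.\<close>

definition dual_point :: "real \<Rightarrow> (real^2 \<Rightarrow> (real^2) set) \<Rightarrow> real^2 \<Rightarrow> proj_point" where
  "dual_point \<epsilon> L p = span (dual_vector \<epsilon> p ` L p)"

lemma dual_point_eq:
  assumes "L p = span {X}"
  shows "dual_point \<epsilon> L p = span {dual_vector \<epsilon> p X}"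
  unfolding dual_point_def
proof (intro subset_antisym span_minimal subspace_span)
  show "dual_vector \<epsilon> p ` L p \<subseteq> span {dual_vector \<epsilon> p X}"
    unfolding assms by (auto simp: span_singleton dual_vector_scale)
  show "{dual_vector \<epsilon> p X} \<subseteq> span (dual_vector \<epsilon> p ` L p)"
    unfolding assms by (auto intro!: span_base imageI)
qed

definition geodesic_field :: "real \<Rightarrow> (real^2) set \<Rightarrow> (real^2 \<Rightarrow> (real^2) set) \<Rightarrow> (real^2 \<Rightarrow> real^2) \<Rightarrow> bool" where
  "geodesic_field \<epsilon> V L X \<longleftrightarrow> open V \<and> smooth_on V X \<and> (\<forall>q\<in>V. q $ 1 \<noteq> 0 \<and> X q \<noteq> 0 \<and> L q = span {X q} \<and>
     X q $ 1 * field_deriv X 2 q - X q $ 2 * field_deriv X 1 q = \<epsilon> * (X q $ 2) ^ 3 / (q $ 1) ^ 3)"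

text \<open>What later arguments retain of the metric: local generators satisfying the geodesic
  equation, and regular tangent arcs inside every neighbourhood of their starting point.\<close>

definition geodesic_foliation :: "real \<Rightarrow> (real^2) set \<Rightarrow> (real^2 \<Rightarrow> (real^2) set) \<Rightarrow> bool" where
  "geodesic_foliation \<epsilon> U L \<longleftrightarrow> open U \<and>
     (\<forall>p\<in>U. \<exists>V X. p \<in> V \<and> V \<subseteq> U \<and> geodesic_field \<epsilon> V L X) \<and>
     (\<forall>p\<in>U. \<forall>N. open N \<longrightarrow> p \<in> N \<longrightarrow> (\<exists>c \<alpha> \<beta>. tangent_path U L p c \<and> 0 \<le> \<alpha> \<and> \<alpha> < \<beta> \<and> \<beta> \<le> 1 \<and>
        c ` {0..\<beta>} \<subseteq> N \<and> (\<forall>t\<in>{\<alpha>..\<beta>}. vector_derivative c (at t) \<noteq> 0)))"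

lemma geodesic_foliation_open: "geodesic_foliation \<epsilon> U L \<Longrightarrow> open U"
  by (simp only: geodesic_foliation_def)

lemma geodesic_foliation_field:
  assumes "geodesic_foliation \<epsilon> U L" "p \<in> U"
  obtains V X where "p \<in> V" "V \<subseteq> U" "geodesic_field \<epsilon> V L X"
  using bspec[OF assms(1)[unfolded geodesic_foliation_def, THEN conjunct2, THEN conjunct1] assms(2)] by (elim exE conjE)

lemma geodesic_foliation_path:
  assumes "geodesic_foliation \<epsilon> U L" "p \<in> U" "open N" "p \<in> N"
  obtains c \<alpha> \<beta> where "tangent_path U L p c" "0 \<le> \<alpha>" "\<alpha> < \<beta>" "\<beta> \<le> 1" "c ` {0..\<beta>} \<subseteq> N"
    "\<forall>t\<in>{\<alpha>..\<beta>}. vector_derivative c (at t) \<noteq> 0"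
proof -
  have "\<exists>c \<alpha> \<beta>. tangent_path U L p c \<and> 0 \<le> \<alpha> \<and> \<alpha> < \<beta> \<and> \<beta> \<le> 1 \<and>
        c ` {0..\<beta>} \<subseteq> N \<and> (\<forall>t\<in>{\<alpha>..\<beta>}. vector_derivative c (at t) \<noteq> 0)"
    using bspec[OF assms(1)[unfolded geodesic_foliation_def, THEN conjunct2, THEN conjunct2] assms(2)] assms(3,4)
    by (elim allE impE)
  then show ?thesis by (elim exE conjE) (rule that)
qed

lemma geodesic_web_foliation:
  assumes U: "open U" "\<forall>p\<in>U. p $ 1 \<noteq> 0" and ode: "geodesics_given_by_ode \<epsilon> g U"
    and eps: "\<epsilon> = 1 \<or> \<epsilon> = -1" and web: "geodesic_web g U W"
  shows "geodesic_foliation \<epsilon> U (W i)"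
proof -
  have fol: "foliation_on U (W i)" and geo: "\<And>p. p \<in> U \<Longrightarrow> unparam_geodesic g U (leaf U (W i) p)"
    using web by (auto simp: geodesic_web_def three_web_def)
  have sub: "subspace (W i q)" if "q \<in> U" for q
    using fol that unfolding foliation_on_def by (metis subspace_span)
  have "\<exists>V X. p \<in> V \<and> V \<subseteq> U \<and> geodesic_field \<epsilon> V (W i) X" if p: "p \<in> U" for p
  proof -
    obtain V X where V: "open V" "p \<in> V" "V \<subseteq> U" "smooth_on V X" "\<And>q. q \<in> V \<Longrightarrow> X q \<noteq> 0 \<and> W i q = span {X q}"
      using fol p unfolding foliation_on_def by metis
    have "geodesic_field \<epsilon> V (W i) X"
      unfolding geodesic_field_def
    proof (intro conjI ballI)
      fix q assume q: "q \<in> V"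
      show "X q $ 1 * field_deriv X 2 q - X q $ 2 * field_deriv X 1 q = \<epsilon> * (X q $ 2) ^ 3 / (q $ 1) ^ 3"
        by (rule geodesic_foliation_equation[OF U ode eps geo V(1,3,4,5) q sub])
      show "q $ 1 \<noteq> 0" using q V(3) U(2) by blast
      show "X q \<noteq> 0" "W i q = span {X q}" using V(5)[OF q] by auto
    qed (use V in auto)
    then show ?thesis by (intro exI[of _ V] exI[of _ X] conjI V)
  qed
  note 1 = this
  have 2: "\<exists>c \<alpha> \<beta>. tangent_path U (W i) p c \<and> 0 \<le> \<alpha> \<and> \<alpha> < \<beta> \<and> \<beta> \<le> 1 \<and>
        c ` {0..\<beta>} \<subseteq> N \<and> (\<forall>t\<in>{\<alpha>..\<beta>}. vector_derivative c (at t) \<noteq> 0)"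
    if "p \<in> U" "open N" "p \<in> N" for p N
    by (rule geodesic_leaf_path[OF geo[OF that(1)] that(2,3)]) blast
  show ?thesis unfolding geodesic_foliation_def by (intro conjI ballI allI impI 1 2 U(1))
qed

lemma geodesic_fieldD:
  assumes "geodesic_field \<epsilon> V L X"
  shows "open V" "smooth_on V X" "smooth_on V (\<lambda>q. X q $ k)"
    "q \<in> V \<Longrightarrow> q $ 1 \<noteq> 0" "q \<in> V \<Longrightarrow> X q \<noteq> 0" "q \<in> V \<Longrightarrow> L q = span {X q}"
    "q \<in> V \<Longrightarrow> X q $ 1 * field_deriv X 2 q - X q $ 2 * field_deriv X 1 q = \<epsilon> * (X q $ 2) ^ 3 / (q $ 1) ^ 3"
  using assms smooth_on_nth unfolding geodesic_field_def by auto

text \<open>With velocity \<open>r X\<close>, where \<open>r\<close> may vanish, the dual vector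
  satisfies a linear equation \<open>F' = \<kappa> F\<close>, so its class is locally constant on
  the connected interval \<open>{0..1}\<close>. Generators \<open>X\<close> exist only locally;
  \<open>dual_point\<close> is what can be compared between their domains.\<close>

lemma dual_point_on_path:
  assumes fol: "geodesic_foliation \<epsilon> U L" and c: "tangent_path U L p c" and t: "t \<in> {0..1}"
  shows "dual_point \<epsilon> L (c t) = dual_point \<epsilon> L p"
proof -
  have "dual_point \<epsilon> L (c t) = dual_point \<epsilon> L (c 0)"
  proof (rule connected_local_const[where A = "{0..1}" and f = "\<lambda>t. dual_point \<epsilon> L (c t)"])
    show "\<forall>a\<in>{0..1}. \<forall>\<^sub>F b in at a within {0..1}. dual_point \<epsilon> L (c a) = dual_point \<epsilon> L (c b)"
    proof
      fix a :: real assume a: "a \<in> {0..1}"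
      have "c a \<in> U" using tangent_pathD(2)[OF c a] .
      then obtain V X where V: "c a \<in> V" "V \<subseteq> U" "geodesic_field \<epsilon> V L X"
        by (rule geodesic_foliation_field[OF fol])
      note X = geodesic_fieldD[OF V(3)]
      have "isCont c a" using has_vector_derivative_continuous[OF tangent_pathD(1)[OF c a]] .
      moreover obtain r where r: "r > 0" "ball (c a) r \<subseteq> V" by (rule openE[OF X(1) V(1)])
      ultimately have "\<exists>d>0. \<forall>s. dist s a < d \<longrightarrow> dist (c s) (c a) < r"
        unfolding continuous_at_eps_delta by simp
      then obtain d where d: "d > 0" "\<And>s. dist s a < d \<Longrightarrow> dist (c s) (c a) < r" by blast
      have inV: "c s \<in> V" if "s \<in> ball a d" for s
        using d(2)[of s] that r(2) by (auto simp: dist_commute subset_iff)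
      let ?F = "\<lambda>s. dual_vector \<epsilon> (c s) (X (c s))"
      have "\<exists>e>0. \<forall>s\<in>{0..1} \<inter> ball a e. span {?F s} = span {?F a}"
      proof (rule span_locally_const[OF _ a d(1)])
        show "convex {0..1::real}" by simp
        show "?F a \<noteq> 0" by (rule dual_vector_nonzero[OF X(5)[OF V(1)]])
        fix s assume s: "s \<in> {0..1} \<inter> ball a d"
        have s01: "s \<in> {0..1}" and sV: "c s \<in> V" using s inV by auto
        have "vector_derivative c (at s) \<in> span {X (c s)}" using tangent_pathD(3)[OF c s01] X(6)[OF sV] by simp
        then obtain r where "vector_derivative c (at s) = r *\<^sub>R X (c s)" by (auto simp: span_singleton)
        then have dc: "(c has_vector_derivative r *\<^sub>R X (c s)) (at s within {0..1})"
          using has_vector_derivative_at_within[OF tangent_pathD(1)[OF c s01]] by simp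
        have dX: "((\<lambda>s. X (c s) $ k) has_real_derivative r * field_deriv X k (c s)) (at s within {0..1})" for k
          using has_partials_curve[OF smooth_on_has_partials[OF X(3)[of k] sV] dc]
          by (simp add: field_deriv_def algebra_simps)
        show "\<exists>\<kappa>. \<forall>i. ((\<lambda>s. ?F s $ i) has_real_derivative \<kappa> * ?F s $ i) (at s within {0..1})"
          by (rule dual_vector_derivative[OF dc dX X(4)[OF sV] X(5)[OF sV] X(7)[OF sV]])
      qed
      then obtain e where e: "e > 0" "\<And>s. s \<in> {0..1} \<inter> ball a e \<Longrightarrow> span {?F s} = span {?F a}" by blast
      have "dual_point \<epsilon> L (c a) = dual_point \<epsilon> L (c s)" if "s \<in> {0..1}" "dist s a < min d e" for s
      proof -
        have "c s \<in> V" "s \<in> ball a e" using that inV[of s] by (auto simp: dist_commute)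
        then show ?thesis using that(1) e(2)[of s] dual_point_eq[where L = L and p = "c a", OF X(6)[OF V(1)]]
            dual_point_eq[where L = L and p = "c s", OF X(6)[of "c s"]] by simp
      qed
      then show "\<forall>\<^sub>F b in at a within {0..1}. dual_point \<epsilon> L (c a) = dual_point \<epsilon> L (c b)"
        unfolding eventually_at using d(1) e(1) by (intro exI[of _ "min d e"]) auto
    qed
  qed (use t in auto)
  then show ?thesis using tangent_pathD(6)[OF c t] by simp
qed

lemma dual_point_nonzero_rep:
  assumes "geodesic_foliation \<epsilon> U L" "p \<in> U"
  obtains X where "X \<noteq> 0" "L p = span {X}" "dual_point \<epsilon> L p = span {dual_vector \<epsilon> p X}" "dual_vector \<epsilon> p X \<noteq> 0" "p $ 1 \<noteq> 0"
proof -
  obtain V X where V: "p \<in> V" "V \<subseteq> U" "geodesic_field \<epsilon> V L X"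
    by (rule geodesic_foliation_field[OF assms])
  note X = geodesic_fieldD(4-6)[OF V(3) V(1)]
  show ?thesis using that[OF X(2,3) dual_point_eq[where L = L and p = p, OF X(3)] dual_vector_nonzero[OF X(2)] X(1)] .
qed

lemma geodesic_foliation_subspace:
  assumes "geodesic_foliation \<epsilon> U L" "p \<in> U"
  shows "subspace (L p)"
proof -
  obtain X where "L p = span {X}" using dual_point_nonzero_rep[OF assms] by metis
  then show ?thesis by simp
qed

lemma dual_point_leaf:
  assumes "geodesic_foliation \<epsilon> U L" "q \<in> leaf U L p"
  shows "q \<in> U" "dual_point \<epsilon> L q = dual_point \<epsilon> L p"
proof -
  obtain c where c: "tangent_path U L p c" "c 1 = q" using assms(2) unfolding leaf_altdef pathfinish_def by blast
  show "q \<in> U" using tangent_pathD(2)[OF c(1), of 1] c(2) by simp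
  show "dual_point \<epsilon> L q = dual_point \<epsilon> L p" using dual_point_on_path[OF assms(1) c(1), of 1] c(2) by simp
qed

text \<open>A point of the quadric is determined by incidence with \<open>q\<close> and tangency to
  \<open>X\<close>: for given \<open>v $ 4\<close>, tangency, the quadric and incidence yield
  \<open>E\<close>, \<open>v $ 1\<close> and \<open>v $ 3\<close> in turn. For a double line,
  \<open>v $ 4 = 0\<close>, the tangency equation is void and \<open>D0\<close> takes its
  place.\<close>

lemma span_eq_dual_vector:
  assumes z: "q $ 1 \<noteq> 0" and X: "X \<noteq> 0" and v: "v \<noteq> 0"
    and quad: "v $ 1 * v $ 3 - (v $ 2)\<^sup>2 + \<epsilon> * (v $ 4)\<^sup>2 = 0"
    and con: "v $ 1 * (q $ 2)\<^sup>2 + 2 * v $ 2 * q $ 2 + v $ 3 + v $ 4 * (q $ 1)\<^sup>2 = 0"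
    and tan: "(v $ 1 * q $ 2 + v $ 2) * X $ 2 + v $ 4 * q $ 1 * X $ 1 = 0"
    and D0: "v $ 4 = 0 \<Longrightarrow> X $ 2 = 0"
  shows "span {v} = span {dual_vector \<epsilon> q X}"
proof -
  define E where "E = v $ 1 * q $ 2 + v $ 2"
  have v3: "v $ 3 = - v $ 1 * (q $ 2)\<^sup>2 - 2 * v $ 2 * q $ 2 - v $ 4 * (q $ 1)\<^sup>2" using con by (simp add: algebra_simps)
  have v2: "v $ 2 = E - v $ 1 * q $ 2" by (simp add: E_def)
  have EE: "E\<^sup>2 + v $ 1 * v $ 4 * (q $ 1)\<^sup>2 = \<epsilon> * (v $ 4)\<^sup>2"
    using quad unfolding v3 E_def by (simp add: power2_eq_square algebra_simps)
  obtain k where k: "v = k *\<^sub>R dual_vector \<epsilon> q X"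
  proof (cases "v $ 4 = 0")
    case True
    then have X2: "X $ 2 = 0" and X1: "X $ 1 \<noteq> 0" using D0 X by (auto simp: vec2_nonzero)
    have E0: "E = 0" using EE True by simp
    have "v = (v $ 1 / (X $ 1)\<^sup>2) *\<^sub>R dual_vector \<epsilon> q X"
      using X1 X2 True E0 v2 v3 by (simp add: vec_eq_iff forall_4 dual_vector_nth power2_eq_square)
    then show ?thesis by (rule that)
  next
    case False
    have X2: "X $ 2 \<noteq> 0" using tan False z X by (auto simp: vec2_nonzero)
    define \<tau> where "\<tau> = X $ 1 / X $ 2"
    have X1: "X $ 1 = \<tau> * X $ 2" using X2 by (simp add: \<tau>_def)
    have "X $ 2 * (E + v $ 4 * q $ 1 * \<tau>) = 0" using tan unfolding E_def[symmetric] X1 by (simp add: algebra_simps)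
    then have E: "E = - v $ 4 * q $ 1 * \<tau>" using X2 by (simp add: add_eq_0_iff)
    have "v $ 4 * (v $ 4 * (q $ 1)\<^sup>2 * \<tau>\<^sup>2 + v $ 1 * (q $ 1)\<^sup>2 - \<epsilon> * v $ 4) = 0"
      using EE unfolding E by (simp add: power2_eq_square algebra_simps)
    then have "v $ 1 * (q $ 1)\<^sup>2 = \<epsilon> * v $ 4 - v $ 4 * (q $ 1)\<^sup>2 * \<tau>\<^sup>2" using False by simp
    then have v1: "v $ 1 = \<epsilon> * v $ 4 / (q $ 1)\<^sup>2 - v $ 4 * \<tau>\<^sup>2" using z by (simp add: field_simps)
    \<comment> \<open>Forced by the fourth component, which is \<open>- (X $ 2)\<^sup>2\<close> for
      the dual vector.\<close>
    define k where "k = - v $ 4 / (X $ 2)\<^sup>2"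
    have kX: "k * (X $ 2)\<^sup>2 = - v $ 4" using X2 by (simp add: k_def)
    have c1: "k * dual_vector \<epsilon> q X $ 1 = v $ 1"
    proof -
      have "k * dual_vector \<epsilon> q X $ 1 = (k * (X $ 2)\<^sup>2) * (\<tau>\<^sup>2 - \<epsilon> / (q $ 1)\<^sup>2)"
        by (simp add: dual_vector_nth X1 power2_eq_square algebra_simps)
      then show ?thesis unfolding kX v1 by (simp add: algebra_simps)
    qed
    have c2: "k * dual_vector \<epsilon> q X $ 2 = v $ 2"
    proof -
      have "k * dual_vector \<epsilon> q X $ 2 = (k * (X $ 2)\<^sup>2) * q $ 1 * \<tau> - q $ 2 * (k * dual_vector \<epsilon> q X $ 1)"
        unfolding dual_vector_nth(2) X1 by (simp add: power2_eq_square algebra_simps)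
      then show ?thesis unfolding kX c1 v2 E by (simp add: algebra_simps)
    qed
    have c3: "k * dual_vector \<epsilon> q X $ 3 = v $ 3"
    proof -
      have "k * dual_vector \<epsilon> q X $ 3 = (k * (X $ 2)\<^sup>2) * ((q $ 1)\<^sup>2 - 2 * q $ 2 * q $ 1 * \<tau>) + (q $ 2)\<^sup>2 * (k * dual_vector \<epsilon> q X $ 1)"
        unfolding dual_vector_nth(3) X1 by (simp add: power2_eq_square algebra_simps)
      then show ?thesis unfolding kX c1 v3 v2 E by (simp add: power2_eq_square algebra_simps)
    qed
    have "v = k *\<^sub>R dual_vector \<epsilon> q X"
      using c1 c2 c3 kX by (simp add: vec_eq_iff forall_4 dual_vector_nth(4))
    then show ?thesis by (rule that)
  qed
  moreover have "k \<noteq> 0" using k v by auto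
  ultimately show ?thesis using span_singleton_scale[of k "dual_vector \<epsilon> q X"] by simp
qed

text \<open>The dual focal curve admits every conic from the quadric that contains some leaf. The
  conic of the dual point qualifies because that point is constant along the leaf; conversely, a
  conic containing a leaf is tangent to it at a point of nonzero velocity, which determines the
  conic.\<close>

lemma dual_focal_curve_eq:
  assumes fol: "geodesic_foliation \<epsilon> U L"
  shows "dual_focal_curve \<epsilon> U L = dual_point \<epsilon> L ` U"
proof (intro subset_antisym subsetI)
  fix P assume "P \<in> dual_point \<epsilon> L ` U"
  then obtain p where p: "p \<in> U" "P = dual_point \<epsilon> L p" by blast
  obtain X where X: "dual_point \<epsilon> L p = span {dual_vector \<epsilon> p X}" "dual_vector \<epsilon> p X \<noteq> 0" "p $ 1 \<noteq> 0"
    by (rule dual_point_nonzero_rep[OF fol p(1)])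
  have "leaf U L p \<subseteq> conic (dual_vector \<epsilon> p X)"
  proof
    fix q assume "q \<in> leaf U L p"
    note q = dual_point_leaf[OF fol this]
    obtain Y where Y: "dual_point \<epsilon> L q = span {dual_vector \<epsilon> q Y}" "dual_vector \<epsilon> q Y \<noteq> 0"
      by (rule dual_point_nonzero_rep[OF fol q(1)])
    have "conic (dual_vector \<epsilon> q Y) = conic (dual_vector \<epsilon> p X)"
      by (rule conic_span_cong) (use q X Y in auto)
    then show "q \<in> conic (dual_vector \<epsilon> p X)" using conic_dual_vector by blast
  qed
  moreover have "span {dual_vector \<epsilon> p X} \<in> quadric \<epsilon>"
    unfolding quadric_span_iff[OF X(2)] by (rule dual_vector_quadric[OF X(3)])
  ultimately show "P \<in> dual_focal_curve \<epsilon> U L"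
    unfolding dual_focal_curve_def p(2) X(1) using X(2) p(1) by blast
next
  fix P assume "P \<in> dual_focal_curve \<epsilon> U L"
  then obtain v p where v: "P = span {v}" "v \<noteq> 0" "span {v} \<in> quadric \<epsilon>" and p: "p \<in> U" "leaf U L p \<subseteq> conic v"
    unfolding dual_focal_curve_def by blast
  obtain c \<alpha> \<beta> where c: "tangent_path U L p c" "0 \<le> \<alpha>" "\<alpha> < \<beta>" "\<beta> \<le> 1" "c ` {0..\<beta>} \<subseteq> U"
    "\<forall>t\<in>{\<alpha>..\<beta>}. vector_derivative c (at t) \<noteq> 0"
    by (rule geodesic_foliation_path[OF fol p(1) geodesic_foliation_open[OF fol] p(1)])
  define t where "t = (\<alpha> + \<beta>) / 2"
  have t: "t \<in> {\<alpha>..\<beta>}" "t \<in> {0<..<1}" "t \<in> {0..1}" using c by (auto simp: t_def)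
  have con: "v $ 1 * (c s $ 2)\<^sup>2 + 2 * v $ 2 * c s $ 2 + v $ 3 + v $ 4 * (c s $ 1)\<^sup>2 = 0" if "s \<in> {0..1}" for s
  proof -
    have "c s \<in> leaf U L p"
    proof (rule tangent_path_in_leaf[OF c(1)])
      show "c ` {0..s} \<subseteq> U" using tangent_pathD(2)[OF c(1)] that by auto
    qed (use that geodesic_foliation_subspace[OF fol] in auto)
    then have "c s \<in> conic v" using p(2) by blast
    then show ?thesis by (simp add: conic_def)
  qed
  let ?q = "c t"
  have qU: "?q \<in> U" by (rule tangent_pathD(2)[OF c(1) t(3)])
  obtain X where X: "X \<noteq> 0" "L ?q = span {X}" "dual_point \<epsilon> L ?q = span {dual_vector \<epsilon> ?q X}" "dual_vector \<epsilon> ?q X \<noteq> 0" "?q $ 1 \<noteq> 0"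
    by (rule dual_point_nonzero_rep[OF fol qU])
  obtain r where r: "vector_derivative c (at t) = r *\<^sub>R X"
    using tangent_pathD(3)[OF c(1) t(3)] unfolding X(2) by (auto simp: span_singleton)
  have r0: "r \<noteq> 0" using c(6) t(1) r by auto
  have dc: "((\<lambda>s. c s $ k) has_real_derivative r * X $ k) (at t)" for k
    using has_vector_derivative_nth[OF tangent_pathD(1)[OF c(1) t(3)], of k] r by simp
  \<comment> \<open>Differentiating the equation of the conic along the leaf gives the tangency
    condition, up to the factor \<open>2 r\<close>.\<close>
  have "((\<lambda>s. v $ 1 * (c s $ 2)\<^sup>2 + 2 * v $ 2 * c s $ 2 + v $ 3 + v $ 4 * (c s $ 1)\<^sup>2) has_real_derivative
      2 * r * ((v $ 1 * ?q $ 2 + v $ 2) * X $ 2 + v $ 4 * ?q $ 1 * X $ 1)) (at t)"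
    by (rule DERIV_cong[OF DERIV_add[OF DERIV_add[OF DERIV_add[OF DERIV_cmult[OF DERIV_power[OF dc[of 2], of 2]]
          DERIV_cmult[OF dc[of 2]]] DERIV_const] DERIV_cmult[OF DERIV_power[OF dc[of 1], of 2]]]])
      (simp add: algebra_simps)
  moreover have "((\<lambda>s. v $ 1 * (c s $ 2)\<^sup>2 + 2 * v $ 2 * c s $ 2 + v $ 3 + v $ 4 * (c s $ 1)\<^sup>2) has_real_derivative 0) (at t)"
    by (rule has_field_derivative_transform_within_open[OF DERIV_const[of 0] _ t(2)]) (use con in auto)
  ultimately have "2 * r * ((v $ 1 * ?q $ 2 + v $ 2) * X $ 2 + v $ 4 * ?q $ 1 * X $ 1) = 0" by (rule DERIV_unique)
  then have tan: "(v $ 1 * ?q $ 2 + v $ 2) * X $ 2 + v $ 4 * ?q $ 1 * X $ 1 = 0" using r0 by simp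
  have quad: "v $ 1 * v $ 3 - (v $ 2)\<^sup>2 + \<epsilon> * (v $ 4)\<^sup>2 = 0" using v(3) quadric_span_iff[OF v(2)] by blast
  \<comment> \<open>A double line of the quadric is \<open>y = - v $ 2 / v $ 1\<close>, and a path
    inside it has no velocity in \<open>y\<close>.\<close>
  have D0: "X $ 2 = 0" if "v $ 4 = 0"
  proof -
    have v1: "v $ 1 \<noteq> 0"
    proof
      assume "v $ 1 = 0"
      then have "v = 0" using quad con[OF t(3)] that by (simp add: vec_eq_iff forall_4)
      then show False using v(2) by simp
    qed
    have "c s $ 2 = - v $ 2 / v $ 1" if "s \<in> {0..1}" for s
    proof -
      have "(v $ 1 * c s $ 2 + v $ 2)\<^sup>2 = v $ 1 * (v $ 1 * (c s $ 2)\<^sup>2 + 2 * v $ 2 * c s $ 2 + v $ 3 + v $ 4 * (c s $ 1)\<^sup>2)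
        - (v $ 1 * v $ 3 - (v $ 2)\<^sup>2 + \<epsilon> * (v $ 4)\<^sup>2)"
        using \<open>v $ 4 = 0\<close> by (simp add: power2_eq_square algebra_simps)
      also have "\<dots> = 0" unfolding con[OF that] quad by simp
      finally have "v $ 1 * c s $ 2 + v $ 2 = 0" by simp
      then show ?thesis using v1 by (simp add: field_simps add_eq_0_iff)
    qed
    then have "((\<lambda>s. c s $ 2) has_real_derivative 0) (at t)"
      by (intro has_field_derivative_transform_within_open[OF DERIV_const _ t(2)]) auto
    then have "r * X $ 2 = 0" using dc[of 2] DERIV_unique by blast
    then show "X $ 2 = 0" using r0 by simp
  qed
  have "span {v} = dual_point \<epsilon> L ?q"
    unfolding X(3) by (rule span_eq_dual_vector[OF X(5,1) v(2) quad con[OF t(3)] tan D0])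
  then show "P \<in> dual_point \<epsilon> L ` U" using v(1) qU by blast
qed

text \<open>Differentiating the quadratic equation on the open set removes its coefficients one by
  one. The use: the leaves of a foliation of an open set cannot all share one conic.\<close>

lemma open_subset_conic_imp_zero:
  assumes U: "open U" "U \<noteq> {}" "\<forall>p\<in>U. p $ 1 \<noteq> 0" and sub: "U \<subseteq> conic v"
  shows "v = 0"
proof -
  have F: "has_partials (\<lambda>q. v $ 1 * (q $ 2)\<^sup>2 + 2 * v $ 2 * q $ 2 + v $ 3 + v $ 4 * (q $ 1)\<^sup>2)
      (2 * v $ 4 * q $ 1) (2 * (v $ 1 * q $ 2 + v $ 2)) q" for q
    unfolding has_partials_def
    by (rule has_derivative_eq_rhs, (rule derivative_intros bounded_linear_imp_has_derivative[OF bounded_linear_vec_nth])+)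
      (auto simp: fun_eq_iff algebra_simps)
  have zero: "v $ 1 * (q $ 2)\<^sup>2 + 2 * v $ 2 * q $ 2 + v $ 3 + v $ 4 * (q $ 1)\<^sup>2 = 0" if "q \<in> U" for q
    using sub that by (auto simp: conic_def)
  have d: "2 * v $ 4 * q $ 1 = 0 \<and> 2 * (v $ 1 * q $ 2 + v $ 2) = 0" if q: "q \<in> U" for q
    using has_partials_unique[OF has_partials_cong[OF F U(1) q zero] has_partials_const] by simp
  have G: "has_partials (\<lambda>q. 2 * (v $ 1 * q $ 2 + v $ 2)) 0 (2 * v $ 1) q" for q
    unfolding has_partials_def
    by (rule has_derivative_eq_rhs, (rule derivative_intros bounded_linear_imp_has_derivative[OF bounded_linear_vec_nth])+)
      (auto simp: fun_eq_iff algebra_simps)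
  obtain q where q: "q \<in> U" using U by blast
  have "2 * v $ 1 = 0"
    using has_partials_unique(2)[OF has_partials_cong[OF G U(1) q] has_partials_const] d by blast
  then show ?thesis using d[OF q] zero[OF q] U(3) q by (simp add: vec_eq_iff forall_4)
qed

section \<open>Dual focal curves as arcs\<close>

text \<open>\<open>arc_of\<close> asks for continuous lifts to \<open>real^4\<close>. Local
  generators of the line field need not fit together over \<open>U\<close>, whereas normalized ones
  give a lift defined on all of \<open>U\<close>.\<close>

definition unit_dual_vector :: "real \<Rightarrow> (real^2 \<Rightarrow> (real^2) set) \<Rightarrow> real^2 \<Rightarrow> real^4" where
  "unit_dual_vector \<epsilon> L q = dual_vector \<epsilon> q (SOME x. x \<in> L q \<and> norm x = 1)"

text \<open>The two unit vectors on a line have the same dual vector.\<close>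

lemma unit_dual_vector_eq:
  assumes L: "L q = span {X}" and X: "X \<noteq> 0"
  shows "unit_dual_vector \<epsilon> L q = (1 / (norm X)\<^sup>2) *\<^sub>R dual_vector \<epsilon> q X"
proof -
  let ?x = "SOME x. x \<in> L q \<and> norm x = 1"
  have "(1 / norm X) *\<^sub>R X \<in> L q \<and> norm ((1 / norm X) *\<^sub>R X) = 1"
    using X unfolding L by (auto intro: span_mul span_base)
  then have x: "?x \<in> L q \<and> norm ?x = 1" by (rule someI[where P = "\<lambda>x. x \<in> L q \<and> norm x = 1"])
  then obtain k where k: "?x = k *\<^sub>R X" unfolding L by (auto simp: span_singleton)
  then have "\<bar>k\<bar> * norm X = 1" using x by simp
  then have "k\<^sup>2 * (norm X)\<^sup>2 = 1" by (metis power_mult_distrib power2_abs one_power2)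
  then have "k\<^sup>2 = 1 / (norm X)\<^sup>2" using X by (simp add: field_simps)
  then show ?thesis unfolding unit_dual_vector_def k dual_vector_scale by simp
qed

lemma continuous_on_unit_dual_vector:
  assumes fol: "geodesic_foliation \<epsilon> U L"
  shows "continuous_on U (unit_dual_vector \<epsilon> L)"
proof (rule continuous_at_imp_continuous_on, rule)
  fix p assume p: "p \<in> U"
  obtain V X where V: "p \<in> V" "V \<subseteq> U" "geodesic_field \<epsilon> V L X"
    by (rule geodesic_foliation_field[OF fol p])
  note X = geodesic_fieldD[OF V(3)]
  have "smooth_on V (\<lambda>q. dual_vector \<epsilon> q (X q) $ 1)"
    unfolding dual_vector_nth(1) using X(4) by (intro smooth_on_intros X(1,3))
  then have "smooth_on V (\<lambda>q. dual_vector \<epsilon> q (X q) $ i)" for i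
    using exhaust_4[of i] by (auto simp: dual_vector_nth(2-4) intro!: smooth_on_intros X(1,3))
  then have "continuous_on V (\<lambda>q. \<chi> i. dual_vector \<epsilon> q (X q) $ i)"
    by (intro continuous_on_vec_lambda smooth_on_continuous_on)
  then have "continuous_on V (\<lambda>q. (1 / (norm (X q))\<^sup>2) *\<^sub>R dual_vector \<epsilon> q (X q))"
    using X(5) by (intro continuous_intros smooth_on_continuous_on[OF X(2)]) auto
  then have "continuous_on V (unit_dual_vector \<epsilon> L)"
    by (rule continuous_on_eq) (simp add: unit_dual_vector_eq X(5,6))
  then show "isCont (unit_dual_vector \<epsilon> L) p"
    using X(1) V(1) by (simp add: continuous_on_eq_continuous_at)
qed

text \<open>Besides the inclusion in \<open>S\<close>, the demands of \<open>arc_of\<close> come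
  from \<open>U\<close>: one dual point for all of \<open>U\<close> would put this open set on a
  single conic, and paths in \<open>U\<close> lift through \<open>unit_dual_vector\<close>.
  Statements about arcs thus become pointwise.\<close>

lemma arc_of_dual_focal_curve_iff:
  assumes fol: "geodesic_foliation \<epsilon> U L" and U: "connected U" "U \<noteq> {}"
  shows "arc_of (dual_focal_curve \<epsilon> U L) S \<longleftrightarrow> (\<forall>p\<in>U. dual_point \<epsilon> L p \<in> S)"
proof
  assume "arc_of (dual_focal_curve \<epsilon> U L) S"
  then have "dual_focal_curve \<epsilon> U L \<subseteq> S" by (simp only: arc_of_def)
  then show "\<forall>p\<in>U. dual_point \<epsilon> L p \<in> S" unfolding dual_focal_curve_eq[OF fol] by auto
next
  assume S: "\<forall>p\<in>U. dual_point \<epsilon> L p \<in> S"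
  have oU: "open U" by (rule geodesic_foliation_open[OF fol])
  have U1: "\<forall>p\<in>U. p $ 1 \<noteq> 0" using dual_point_nonzero_rep[OF fol] by metis
  have lift: "unit_dual_vector \<epsilon> L q \<noteq> 0 \<and> span {unit_dual_vector \<epsilon> L q} = dual_point \<epsilon> L q" if q: "q \<in> U" for q
  proof -
    obtain X where X: "X \<noteq> 0" "L q = span {X}" "dual_point \<epsilon> L q = span {dual_vector \<epsilon> q X}" "dual_vector \<epsilon> q X \<noteq> 0"
      by (rule dual_point_nonzero_rep[OF fol q])
    have nz: "1 / (norm X)\<^sup>2 \<noteq> 0" using X(1) by simp
    show ?thesis
      unfolding unit_dual_vector_eq[where L = L and q = q, OF X(2,1)] X(3)
      using X(4) X(1) span_singleton_scale[OF nz, of "dual_vector \<epsilon> q X"] by (intro conjI) (simp, assumption)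
  qed
  have nonconst: "\<exists>p\<in>U. \<exists>q\<in>U. dual_point \<epsilon> L p \<noteq> dual_point \<epsilon> L q"
  proof (rule ccontr)
    assume eq: "\<not> ?thesis"
    obtain p where p: "p \<in> U" using U by blast
    obtain X where X: "dual_point \<epsilon> L p = span {dual_vector \<epsilon> p X}" "dual_vector \<epsilon> p X \<noteq> 0"
      by (rule dual_point_nonzero_rep[OF fol p])
    have "U \<subseteq> conic (dual_vector \<epsilon> p X)"
    proof
      fix q assume q: "q \<in> U"
      obtain Y where Y: "dual_point \<epsilon> L q = span {dual_vector \<epsilon> q Y}" "dual_vector \<epsilon> q Y \<noteq> 0"
        by (rule dual_point_nonzero_rep[OF fol q])
      have "dual_point \<epsilon> L q = dual_point \<epsilon> L p" using eq p q by blast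
      then have "conic (dual_vector \<epsilon> q Y) = conic (dual_vector \<epsilon> p X)"
        by (intro conic_span_cong) (use X Y in auto)
      then show "q \<in> conic (dual_vector \<epsilon> p X)" using conic_dual_vector by blast
    qed
    then show False using open_subset_conic_imp_zero[OF oU U(2) U1] X(2) by blast
  qed
  have path: "\<exists>w. path w \<and> (\<forall>t\<in>{0..1}. w t \<noteq> 0 \<and> span {w t} \<in> dual_point \<epsilon> L ` U) \<and>
      span {pathstart w} = dual_point \<epsilon> L p \<and> span {pathfinish w} = dual_point \<epsilon> L q" if pq: "p \<in> U" "q \<in> U" for p q
  proof -
    have "path_connected U" using connected_open_path_connected[OF oU U(1)] .
    then obtain \<pi> where \<pi>: "path \<pi>" "path_image \<pi> \<subseteq> U" "pathstart \<pi> = p" "pathfinish \<pi> = q"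
      using pq unfolding path_connected_def by blast
    have inU: "\<pi> t \<in> U" if "t \<in> {0..1}" for t using \<pi>(2) that by (auto simp: path_image_def)
    have "path (unit_dual_vector \<epsilon> L \<circ> \<pi>)"
      by (rule path_continuous_image[OF \<pi>(1) continuous_on_subset[OF continuous_on_unit_dual_vector[OF fol] \<pi>(2)]])
    moreover have "\<forall>t\<in>{0..1}. (unit_dual_vector \<epsilon> L \<circ> \<pi>) t \<noteq> 0 \<and> span {(unit_dual_vector \<epsilon> L \<circ> \<pi>) t} \<in> dual_point \<epsilon> L ` U"
      using lift inU by simp
    moreover have "span {pathstart (unit_dual_vector \<epsilon> L \<circ> \<pi>)} = dual_point \<epsilon> L p"
      "span {pathfinish (unit_dual_vector \<epsilon> L \<circ> \<pi>)} = dual_point \<epsilon> L q"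
      using lift[OF pq(1)] lift[OF pq(2)] \<pi>(3,4) by (simp_all add: pathstart_compose pathfinish_compose)
    ultimately show ?thesis by (intro exI[of _ "unit_dual_vector \<epsilon> L \<circ> \<pi>"] conjI)
  qed
  show "arc_of (dual_focal_curve \<epsilon> U L) S"
    unfolding arc_of_def dual_focal_curve_eq[OF fol]
  proof (intro conjI ballI)
    show "dual_point \<epsilon> L ` U \<subseteq> S" using S by auto
    show "\<exists>P\<in>dual_point \<epsilon> L ` U. \<exists>Q\<in>dual_point \<epsilon> L ` U. P \<noteq> Q" using nonconst by simp
    fix P Q assume "P \<in> dual_point \<epsilon> L ` U" "Q \<in> dual_point \<epsilon> L ` U"
    then obtain p q where pq: "p \<in> U" "q \<in> U" "P = dual_point \<epsilon> L p" "Q = dual_point \<epsilon> L q" by auto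
    show "\<exists>w. path w \<and> (\<forall>t\<in>{0..1}. w t \<noteq> 0 \<and> span {w t} \<in> dual_point \<epsilon> L ` U) \<and>
      span {pathstart w} = P \<and> span {pathfinish w} = Q"
      unfolding pq(3,4) by (rule path[OF pq(1,2)])
  qed
qed

section \<open>The hexagonality equations\<close>

lemma partial_const_on:
  assumes "open V" "p \<in> V" "\<And>q. q \<in> V \<Longrightarrow> F q = c"
  shows "partial i F p = 0"
  using partial_cong[OF smooth_on_const[of V c] assms(1,2), of F i] assms(3)
    partial_eq[OF has_partials_const[of c p]] exhaust_2[of i] by auto

lemma smooth_on_inverse_coord:
  fixes V :: "(real^2) set"
  shows "open V \<Longrightarrow> \<forall>q\<in>V. q $ 1 \<noteq> 0 \<Longrightarrow> smooth_on V (\<lambda>q. inverse (q $ 1))"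
  by (intro smooth_on_intros) auto

lemma has_partials_inverse_coord:
  assumes "p $ 1 \<noteq> 0"
  shows "has_partials (\<lambda>q. inverse (q $ 1)) (- (inverse (p $ 1))\<^sup>2) 0 p"
proof -
  have "(inverse has_real_derivative - (inverse (p $ 1))\<^sup>2) (at (p $ 1))"
    using DERIV_inverse[OF assms] by (simp add: power2_eq_square power_inverse)
  from has_partials_compose[OF has_partials_coord1 this] show ?thesis by simp
qed

text \<open>A Burgers equation with source. The reciprocal of \<open>z\<close> is written with
  \<open>inverse\<close> so that it can serve as an atom in the polynomial identities proved by
  \<open>algebra\<close>.\<close>

definition slope_on :: "real \<Rightarrow> (real^2) set \<Rightarrow> (real^2 \<Rightarrow> real) \<Rightarrow> bool" where
  "slope_on \<epsilon> V S \<longleftrightarrow> open V \<and> (\<forall>p\<in>V. p $ 1 \<noteq> 0) \<and> smooth_on V S \<and>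
     (\<forall>p\<in>V. partial 2 S p = - S p * partial 1 S p - \<epsilon> * inverse (p $ 1) ^ 3)"

lemma slope_onD:
  assumes "slope_on \<epsilon> V S"
  shows "open V" "\<And>p. p \<in> V \<Longrightarrow> p $ 1 \<noteq> 0" "smooth_on V S"
    "\<And>p. p \<in> V \<Longrightarrow> partial 2 S p = - S p * partial 1 S p - \<epsilon> * inverse (p $ 1) ^ 3"
    "\<And>p. p \<in> V \<Longrightarrow> has_partials S (partial 1 S p) (partial 2 S p) p"
  using assms smooth_on_has_partials unfolding slope_on_def by blast+

lemma slope_on_subset: "slope_on \<epsilon> U S \<Longrightarrow> open V \<Longrightarrow> V \<subseteq> U \<Longrightarrow> slope_on \<epsilon> V S"
  unfolding slope_on_def using smooth_on_subset by blast

text \<open>Differentiating \<open>u\<^sub>y = - S u\<^sub>z\<close> in \<open>z\<close> gives the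
  conservation law \<open>f\<^sub>y + (S f)\<^sub>z = 0\<close> for
  \<open>f = u\<^sub>z\<close>.\<close>

lemma first_integral_conservation:
  assumes S: "slope_on \<epsilon> V S" and u: "smooth_on V u"
    and eq: "\<And>q. q \<in> V \<Longrightarrow> partial 2 u q = - S q * partial 1 u q" and p: "p \<in> V"
  shows "partial 2 (partial 1 u) p = - S p * partial 1 (partial 1 u) p - partial 1 S p * partial 1 u p"
proof -
  note o = slope_onD(1)[OF S]
  have "partial 2 (partial 1 u) p = partial 1 (partial 2 u) p"
    by (rule partial_commute[OF o u p])
  also have "\<dots> = partial 1 (\<lambda>q. - S q * partial 1 u q) p"
    by (rule partial_cong[OF _ o p])
      (use eq in \<open>auto intro!: smooth_on_intros o slope_onD(3)[OF S] smooth_on_partial u\<close>)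
  also have "\<dots> = - S p * partial 1 (partial 1 u) p - partial 1 S p * partial 1 u p"
    by (rule trans[OF partial_eq(1)], (rule slope_onD(5)[OF S p] smooth_on_has_partials[OF smooth_on_partial[OF u] p]
          has_partials_intros)+) simp
  finally show ?thesis .
qed

section \<open>Three finite slopes: the contradiction\<close>

text \<open>Turns identities between functions on \<open>z \<noteq> 0\<close> into identities
  between polynomials in \<open>z\<close> for one fixed \<open>y\<close>, which can then be
  evaluated at \<open>z = 0\<close>, outside the domain.\<close>

lemma polynomial_on_line:
  assumes V: "smooth_on V F" and zzz: "\<And>q. q \<in> V \<Longrightarrow> partial 1 (partial 1 (partial 1 F)) q = 0"
    and J: "\<And>z. z \<in> {a<..<b} \<Longrightarrow> vector [z, y] \<in> V"
  obtains P :: "real poly" where "\<And>z. z \<in> {a<..<b} \<Longrightarrow> F (vector [z, y]) = poly P z"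
proof -
  have line: "((\<lambda>z. G (vector [z, y])) has_real_derivative partial 1 G (vector [z, y])) (at z within {a<..<b})"
    if "smooth_on V G" "z \<in> {a<..<b}" for G z
  proof -
    have "((\<lambda>z. vector [z, y] :: real^2) has_vector_derivative axis 1 1) (at z within {a<..<b})"
      unfolding vector_2_eq_axis by (auto intro!: derivative_eq_intros)
    from has_partials_curve[where F = G and c = "\<lambda>z. vector [z, y]", OF smooth_on_has_partials[OF that(1) J[OF that(2)]] this]
    show ?thesis by (simp add: axis_def)
  qed
  have const: "\<exists>c. \<forall>z\<in>{a<..<b}. f z = c"
    if "\<And>z. z \<in> {a<..<b} \<Longrightarrow> (f has_real_derivative 0) (at z within {a<..<b})" for f :: "real \<Rightarrow> real"
    by (rule has_field_derivative_zero_constant[OF _ that]) auto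
  note sm = V smooth_on_partial[OF V, of 1] smooth_on_partial[OF smooth_on_partial[OF V, of 1], of 1]
  obtain k where k: "\<And>z. z \<in> {a<..<b} \<Longrightarrow> partial 1 (partial 1 F) (vector [z, y]) = k"
    using const[of "\<lambda>z. partial 1 (partial 1 F) (vector [z, y])"] line[OF sm(3)] zzz[OF J] by auto
  have "((\<lambda>z. partial 1 F (vector [z, y]) - k * z) has_real_derivative 0) (at z within {a<..<b})"
    if "z \<in> {a<..<b}" for z
    by (rule DERIV_cong[OF DERIV_diff[OF line[OF sm(2) that] DERIV_cmult[OF DERIV_ident]]]) (simp add: k[OF that])
  then obtain l where l: "\<And>z. z \<in> {a<..<b} \<Longrightarrow> partial 1 F (vector [z, y]) - k * z = l"
    using const[of "\<lambda>z. partial 1 F (vector [z, y]) - k * z"] by auto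
  have "((\<lambda>z. F (vector [z, y]) - (k / 2 * z ^ 2 + l * z)) has_real_derivative 0) (at z within {a<..<b})"
    if "z \<in> {a<..<b}" for z
    by (rule DERIV_cong[OF DERIV_diff[OF line[OF sm(1) that] DERIV_add[OF DERIV_cmult[OF DERIV_power[OF DERIV_ident]] DERIV_cmult[OF DERIV_ident]]]])
      (simp add: l[OF that, symmetric])
  then obtain m where m: "\<And>z. z \<in> {a<..<b} \<Longrightarrow> F (vector [z, y]) - (k / 2 * z ^ 2 + l * z) = m"
    using const[of "\<lambda>z. F (vector [z, y]) - (k / 2 * z ^ 2 + l * z)"] by auto
  show ?thesis
    by (rule that[of "[:m, l, k / 2:]"]) (use m in \<open>force simp: algebra_simps power2_eq_square\<close>)
qed

text \<open>Keeps the functions of degree at most two in \<open>z\<close> closed under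
  \<open>y\<close>-derivatives, so that the terms of a compatibility condition stay
  polynomial.\<close>

lemma partial_zzz_commute:
  assumes V: "open V" "smooth_on V F" and zzz: "\<And>q. q \<in> V \<Longrightarrow> partial 1 (partial 1 (partial 1 F)) q = 0" and p: "p \<in> V"
  shows "partial 1 (partial 1 (partial 1 (partial 2 F))) p = 0"
proof -
  note sm = V(2) smooth_on_partial[OF V(2), of 1] smooth_on_partial[OF smooth_on_partial[OF V(2), of 1], of 1]
  have sp: "smooth_on V (partial 2 G)" if "smooth_on V G" for G by (rule smooth_on_partial[OF that])
  have 1: "partial 1 (partial 2 F) q = partial 2 (partial 1 F) q" if "q \<in> V" for q
    by (rule partial_commute[OF V that])
  have 2: "partial 1 (partial 1 (partial 2 F)) q = partial 2 (partial 1 (partial 1 F)) q" if "q \<in> V" for q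
  proof -
    have "partial 1 (partial 1 (partial 2 F)) q = partial 1 (partial 2 (partial 1 F)) q"
      by (rule partial_cong[OF sp[OF sm(2)] V(1) that]) (simp add: 1)
    also have "\<dots> = partial 2 (partial 1 (partial 1 F)) q" by (rule partial_commute[OF V(1) sm(2) that])
    finally show ?thesis .
  qed
  have "partial 1 (partial 1 (partial 1 (partial 2 F))) p = partial 1 (partial 2 (partial 1 (partial 1 F))) p"
    by (rule partial_cong[OF sp[OF sm(3)] V(1) p]) (simp add: 2)
  also have "\<dots> = partial 2 (partial 1 (partial 1 (partial 1 F))) p" by (rule partial_commute[OF V(1) sm(3) p])
  also have "\<dots> = 0" by (rule partial_const_on[OF V(1) p zzz])
  finally show ?thesis .
qed

text \<open>If no foliation is the special one \<open>y = const\<close>, the elementary symmetric functions of the three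
  slopes satisfy the system below. For fixed \<open>y\<close> its compatibility condition, multiplied by \<open>z\<^sup>6\<close>, is polynomial
  in \<open>z\<close> with constant term \<open>15/2\<close>.\<close>

lemma symmetric_system_inconsistent:
  fixes e1 e2 e3 :: "real^2 \<Rightarrow> real"
  defines "w \<equiv> \<lambda>q :: real^2. inverse (q $ 1)"
  assumes V: "open V" "p \<in> V" "\<forall>q\<in>V. q $ 1 \<noteq> 0" and eps: "\<epsilon> * \<epsilon> = 1"
    and sm: "smooth_on V e1" "smooth_on V e2" "smooth_on V e3"
    and zz: "\<And>q. q \<in> V \<Longrightarrow> partial 1 (partial 1 e1) q = 0"
    and A: "\<And>q. q \<in> V \<Longrightarrow> partial 1 e2 q = e1 q * partial 1 e1 q + partial 2 e1 q + 3 * \<epsilon> * w q ^ 3"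
    and B: "\<And>q. q \<in> V \<Longrightarrow> partial 1 e3 q = partial 2 e2 q + 2 * \<epsilon> * e1 q * w q ^ 3 + partial 1 e1 q * e2 q"
    and C: "\<And>q. q \<in> V \<Longrightarrow> partial 2 e3 q = - e3 q * partial 1 e1 q - \<epsilon> * e2 q * w q ^ 3"
  shows False
proof -
  define m where "m = partial 1 e1"
  define my where "my = partial 2 m"
  define ey where "ey = partial 2 e1"
  \<comment> \<open>Adding \<open>3 \<epsilon> / (2 z\<^sup>2)\<close> cancels the pole
    \<open>3 \<epsilon> / z\<^sup>3\<close> in the \<open>z\<close>-derivative of \<open>e2\<close>;
    for fixed \<open>y\<close> the result is polynomial in \<open>z\<close>.\<close>
  define Q where "Q = (\<lambda>q. e2 q + 3 / 2 * \<epsilon> * w q ^ 2)"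
  have smw: "smooth_on V w" unfolding w_def by (rule smooth_on_inverse_coord[OF V(1,3)])
  have hw: "has_partials w (- (w q)\<^sup>2) 0 q" if "q \<in> V" for q
    unfolding w_def using has_partials_inverse_coord V(3) that by blast
  have sms: "smooth_on V m" "smooth_on V my" "smooth_on V ey" "smooth_on V Q" "smooth_on V (partial 2 Q)"
    "smooth_on V (partial 2 e2)" "smooth_on V (partial 2 (partial 2 e2))"
    unfolding m_def my_def ey_def Q_def
    by (intro smooth_on_intros smooth_on_partial smw sm V(1))+
  have h: "has_partials F (partial 1 F q) (partial 2 F q) q" if "smooth_on V F" "q \<in> V" for F q
    by (rule smooth_on_has_partials[OF that])
  have mz: "partial 1 m q = 0" if "q \<in> V" for q unfolding m_def by (rule zz[OF that])
  have eyz: "partial 1 ey q = my q" if "q \<in> V" for q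
    unfolding ey_def my_def m_def by (rule partial_commute[OF V(1) sm(1) that])
  have myz: "partial 1 my q = 0" if "q \<in> V" for q
  proof -
    have "partial 1 my q = partial 2 (partial 1 m) q" unfolding my_def by (rule partial_commute[OF V(1) sms(1) that])
    also have "\<dots> = 0" by (rule partial_const_on[OF V(1) that mz])
    finally show ?thesis .
  qed
  have Qz: "partial 1 Q q = e1 q * m q + ey q" if q: "q \<in> V" for q
    unfolding Q_def
    by (rule trans[OF partial_eq(1)], (rule hw[OF q] h[OF sm(2) q] has_partials_intros)+)
      (simp add: A[OF q] m_def ey_def power2_eq_square power3_eq_cube)
  have Qzz: "partial 1 (partial 1 Q) q = m q * m q + my q" if q: "q \<in> V" for q
  proof -
    have "partial 1 (partial 1 Q) q = partial 1 (\<lambda>q. e1 q * m q + ey q) q"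
      by (rule partial_cong[OF _ V(1) q]) (use Qz in \<open>auto intro!: smooth_on_intros V(1) sm sms\<close>)
    also have "\<dots> = m q * m q + my q"
      by (rule trans[OF partial_eq(1)], (rule h[OF sm(1) q] h[OF sms(1) q] h[OF sms(3) q] has_partials_intros)+)
        (simp add: mz[OF q] eyz[OF q] m_def[symmetric])
    finally show ?thesis .
  qed
  have Qzzz: "partial 1 (partial 1 (partial 1 Q)) q = 0" if q: "q \<in> V" for q
  proof -
    have "partial 1 (partial 1 (partial 1 Q)) q = partial 1 (\<lambda>q. m q * m q + my q) q"
      by (rule partial_cong[OF _ V(1) q]) (use Qzz in \<open>auto intro!: smooth_on_intros V(1) sms\<close>)
    also have "\<dots> = 0"
      by (rule trans[OF partial_eq(1)], (rule h[OF sms(1) q] h[OF sms(2) q] has_partials_intros)+)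
        (simp add: mz[OF q] myz[OF q])
    finally show ?thesis .
  qed
  have mzzz: "partial 1 (partial 1 (partial 1 m)) q = 0" if q: "q \<in> V" for q
    by (rule partial_const_on[OF V(1) q], rule partial_const_on[OF V(1) _ mz])
  have ezzz: "partial 1 (partial 1 (partial 1 e1)) q = 0" if q: "q \<in> V" for q
    by (rule partial_const_on[OF V(1) q zz])
  have Qy: "partial 2 Q q = partial 2 e2 q" if q: "q \<in> V" for q
    unfolding Q_def
    by (rule trans[OF partial_eq(2)], (rule hw[OF q] h[OF sm(2) q] has_partials_intros)+) simp
  have Qyy: "partial 2 (partial 2 Q) q = partial 2 (partial 2 e2) q" if q: "q \<in> V" for q
    by (rule partial_cong[OF sms(6) V(1) q]) (simp add: Qy)
  \<comment> \<open>Equality of the mixed derivatives of \<open>e3\<close>, computed from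
    \<open>B\<close> and from \<open>C\<close>.\<close>
  have compat: "partial 2 (partial 2 e2) q + 2 * \<epsilon> * ey q * w q ^ 3 + (m q * partial 2 e2 q + my q * e2 q)
    = - partial 1 e3 q * m q - \<epsilon> * (partial 1 e2 q * w q ^ 3 - 3 * e2 q * w q ^ 4)" if q: "q \<in> V" for q
  proof -
    have "partial 2 (partial 1 e3) q = partial 2 (\<lambda>q. partial 2 e2 q + 2 * \<epsilon> * e1 q * w q ^ 3 + m q * e2 q) q"
      by (rule partial_cong[OF _ V(1) q]) (use B in \<open>auto intro!: smooth_on_intros V(1) sm sms smw smooth_on_partial simp: m_def\<close>)
    also have "\<dots> = partial 2 (partial 2 e2) q + 2 * \<epsilon> * ey q * w q ^ 3 + (m q * partial 2 e2 q + my q * e2 q)"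
      by (rule trans[OF partial_eq(2)], (rule hw[OF q] h[OF sm(1) q] h[OF sm(2) q] h[OF sms(1) q] h[OF sms(6) q] has_partials_intros)+)
        (simp add: ey_def my_def)
    finally have 1: "partial 2 (partial 1 e3) q = partial 2 (partial 2 e2) q + 2 * \<epsilon> * ey q * w q ^ 3 + (m q * partial 2 e2 q + my q * e2 q)" .
    have "partial 1 (partial 2 e3) q = partial 1 (\<lambda>q. - e3 q * m q - \<epsilon> * e2 q * w q ^ 3) q"
      by (rule partial_cong[OF _ V(1) q]) (use C in \<open>auto intro!: smooth_on_intros V(1) sm sms smw smooth_on_partial simp: m_def\<close>)
    also have "\<dots> = - partial 1 e3 q * m q - \<epsilon> * (partial 1 e2 q * w q ^ 3 - 3 * e2 q * w q ^ 4)"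
      by (rule trans[OF partial_eq(1)], (rule hw[OF q] h[OF sm(3) q] h[OF sm(2) q] h[OF sms(1) q] has_partials_intros)+)
        (simp add: mz[OF q] algebra_simps power2_eq_square power3_eq_cube power4_eq_xxxx)
    finally have 2: "partial 1 (partial 2 e3) q = - partial 1 e3 q * m q - \<epsilon> * (partial 1 e2 q * w q ^ 3 - 3 * e2 q * w q ^ 4)" .
    show ?thesis using 1 2 partial_commute[OF V(1) sm(3) q, of 1 2] by simp
  qed
  define Qy' where "Qy' = partial 2 Q"
  define Qyy' where "Qyy' = partial 2 (partial 2 Q)"
  \<comment> \<open>Multiplication by \<open>z ^ 6\<close> turns the terms in \<open>w ^ 6\<close>
    into constants: 3 comes from the pole of the \<open>z\<close>-derivative of \<open>e2\<close>,
    and 9/2 from \<open>- 3 \<epsilon> e2 w ^ 4\<close> with the pole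
    \<open>- 3 \<epsilon> / (2 z\<^sup>2)\<close> of \<open>e2\<close>; together 15/2.\<close>
  have main: "15 / 2 + (q $ 1)\<^sup>2 * ((q $ 1) ^ 4 * (Qyy' q + my q * Q q + 2 * m q * Qy' q + m q * m q * Q q)
     + 3 * \<epsilon> * q $ 1 * (ey q + m q * e1 q) - 3 / 2 * \<epsilon> * (q $ 1)\<^sup>2 * (my q + m q * m q) - 3 * \<epsilon> * Q q) = 0"
    if q: "q \<in> V" for q
  proof -
    define z where "z = q $ 1"
    have zw: "z * w q = 1" using V(3) q by (simp add: z_def w_def)
    have e2: "e2 q = Q q - 3 / 2 * \<epsilon> * (w q)\<^sup>2" by (simp add: Q_def)
    have "Qyy' q + 2 * \<epsilon> * ey q * w q ^ 3 + (m q * Qy' q + my q * e2 q)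
      + (Qy' q + 2 * \<epsilon> * e1 q * w q ^ 3 + m q * e2 q) * m q
      + \<epsilon> * ((e1 q * m q + ey q + 3 * \<epsilon> * w q ^ 3) * w q ^ 3 - 3 * e2 q * w q ^ 4) = 0"
      using compat[OF q] unfolding B[OF q] A[OF q] Qyy'_def Qy'_def Qyy[OF q] Qy[OF q] m_def[symmetric] ey_def[symmetric]
      by (simp only: left_diff_distrib minus_mult_left[symmetric] distrib_right distrib_left right_diff_distrib)
    then have "z ^ 6 * (Qyy' q + 2 * \<epsilon> * ey q * w q ^ 3 + (m q * Qy' q + my q * e2 q)
      + (Qy' q + 2 * \<epsilon> * e1 q * w q ^ 3 + m q * e2 q) * m q
      + \<epsilon> * ((e1 q * m q + ey q + 3 * \<epsilon> * w q ^ 3) * w q ^ 3 - 3 * e2 q * w q ^ 4)) = 0" by simp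
    then have "15 / 2 + z\<^sup>2 * (z ^ 4 * (Qyy' q + my q * Q q + 2 * m q * Qy' q + m q * m q * Q q)
     + 3 * \<epsilon> * z * (ey q + m q * e1 q) - 3 / 2 * \<epsilon> * z\<^sup>2 * (my q + m q * m q) - 3 * \<epsilon> * Q q) = 0"
      using zw eps unfolding e2 by algebra
    then show ?thesis by (simp only: z_def)
  qed
  obtain r where r: "r > 0" "ball p r \<subseteq> V" using openE[OF V(1,2)] .
  define J where "J = {p $ 1 - r<..<p $ 1 + r}"
  have line: "vector [z, p $ 2] \<in> V" if "z \<in> J" for z
  proof -
    have "(vector [z, p $ 2] :: real^2) - p = (z - p $ 1) *\<^sub>R axis 1 1"
      by (simp add: vec_eq_iff forall_2 axis_def)
    then have "dist (vector [z, p $ 2]) p = \<bar>z - p $ 1\<bar>" by (simp add: dist_norm)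
    then show ?thesis using r(2) that by (auto simp: J_def dist_commute)
  qed
  have ex: "\<exists>P :: real poly. \<forall>z\<in>J. F (vector [z, p $ 2]) = poly P z"
    if F: "smooth_on V F" "\<And>q. q \<in> V \<Longrightarrow> partial 1 (partial 1 (partial 1 F)) q = 0" for F
  proof -
    obtain P :: "real poly" where "\<And>z. z \<in> {p $ 1 - r<..<p $ 1 + r} \<Longrightarrow> F (vector [z, p $ 2]) = poly P z"
      by (rule polynomial_on_line[OF F, of "p $ 1 - r" "p $ 1 + r" "p $ 2"]) (use line in \<open>auto simp: J_def\<close>)
    then show ?thesis unfolding J_def by blast
  qed
  obtain P1 where P1: "\<And>z. z \<in> J \<Longrightarrow> e1 (vector [z, p $ 2]) = poly P1 z" using ex[OF sm(1) ezzz] by blast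
  obtain P2 where P2: "\<And>z. z \<in> J \<Longrightarrow> m (vector [z, p $ 2]) = poly P2 z" using ex[OF sms(1) mzzz] by blast
  obtain P3 where P3: "\<And>z. z \<in> J \<Longrightarrow> ey (vector [z, p $ 2]) = poly P3 z"
    using ex[OF sms(3)[unfolded ey_def] partial_zzz_commute[OF V(1) sm(1) ezzz], folded ey_def] by blast
  obtain P4 where P4: "\<And>z. z \<in> J \<Longrightarrow> my (vector [z, p $ 2]) = poly P4 z"
    using ex[OF sms(2)[unfolded my_def] partial_zzz_commute[OF V(1) sms(1) mzzz], folded my_def] by blast
  obtain P5 where P5: "\<And>z. z \<in> J \<Longrightarrow> Q (vector [z, p $ 2]) = poly P5 z" using ex[OF sms(4) Qzzz] by blast
  note Qyzzz = partial_zzz_commute[OF V(1) sms(4) Qzzz]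
  obtain P6 where P6: "\<And>z. z \<in> J \<Longrightarrow> Qy' (vector [z, p $ 2]) = poly P6 z"
    using ex[OF sms(5) Qyzzz, folded Qy'_def] by blast
  obtain P7 where P7: "\<And>z. z \<in> J \<Longrightarrow> Qyy' (vector [z, p $ 2]) = poly P7 z"
    using ex[OF smooth_on_partial[OF sms(5)] partial_zzz_commute[OF V(1) sms(5) Qyzzz], folded Qyy'_def] by blast
  define P where "P = [:15 / 2:] + [:0, 0, 1:] * ([:0, 0, 0, 0, 1:] * (P7 + P4 * P5 + 2 * P2 * P6 + P2 * P2 * P5)
    + [:0, 3 * \<epsilon>:] * (P3 + P2 * P1) - [:0, 0, 3 / 2 * \<epsilon>:] * (P4 + P2 * P2) - [:3 * \<epsilon>:] * P5)"
  have "poly P z = 0" if z: "z \<in> J" for z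
    using main[OF line[OF z]] unfolding P1[OF z] P2[OF z] P3[OF z] P4[OF z] P5[OF z] P6[OF z] P7[OF z]
    by (simp add: P_def power2_eq_square power4_eq_xxxx algebra_simps)
  then have "J \<subseteq> {z. poly P z = 0}" by blast
  moreover have "infinite J" unfolding J_def by (rule infinite_Ioo) (use r in simp)
  ultimately have "infinite {z. poly P z = 0}" using finite_subset by blast
  then have "P = 0" using poly_roots_finite by blast
  \<comment> \<open>The polynomial identity extends to \<open>z = 0\<close>, which lies outside
    \<open>V\<close>; all terms other than 15/2 carry a factor \<open>z\<^sup>2\<close>.\<close>
  then have "poly P 0 = 0" by simp
  then show False by (simp add: P_def)
qed

text \<open>The second moment \<open>T\<close> does not depend on \<open>z\<close>, satisfies
  \<open>T\<^sub>y = - (e1)\<^sub>z T\<close> and vanishes nowhere, whence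
  \<open>(e1)\<^sub>z\<^sub>z = 0\<close>. This is the first relation of the inconsistent system;
  the other three are symmetric combinations of the slope equations alone.\<close>

lemma three_slopes_not_hexagonal:
  assumes S: "slope_on \<epsilon> V S1" "slope_on \<epsilon> V S2" "slope_on \<epsilon> V S3" and p: "p \<in> V" and eps: "\<epsilon> * \<epsilon> = 1"
    and ne: "\<And>q. q \<in> V \<Longrightarrow> S1 q \<noteq> S2 q" "\<And>q. q \<in> V \<Longrightarrow> S1 q \<noteq> S3 q"
    and u: "smooth_on V u1" "smooth_on V u2" "smooth_on V u3"
    and sum: "\<And>q. q \<in> V \<Longrightarrow> u1 q + u2 q + u3 q = 0"
    and eq: "\<And>q. q \<in> V \<Longrightarrow> partial 2 u1 q = - S1 q * partial 1 u1 q"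
      "\<And>q. q \<in> V \<Longrightarrow> partial 2 u2 q = - S2 q * partial 1 u2 q"
      "\<And>q. q \<in> V \<Longrightarrow> partial 2 u3 q = - S3 q * partial 1 u3 q"
    and nz: "\<And>q. q \<in> V \<Longrightarrow> partial 1 u1 q \<noteq> 0"
  shows False
proof -
  define f1 where "f1 = partial 1 u1"
  define f2 where "f2 = partial 1 u2"
  define f3 where "f3 = partial 1 u3"
  note V = slope_onD(1)[OF S(1)]
  note smS = slope_onD(3)[OF S(1)] slope_onD(3)[OF S(2)] slope_onD(3)[OF S(3)]
  have smf: "smooth_on V f1" "smooth_on V f2" "smooth_on V f3"
    unfolding f1_def f2_def f3_def by (intro smooth_on_partial u)+
  have h: "has_partials F (partial 1 F q) (partial 2 F q) q" if "smooth_on V F" "q \<in> V" for F q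
    by (rule smooth_on_has_partials[OF that])
  note Sy = slope_onD(4)[OF S(1)] slope_onD(4)[OF S(2)] slope_onD(4)[OF S(3)]
  have fy: "partial 2 f1 q = - S1 q * partial 1 f1 q - partial 1 S1 q * f1 q"
    "partial 2 f2 q = - S2 q * partial 1 f2 q - partial 1 S2 q * f2 q"
    "partial 2 f3 q = - S3 q * partial 1 f3 q - partial 1 S3 q * f3 q" if "q \<in> V" for q
  proof -
    show "partial 2 f1 q = - S1 q * partial 1 f1 q - partial 1 S1 q * f1 q"
      unfolding f1_def by (rule first_integral_conservation[OF S(1) u(1) eq(1) that])
    show "partial 2 f2 q = - S2 q * partial 1 f2 q - partial 1 S2 q * f2 q"
      unfolding f2_def by (rule first_integral_conservation[OF S(2) u(2) eq(2) that])
    show "partial 2 f3 q = - S3 q * partial 1 f3 q - partial 1 S3 q * f3 q"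
      unfolding f3_def by (rule first_integral_conservation[OF S(3) u(3) eq(3) that])
  qed
  have T0: "f1 q + f2 q + f3 q = 0" if q: "q \<in> V" for q
  proof -
    have "partial 1 (\<lambda>q. u1 q + u2 q + u3 q) q = f1 q + f2 q + f3 q"
      unfolding f1_def f2_def f3_def
      by (rule trans[OF partial_eq(1)], (rule h[OF u(1) q] h[OF u(2) q] h[OF u(3) q] has_partials_intros)+) simp
    then show ?thesis using partial_const_on[OF V q sum, where i = 1] by simp
  qed
  have T1: "S1 q * f1 q + S2 q * f2 q + S3 q * f3 q = 0" if q: "q \<in> V" for q
  proof -
    have "partial 2 (\<lambda>q. u1 q + u2 q + u3 q) q = - (S1 q * f1 q + S2 q * f2 q + S3 q * f3 q)"
      by (rule trans[OF partial_eq(2)], (rule h[OF u(1) q] h[OF u(2) q] h[OF u(3) q] has_partials_intros)+)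
        (simp add: eq q f1_def f2_def f3_def)
    then show ?thesis using partial_const_on[OF V q sum, where i = 2] by simp
  qed
  define T where "T = (\<lambda>q. S1 q * S1 q * f1 q + S2 q * S2 q * f2 q + S3 q * S3 q * f3 q)"
  define e1 where "e1 = (\<lambda>q. S1 q + S2 q + S3 q)"
  define e2 where "e2 = (\<lambda>q. S1 q * S2 q + S1 q * S3 q + S2 q * S3 q)"
  define e3 where "e3 = (\<lambda>q. S1 q * S2 q * S3 q)"
  have sm: "smooth_on V T" "smooth_on V e1" "smooth_on V e2" "smooth_on V e3"
    unfolding T_def e1_def e2_def e3_def by (intro smooth_on_intros V smS smf)+
  have Tnz: "T q \<noteq> 0" if q: "q \<in> V" for q
  proof -
    \<comment> \<open>The vanishing moments of orders 0 and 1 eliminate \<open>f2\<close> and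
      \<open>f3\<close>.\<close>
    have "T q = f1 q * (S1 q - S2 q) * (S1 q - S3 q)"
      using T0[OF q] T1[OF q] unfolding T_def by algebra
    then show ?thesis using ne[OF q] nz[OF q] by (simp add: f1_def)
  qed
  have dT: "partial 1 T q = 2 * S1 q * partial 1 S1 q * f1 q + S1 q * S1 q * partial 1 f1 q
      + 2 * S2 q * partial 1 S2 q * f2 q + S2 q * S2 q * partial 1 f2 q
      + 2 * S3 q * partial 1 S3 q * f3 q + S3 q * S3 q * partial 1 f3 q"
    and dTy: "partial 2 T q = 2 * S1 q * partial 2 S1 q * f1 q + S1 q * S1 q * partial 2 f1 q
      + 2 * S2 q * partial 2 S2 q * f2 q + S2 q * S2 q * partial 2 f2 q
      + 2 * S3 q * partial 2 S3 q * f3 q + S3 q * S3 q * partial 2 f3 q" if q: "q \<in> V" for q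
    unfolding T_def
    by (rule trans[OF partial_eq(1)] trans[OF partial_eq(2)],
        (rule h[OF smS(1) q] h[OF smS(2) q] h[OF smS(3) q] h[OF smf(1) q] h[OF smf(2) q] h[OF smf(3) q] has_partials_intros)+,
        simp add: algebra_simps)+
  have Tz: "partial 1 T q = 0" if q: "q \<in> V" for q
  proof -
    have "partial 2 (\<lambda>q. S1 q * f1 q + S2 q * f2 q + S3 q * f3 q) q =
        S1 q * partial 2 f1 q + partial 2 S1 q * f1 q + (S2 q * partial 2 f2 q + partial 2 S2 q * f2 q)
        + (S3 q * partial 2 f3 q + partial 2 S3 q * f3 q)"
      by (rule trans[OF partial_eq(2)], (rule h[OF smS(1) q] h[OF smS(2) q] h[OF smS(3) q] h[OF smf(1) q] h[OF smf(2) q] h[OF smf(3) q] has_partials_intros)+)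
        (rule refl)
    then have "S1 q * partial 2 f1 q + partial 2 S1 q * f1 q + (S2 q * partial 2 f2 q + partial 2 S2 q * f2 q)
        + (S3 q * partial 2 f3 q + partial 2 S3 q * f3 q) = 0"
      using partial_const_on[OF V q T1, where i = 2] by simp
    \<comment> \<open>The source of the slope equation enters multiplied by the zeroth moment, which
      vanishes.\<close>
    then show ?thesis using T0[OF q] unfolding dT[OF q] fy[OF q] Sy[OF q] by algebra
  qed
  \<comment> \<open>Newton's relation between the moments of orders 0 to 3; the terms with
    \<open>e2\<close> and \<open>e3\<close> carry the vanishing moments.\<close>
  have eT: "S1 q * S1 q * S1 q * f1 q + S2 q * S2 q * S2 q * f2 q + S3 q * S3 q * S3 q * f3 q = e1 q * T q" if q: "q \<in> V" for q
    using T0[OF q] T1[OF q] unfolding T_def e1_def by algebra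
  have Ty: "partial 2 T q = - (partial 1 e1 q * T q)" if q: "q \<in> V" for q
  proof -
    have "partial 1 (\<lambda>q. S1 q * S1 q * S1 q * f1 q + S2 q * S2 q * S2 q * f2 q + S3 q * S3 q * S3 q * f3 q) q
      = 3 * S1 q * S1 q * partial 1 S1 q * f1 q + S1 q * S1 q * S1 q * partial 1 f1 q
      + (3 * S2 q * S2 q * partial 1 S2 q * f2 q + S2 q * S2 q * S2 q * partial 1 f2 q)
      + (3 * S3 q * S3 q * partial 1 S3 q * f3 q + S3 q * S3 q * S3 q * partial 1 f3 q)"
      by (rule trans[OF partial_eq(1)], (rule h[OF smS(1) q] h[OF smS(2) q] h[OF smS(3) q] h[OF smf(1) q] h[OF smf(2) q] h[OF smf(3) q] has_partials_intros)+)
        (simp add: algebra_simps)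
    moreover have "partial 1 (\<lambda>q. S1 q * S1 q * S1 q * f1 q + S2 q * S2 q * S2 q * f2 q + S3 q * S3 q * S3 q * f3 q) q
      = partial 1 (\<lambda>q. e1 q * T q) q"
      by (rule partial_cong[OF smooth_on_mult[OF V sm(2,1)] V q]) (simp add: eT)
    moreover have "partial 1 (\<lambda>q. e1 q * T q) q = partial 1 e1 q * T q"
      by (rule trans[OF partial_eq(1)], (rule h[OF sm(1) q] h[OF sm(2) q] has_partials_intros)+) (simp add: Tz[OF q])
    \<comment> \<open>Here the source enters multiplied by the first moment.\<close>
    ultimately show ?thesis using T1[OF q] unfolding dTy[OF q] fy[OF q] Sy[OF q] by algebra
  qed
  have zz: "partial 1 (partial 1 e1) q = 0" if q: "q \<in> V" for q
  proof -
    have "partial 1 (partial 2 T) q = partial 2 (partial 1 T) q" by (rule partial_commute[OF V sm(1) q])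
    also have "\<dots> = 0" by (rule partial_const_on[OF V q Tz])
    finally have "partial 1 (partial 2 T) q = 0" .
    moreover have "partial 1 (partial 2 T) q = partial 1 (\<lambda>q. - (partial 1 e1 q * T q)) q"
      by (rule partial_cong[OF _ V q]) (use Ty in \<open>auto intro!: smooth_on_intros V sm smooth_on_partial\<close>)
    moreover have "partial 1 (\<lambda>q. - (partial 1 e1 q * T q)) q = - (partial 1 (partial 1 e1) q * T q)"
      by (rule trans[OF partial_eq(1)], (rule h[OF sm(1) q] h[OF smooth_on_partial[OF sm(2)] q] has_partials_intros)+) (simp add: Tz[OF q])
    ultimately show ?thesis using Tnz[OF q] by simp
  qed
  have de1: "partial 1 e1 q = partial 1 S1 q + partial 1 S2 q + partial 1 S3 q"
    "partial 2 e1 q = partial 2 S1 q + partial 2 S2 q + partial 2 S3 q"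
    and de2: "partial 1 e2 q = partial 1 S1 q * (S2 q + S3 q) + partial 1 S2 q * (S1 q + S3 q) + partial 1 S3 q * (S1 q + S2 q)"
    "partial 2 e2 q = partial 2 S1 q * (S2 q + S3 q) + partial 2 S2 q * (S1 q + S3 q) + partial 2 S3 q * (S1 q + S2 q)"
    and de3: "partial 1 e3 q = partial 1 S1 q * S2 q * S3 q + S1 q * partial 1 S2 q * S3 q + S1 q * S2 q * partial 1 S3 q"
    "partial 2 e3 q = partial 2 S1 q * S2 q * S3 q + S1 q * partial 2 S2 q * S3 q + S1 q * S2 q * partial 2 S3 q" if q: "q \<in> V" for q
    unfolding e1_def e2_def e3_def
    by (rule trans[OF partial_eq(1)] trans[OF partial_eq(2)],
        (rule h[OF smS(1) q] h[OF smS(2) q] h[OF smS(3) q] has_partials_intros)+, simp add: algebra_simps)+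
  show False
  proof (rule symmetric_system_inconsistent[OF V p _ eps sm(2,3,4) zz])
    show "\<forall>q\<in>V. q $ 1 \<noteq> 0" using slope_onD(2)[OF S(1)] by blast
    fix q assume q: "q \<in> V"
    show "partial 1 e2 q = e1 q * partial 1 e1 q + partial 2 e1 q + 3 * \<epsilon> * inverse (q $ 1) ^ 3"
      unfolding de1[OF q] de2[OF q] Sy[OF q] unfolding e1_def by algebra
    show "partial 1 e3 q = partial 2 e2 q + 2 * \<epsilon> * e1 q * inverse (q $ 1) ^ 3 + partial 1 e1 q * e2 q"
      unfolding de1[OF q] de2[OF q] de3[OF q] Sy[OF q] unfolding e1_def e2_def by algebra
    show "partial 2 e3 q = - e3 q * partial 1 e1 q - \<epsilon> * e2 q * inverse (q $ 1) ^ 3"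
      unfolding de1[OF q] de3[OF q] Sy[OF q] unfolding e2_def e3_def by algebra
  qed
qed

section \<open>Two finite slopes beside the special foliation: the common plane\<close>

text \<open>The first integral \<open>u0\<close> of the lines \<open>y = const\<close> is free of
  \<open>z\<close>, and so is \<open>m = (S - R) f = (u0)\<^sub>y\<close>. The conservation laws
  give \<open>m\<^sub>y = - (S + R)\<^sub>z m\<close>, as the sources cancel in the difference of
  the slope equations. Since \<open>m\<close> is nonzero and free of \<open>z\<close>, so is
  \<open>(S + R)\<^sub>z\<close>.\<close>

lemma two_slopes_hexagonal_sum:
  assumes S: "slope_on \<epsilon> V S" "slope_on \<epsilon> V R" and p: "p \<in> V"
    and ne: "\<And>q. q \<in> V \<Longrightarrow> S q \<noteq> R q"
    and u: "smooth_on V u0" "smooth_on V u1" "smooth_on V u2"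
    and sum: "\<And>q. q \<in> V \<Longrightarrow> u0 q + u1 q + u2 q = 0"
    and eq: "\<And>q. q \<in> V \<Longrightarrow> partial 1 u0 q = 0"
      "\<And>q. q \<in> V \<Longrightarrow> partial 2 u1 q = - S q * partial 1 u1 q"
      "\<And>q. q \<in> V \<Longrightarrow> partial 2 u2 q = - R q * partial 1 u2 q"
    and nz: "\<And>q. q \<in> V \<Longrightarrow> partial 1 u1 q \<noteq> 0"
  shows "partial 1 (partial 1 (\<lambda>q. S q + R q)) p = 0"
proof -
  define f where "f = partial 1 u1"
  note V = slope_onD(1)[OF S(1)]
  note smS = slope_onD(3)[OF S(1)] slope_onD(3)[OF S(2)]
  have smf: "smooth_on V f" unfolding f_def by (intro smooth_on_partial u)
  have h: "has_partials F (partial 1 F q) (partial 2 F q) q" if "smooth_on V F" "q \<in> V" for F q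
    by (rule smooth_on_has_partials[OF that])
  note Sy = slope_onD(4)[OF S(1)] slope_onD(4)[OF S(2)]
  have sums: "partial 1 u2 q = - f q" "partial 2 u0 q = (S q - R q) * f q" if q: "q \<in> V" for q
  proof -
    have "partial 1 (\<lambda>q. u0 q + u1 q + u2 q) q = f q + partial 1 u2 q"
      by (rule trans[OF partial_eq(1)], (rule h[OF u(1) q] h[OF u(2) q] h[OF u(3) q] has_partials_intros)+)
        (simp add: eq q f_def)
    then show 1: "partial 1 u2 q = - f q" using partial_const_on[OF V q sum, where i = 1] by simp
    have "partial 2 (\<lambda>q. u0 q + u1 q + u2 q) q = partial 2 u0 q - S q * f q + R q * f q"
      by (rule trans[OF partial_eq(2)], (rule h[OF u(1) q] h[OF u(2) q] h[OF u(3) q] has_partials_intros)+)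
        (simp add: eq q f_def 1[unfolded f_def])
    then show "partial 2 u0 q = (S q - R q) * f q"
      using partial_const_on[OF V q sum, where i = 2] by (simp add: algebra_simps)
  qed
  have fy1: "partial 2 f q = - S q * partial 1 f q - partial 1 S q * f q" if "q \<in> V" for q
    unfolding f_def by (rule first_integral_conservation[OF S(1) u(2) eq(2) that])
  have fy2: "partial 2 f q = - R q * partial 1 f q - partial 1 R q * f q" if q: "q \<in> V" for q
  proof -
    have c: "partial i (partial 1 u2) q = - partial i f q" for i
    proof -
      have "partial i (partial 1 u2) q = partial i (\<lambda>q. - f q) q"
        by (rule partial_cong[OF smooth_on_uminus[OF V smf] V q]) (simp add: sums)
      also have "\<dots> = - partial i f q"
        using partial_eq[OF has_partials_uminus[OF h[OF smf q]]] exhaust_2[of i] by auto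
      finally show ?thesis .
    qed
    show ?thesis using first_integral_conservation[OF S(2) u(3) eq(3) q] unfolding c sums(1)[OF q] by simp
  qed
  define m where "m = (\<lambda>q. (S q - R q) * f q)"
  define e1 where "e1 = (\<lambda>q. S q + R q)"
  have sm: "smooth_on V m" "smooth_on V e1" unfolding m_def e1_def by (intro smooth_on_intros V smS smf)+
  have mz: "partial 1 m q = 0" if q: "q \<in> V" for q
  proof -
    have "partial 1 m q = partial 1 (partial 2 u0) q"
      by (rule partial_cong[OF smooth_on_partial[OF u(1)] V q]) (simp add: sums m_def)
    also have "\<dots> = partial 2 (partial 1 u0) q" by (rule partial_commute[OF V u(1) q])
    also have "\<dots> = 0" by (rule partial_const_on[OF V q eq(1)])
    finally show ?thesis .
  qed
  have my: "partial 2 m q = - (partial 1 e1 q * m q)" if q: "q \<in> V" for q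
  proof -
    have 1: "partial 2 m q = (S q - R q) * partial 2 f q + (partial 2 S q - partial 2 R q) * f q"
      and 2: "partial 1 m q = (S q - R q) * partial 1 f q + (partial 1 S q - partial 1 R q) * f q"
      and 3: "partial 1 e1 q = partial 1 S q + partial 1 R q"
      unfolding m_def e1_def
      by (rule trans[OF partial_eq(1)] trans[OF partial_eq(2)],
          (rule h[OF smS(1) q] h[OF smS(2) q] h[OF smf q] has_partials_intros)+, rule refl)+
    show ?thesis
      using fy1[OF q] fy2[OF q] mz[OF q] unfolding 1 2 3 Sy[OF q] unfolding m_def by algebra
  qed
  have "partial 1 (partial 2 m) p = partial 2 (partial 1 m) p" by (rule partial_commute[OF V sm(1) p])
  also have "\<dots> = 0" by (rule partial_const_on[OF V p mz])
  finally have "partial 1 (partial 2 m) p = 0" .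
  moreover have "partial 1 (partial 2 m) p = partial 1 (\<lambda>q. - (partial 1 e1 q * m q)) p"
    by (rule partial_cong[OF _ V p]) (use my in \<open>auto intro!: smooth_on_intros V sm smooth_on_partial\<close>)
  moreover have "partial 1 (\<lambda>q. - (partial 1 e1 q * m q)) p = - (partial 1 (partial 1 e1) p * m p)"
    by (rule trans[OF partial_eq(1)], (rule h[OF sm(1) p] h[OF smooth_on_partial[OF sm(2)] p] has_partials_intros)+) (simp add: mz[OF p])
  moreover have "m p \<noteq> 0" using ne[OF p] nz[OF p] by (simp add: m_def f_def)
  ultimately show ?thesis by (simp add: e1_def)
qed

lemma span_const_on_interval:
  fixes F :: "real \<Rightarrow> real^'n"
  assumes "\<And>s. s \<in> {0..1} \<Longrightarrow> F s \<noteq> 0"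
    "\<And>s. s \<in> {0..1} \<Longrightarrow> \<exists>\<kappa>. \<forall>i. ((\<lambda>s. F s $ i) has_real_derivative \<kappa> * F s $ i) (at s within {0..1})"
  shows "span {F 0} = span {F 1}"
proof (rule connected_local_const[where A = "{0..1}" and f = "\<lambda>s. span {F s}"])
  show "\<forall>a\<in>{0..1}. \<forall>\<^sub>F b in at a within {0..1}. span {F a} = span {F b}"
  proof
    fix a :: real assume a: "a \<in> {0..1}"
    have "\<exists>e>0. \<forall>s\<in>{0..1} \<inter> ball a e. span {F s} = span {F a}"
      by (rule span_locally_const[where F = F and T = "{0..1}" and d = 1]) (use a assms in auto)
    then obtain e where e: "e > 0" "\<And>s. s \<in> {0..1} \<inter> ball a e \<Longrightarrow> span {F s} = span {F a}" by blast
    then show "\<forall>\<^sub>F b in at a within {0..1}. span {F a} = span {F b}"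
      unfolding eventually_at by (intro exI[of _ e]) (auto simp: dist_commute)
  qed
qed auto

text \<open>Along every short segment all components satisfy one linear equation, so the spanned
  line is locally constant, hence constant on the connected \<open>U\<close>.\<close>

lemma span_const_on_connected:
  fixes N :: "real^2 \<Rightarrow> real^'n"
  assumes U: "open U" "connected U" "p \<in> U" "q \<in> U" and nz: "\<And>q. q \<in> U \<Longrightarrow> N q \<noteq> 0"
    and d: "\<And>q i. q \<in> U \<Longrightarrow> has_partials (\<lambda>q. N q $ i) (a q * N q $ i) (b q * N q $ i) q"
  shows "span {N p} = span {N q}"
proof (rule connected_local_const[where A = U and f = "\<lambda>q. span {N q}", OF U(2,3,4)])
  show "\<forall>p\<in>U. \<forall>\<^sub>F q in at p within U. span {N p} = span {N q}"
  proof
    fix p assume "p \<in> U"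
    then obtain r where r: "r > 0" "ball p r \<subseteq> U" using openE[OF U(1)] by blast
    have "span {N p} = span {N q}" if q: "dist q p < r" for q
    proof -
      define c where "c t = p + t *\<^sub>R (q - p)" for t :: real
      have cU: "c t \<in> U" if "t \<in> {0..1}" for t
      proof -
        have "dist (c t) p = \<bar>t\<bar> * dist q p" by (simp add: c_def dist_norm)
        also have "\<dots> \<le> 1 * dist q p" using that by (intro mult_right_mono) auto
        also have "\<dots> < r" using q by simp
        finally show ?thesis using r(2) by (auto simp: dist_commute)
      qed
      have dc: "(c has_vector_derivative q - p) (at t within {0..1})" for t
        unfolding c_def[abs_def] by (auto intro!: derivative_eq_intros)
      have "span {N (c 0)} = span {N (c 1)}"
      proof (rule span_const_on_interval)
        show "N (c s) \<noteq> 0" if "s \<in> {0..1}" for s by (rule nz[OF cU[OF that]])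
        fix s :: real assume s: "s \<in> {0..1}"
        have "((\<lambda>s. N (c s) $ i) has_real_derivative
            (a (c s) * (q - p) $ 1 + b (c s) * (q - p) $ 2) * N (c s) $ i) (at s within {0..1})" for i
          by (rule DERIV_cong[OF has_partials_curve[OF d[OF cU[OF s]] dc]]) (simp add: algebra_simps)
        then show "\<exists>\<kappa>. \<forall>i. ((\<lambda>s. N (c s) $ i) has_real_derivative \<kappa> * N (c s) $ i) (at s within {0..1})" by blast
      qed
      then show ?thesis by (simp add: c_def)
    qed
    then show "\<forall>\<^sub>F q in at p within U. span {N p} = span {N q}"
      unfolding eventually_at using r(1) by blast
  qed
qed

text \<open>With \<open>\<rho>(y) = n\<^sub>3 y\<^sup>2 - n\<^sub>2 y + n\<^sub>1\<close> the right
  side is \<open>\<rho> (s\<^sup>2 - \<epsilon> / z\<^sup>2) - \<rho>' z s + \<rho>'' z\<^sup>2 / 2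
  - n\<^sub>4\<close>: a plane section of the quadric is a quadratic equation for the slope.\<close>

lemma inner_dual_vector_slope:
  "n \<bullet> dual_vector \<epsilon> q (vector [s, 1]) =
    (n $ 3 * (q $ 2)\<^sup>2 - n $ 2 * q $ 2 + n $ 1) * (s\<^sup>2 - \<epsilon> * (inverse (q $ 1))\<^sup>2)
    - (2 * n $ 3 * q $ 2 - n $ 2) * q $ 1 * s + n $ 3 * (q $ 1)\<^sup>2 - n $ 4"
  unfolding inner_vec_def sum_4 dual_vector_nth
  by (simp add: inverse_eq_divide power2_eq_square algebra_simps)

text \<open>The sum of two slopes with \<open>(S + R)\<^sub>z\<^sub>z = 0\<close> has the form \<open>\<mu>(y) z\<close> with \<open>\<mu>'' + 3 \<mu> \<mu>' + \<mu>\<^sup>3 = 0\<close>, an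
  equation linearized by \<open>\<mu> = \<rho>' / \<rho>\<close>, where it says that \<open>\<rho>\<close> is a quadratic polynomial. The vector \<open>N\<close> below
  consists of the coefficients of the plane, with \<open>\<rho>\<close> normalized to be \<open>1\<close> at the current point.\<close>

lemma two_slopes_common_plane:
  assumes S: "slope_on \<epsilon> U S" "slope_on \<epsilon> U R" and U: "connected U" "U \<noteq> {}" and eps: "\<epsilon> * \<epsilon> = 1"
    and zz: "\<And>q. q \<in> U \<Longrightarrow> partial 1 (partial 1 (\<lambda>q. S q + R q)) q = 0"
  shows "\<exists>n :: real^4. (n $ 1 \<noteq> 0 \<or> n $ 2 \<noteq> 0 \<or> n $ 3 \<noteq> 0) \<and>
    (\<forall>q\<in>U. n \<bullet> dual_vector \<epsilon> q (vector [S q, 1]) = 0 \<and> n \<bullet> dual_vector \<epsilon> q (vector [R q, 1]) = 0)"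
proof -
  note V = slope_onD(1)[OF S(1)]
  note smS = slope_onD(3)[OF S(1)] slope_onD(3)[OF S(2)]
  have h: "has_partials F (partial 1 F q) (partial 2 F q) q" if "smooth_on U F" "q \<in> U" for F q
    by (rule smooth_on_has_partials[OF that])
  note Sy = slope_onD(4)[OF S(1)] slope_onD(4)[OF S(2)]
  define w where "w = (\<lambda>q :: real^2. inverse (q $ 1))"
  have smw: "smooth_on U w" unfolding w_def by (rule smooth_on_inverse_coord[OF V]) (use slope_onD(2)[OF S(1)] in blast)
  have hw: "has_partials w (- (w q)\<^sup>2) 0 q" if "q \<in> U" for q
    unfolding w_def using has_partials_inverse_coord slope_onD(2)[OF S(1)] that by blast
  have zw: "q $ 1 * w q = 1" if "q \<in> U" for q using slope_onD(2)[OF S(1) that] by (simp add: w_def)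
  define e1 where "e1 = (\<lambda>q. S q + R q)"
  define e2 where "e2 = (\<lambda>q. S q * R q)"
  define m where "m = partial 1 e1"
  define ey where "ey = partial 2 e1"
  define my where "my = partial 2 m"
  define myy where "myy = partial 2 my"
  define eyy where "eyy = partial 2 ey"
  have sm: "smooth_on U e1" "smooth_on U e2" unfolding e1_def e2_def by (intro smooth_on_intros V smS)+
  have sms: "smooth_on U m" "smooth_on U ey" "smooth_on U my" "smooth_on U myy" "smooth_on U eyy"
    unfolding m_def ey_def my_def myy_def eyy_def by (intro smooth_on_partial sm)+
  have mz: "partial 1 m q = 0" if "q \<in> U" for q unfolding m_def e1_def by (rule zz[OF that])
  have myz: "partial 1 my q = 0" if q: "q \<in> U" for q
  proof -
    have "partial 1 my q = partial 2 (partial 1 m) q" unfolding my_def by (rule partial_commute[OF V sms(1) q])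
    also have "\<dots> = 0" by (rule partial_const_on[OF V q mz])
    finally show ?thesis .
  qed
  have myyz: "partial 1 myy q = 0" if q: "q \<in> U" for q
  proof -
    have "partial 1 myy q = partial 2 (partial 1 my) q" unfolding myy_def by (rule partial_commute[OF V sms(3) q])
    also have "\<dots> = 0" by (rule partial_const_on[OF V q myz])
    finally show ?thesis .
  qed
  have eyz: "partial 1 ey q = my q" if q: "q \<in> U" for q
    unfolding ey_def my_def m_def by (rule partial_commute[OF V sm(1) q])
  have eyyz: "partial 1 eyy q = myy q" if q: "q \<in> U" for q
  proof -
    have "partial 1 eyy q = partial 2 (partial 1 ey) q" unfolding eyy_def by (rule partial_commute[OF V sms(2) q])
    also have "\<dots> = partial 2 my q" by (rule partial_cong[OF sms(3) V q]) (simp add: eyz)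
    finally show ?thesis by (simp add: myy_def)
  qed
  have d1: "partial 1 e1 q = partial 1 S q + partial 1 R q" "partial 2 e1 q = partial 2 S q + partial 2 R q"
    "partial 1 e2 q = S q * partial 1 R q + partial 1 S q * R q" "partial 2 e2 q = S q * partial 2 R q + partial 2 S q * R q"
    if q: "q \<in> U" for q
    unfolding e1_def e2_def
    by (rule trans[OF partial_eq(1)] trans[OF partial_eq(2)],
        (rule h[OF smS(1) q] h[OF smS(2) q] has_partials_intros)+, rule refl)+
  have A: "partial 1 e2 q = e1 q * m q + ey q + 2 * \<epsilon> * w q ^ 3" if q: "q \<in> U" for q
    unfolding m_def ey_def d1[OF q] Sy[OF q] unfolding e1_def w_def by algebra
  have B: "partial 2 e2 q = - e2 q * m q - \<epsilon> * e1 q * w q ^ 3" if q: "q \<in> U" for q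
    unfolding m_def d1[OF q] Sy[OF q] unfolding e1_def e2_def w_def by algebra
  \<comment> \<open>Equality of the mixed derivatives of the product \<open>e2\<close> of the two
    slopes.\<close>
  have compat: "e1 q * my q + ey q * m q + eyy q
      = - (m q * (e1 q * m q + ey q + 2 * \<epsilon> * w q ^ 3)) - \<epsilon> * (m q * w q ^ 3 - 3 * e1 q * w q ^ 4)" if q: "q \<in> U" for q
  proof -
    have "partial 2 (partial 1 e2) q = partial 2 (\<lambda>q. e1 q * m q + ey q + 2 * \<epsilon> * w q ^ 3) q"
      by (rule partial_cong[OF _ V q]) (use A in \<open>auto intro!: smooth_on_intros V sm sms smw\<close>)
    also have "\<dots> = e1 q * my q + ey q * m q + eyy q"
      by (rule trans[OF partial_eq(2)], (rule hw[OF q] h[OF sm(1) q] h[OF sms(1) q] h[OF sms(2) q] has_partials_intros)+)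
        (simp add: ey_def my_def eyy_def)
    finally have 1: "partial 2 (partial 1 e2) q = e1 q * my q + ey q * m q + eyy q" .
    have "partial 1 (partial 2 e2) q = partial 1 (\<lambda>q. - e2 q * m q - \<epsilon> * e1 q * w q ^ 3) q"
      by (rule partial_cong[OF _ V q]) (use B in \<open>auto intro!: smooth_on_intros V sm sms smw\<close>)
    also have "\<dots> = - (m q * (e1 q * m q + ey q + 2 * \<epsilon> * w q ^ 3)) - \<epsilon> * (m q * w q ^ 3 - 3 * e1 q * w q ^ 4)"
      by (rule trans[OF partial_eq(1)], (rule hw[OF q] h[OF sm(1) q] h[OF sm(2) q] h[OF sms(1) q] has_partials_intros)+)
        (simp add: mz[OF q] A[OF q] m_def[symmetric] algebra_simps power2_eq_square power3_eq_cube power4_eq_xxxx)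
    finally have 2: "partial 1 (partial 2 e2) q
      = - (m q * (e1 q * m q + ey q + 2 * \<epsilon> * w q ^ 3)) - \<epsilon> * (m q * w q ^ 3 - 3 * e1 q * w q ^ 4)" .
    show ?thesis using 1 2 partial_commute[OF V sm(2) q, of 1 2] by simp
  qed
  \<comment> \<open>The constant term of \<open>e1 = m z + \<nu>\<close>, affine in
    \<open>z\<close>. Compatibility becomes \<open>L = 3 \<epsilon> \<nu> / z\<^sup>4\<close>; the
    left side is affine in \<open>z\<close>, while the second \<open>z\<close>-derivative of the
    right side is \<open>60 \<epsilon> \<nu> / z\<^sup>6\<close>, so \<open>\<nu>\<close>
    vanishes.\<close>
  define \<nu> where "\<nu> = (\<lambda>q. e1 q - q $ 1 * m q)"
  define L where "L = (\<lambda>q. eyy q + 2 * m q * ey q + e1 q * my q + e1 q * m q * m q)"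
  define M where "M = (\<lambda>q. myy q + 3 * m q * my q + m q * m q * m q)"
  have sm\<nu>: "smooth_on U \<nu>" unfolding \<nu>_def by (intro smooth_on_intros V sm sms)
  have \<nu>z: "partial 1 \<nu> q = 0" if q: "q \<in> U" for q
    unfolding \<nu>_def
    by (rule trans[OF partial_eq(1)], (rule h[OF sm(1) q] h[OF sms(1) q] has_partials_intros)+) (simp add: mz[OF q] m_def[symmetric])
  have L: "L q = 3 * \<epsilon> * \<nu> q * w q ^ 4" if q: "q \<in> U" for q
  proof -
    have "L q = - 3 * \<epsilon> * m q * w q ^ 3 + 3 * \<epsilon> * e1 q * w q ^ 4"
      using compat[OF q] unfolding L_def by (simp add: algebra_simps)
    also have "w q ^ 3 = q $ 1 * w q * w q ^ 3" using zw[OF q] by simp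
    finally show ?thesis by (simp add: \<nu>_def algebra_simps power3_eq_cube power4_eq_xxxx)
  qed
  have Lz: "partial 1 L q = M q" if q: "q \<in> U" for q
    unfolding L_def
    by (rule trans[OF partial_eq(1)], (rule h[OF sm(1) q] h[OF sms(1) q] h[OF sms(2) q] h[OF sms(3) q] h[OF sms(5) q] has_partials_intros)+)
      (simp add: mz[OF q] myz[OF q] eyz[OF q] eyyz[OF q] m_def[symmetric] M_def algebra_simps)
  have M: "M q = - 12 * \<epsilon> * \<nu> q * w q ^ 5" if q: "q \<in> U" for q
  proof -
    have "partial 1 L q = partial 1 (\<lambda>q. 3 * \<epsilon> * \<nu> q * w q ^ 4) q"
      by (rule partial_cong[OF _ V q]) (use L in \<open>auto intro!: smooth_on_intros V sm\<nu> smw\<close>)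
    also have "\<dots> = - 12 * \<epsilon> * \<nu> q * w q ^ 5"
      by (rule trans[OF partial_eq(1)], (rule hw[OF q] h[OF sm\<nu> q] has_partials_intros)+)
        (simp add: \<nu>z[OF q] algebra_simps eval_nat_numeral)
    finally show ?thesis using Lz[OF q] by simp
  qed
  have Mz: "partial 1 M q = 0" if q: "q \<in> U" for q
    unfolding M_def
    by (rule trans[OF partial_eq(1)], (rule h[OF sms(1) q] h[OF sms(3) q] h[OF sms(4) q] has_partials_intros)+)
      (simp add: mz[OF q] myz[OF q] myyz[OF q])
  have \<nu>0: "\<nu> q = 0" if q: "q \<in> U" for q
  proof -
    have "partial 1 M q = partial 1 (\<lambda>q. - 12 * \<epsilon> * \<nu> q * w q ^ 5) q"
      by (rule partial_cong[OF _ V q]) (use M in \<open>auto intro!: smooth_on_intros V sm\<nu> smw\<close>)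
    also have "\<dots> = 60 * \<epsilon> * \<nu> q * w q ^ 6"
      by (rule trans[OF partial_eq(1)], (rule hw[OF q] h[OF sm\<nu> q] has_partials_intros)+)
        (simp add: \<nu>z[OF q] algebra_simps eval_nat_numeral)
    finally have "60 * \<epsilon> * \<nu> q * w q ^ 6 = 0" using Mz[OF q] by simp
    moreover have "w q \<noteq> 0" "\<epsilon> \<noteq> 0" using zw[OF q] eps by auto
    ultimately show ?thesis by simp
  qed
  have e1: "e1 q = q $ 1 * m q" if "q \<in> U" for q using \<nu>0[OF that] by (simp add: \<nu>_def)
  have M0: "myy q = - 3 * m q * my q - m q * m q * m q" if "q \<in> U" for q
    using M[OF that] \<nu>0[OF that] by (simp add: M_def)
  have ey: "ey q = q $ 1 * my q" if q: "q \<in> U" for q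
  proof -
    have "ey q = partial 2 (\<lambda>q. q $ 1 * m q) q"
      unfolding ey_def by (rule partial_cong[OF _ V q]) (use e1 in \<open>auto intro!: smooth_on_intros V sms\<close>)
    also have "\<dots> = q $ 1 * my q"
      by (rule trans[OF partial_eq(2)], (rule h[OF sms(1) q] has_partials_intros)+) (simp add: my_def)
    finally show ?thesis .
  qed
  \<comment> \<open>If \<open>m = \<rho>' / \<rho>\<close> then
    \<open>m\<^sub>y + m\<^sup>2 = \<rho>'' / \<rho>\<close>. With \<open>\<rho>\<close> scaled to 1
    at the current \<open>y\<close>, Taylor expansion gives the coefficients:
    \<open>\<alpha> = \<rho>'' / 2\<close>, \<open>N1 = \<rho>(0)\<close>,
    \<open>N2 = - \<rho>'(0)\<close>. \<open>N4\<close> is solved from the product \<open>e2\<close>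
    of the roots.\<close>
  define \<alpha> where "\<alpha> = (\<lambda>q. (my q + m q * m q) / 2)"
  define N1 where "N1 = (\<lambda>q. 1 - m q * q $ 2 + \<alpha> q * (q $ 2 * q $ 2))"
  define N2 where "N2 = (\<lambda>q. 2 * \<alpha> q * q $ 2 - m q)"
  define N4 where "N4 = (\<lambda>q. \<alpha> q * (q $ 1 * q $ 1) - \<epsilon> * (w q * w q) - e2 q)"
  define N :: "real^2 \<Rightarrow> real^4" where "N = (\<lambda>q. \<chi> i. if i = 1 then N1 q else if i = 2 then N2 q else if i = 3 then \<alpha> q else N4 q)"
  have N: "N q $ 1 = N1 q" "N q $ 2 = N2 q" "N q $ 3 = \<alpha> q" "N q $ 4 = N4 q" for q by (simp_all add: N_def)
  have hm: "has_partials m 0 (my q) q" and hmy: "has_partials my 0 (myy q) q" if q: "q \<in> U" for q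
    using h[OF sms(1) q] h[OF sms(3) q] by (simp_all add: mz[OF q] myz[OF q] my_def[symmetric] myy_def[symmetric])
  have h\<alpha>: "has_partials \<alpha> (0 * \<alpha> q) (- m q * \<alpha> q) q" if q: "q \<in> U" for q
  proof -
    have "has_partials (\<lambda>q. 1 / 2 * (my q + m q * m q)) (1 / 2 * (0 + (m q * 0 + 0 * m q)) + 0 * (my q + m q * m q))
      (1 / 2 * (myy q + (m q * my q + my q * m q)) + 0 * (my q + m q * m q)) q"
      by (intro has_partials_intros hm hmy q)
    then show ?thesis by (simp add: M0[OF q] \<alpha>_def algebra_simps add_divide_distrib)
  qed
  \<comment> \<open>The scaling divides a constant vector by \<open>\<rho>(y)\<close>, so each
    component should have \<open>y\<close>-derivative \<open>- m\<close> times itself.\<close>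
  have hN: "has_partials (\<lambda>q. N q $ i) (0 * N q $ i) (- m q * N q $ i) q" if q: "q \<in> U" for i q
  proof -
    have a2: "my q = 2 * \<alpha> q - m q * m q" by (simp add: \<alpha>_def field_simps)
    have p2: "partial 2 N1 q = - m q * N1 q" "partial 1 N1 q = 0" "partial 2 N2 q = - m q * N2 q" "partial 1 N2 q = 0"
      unfolding N1_def N2_def
      by (rule trans[OF partial_eq(1)] trans[OF partial_eq(2)], (rule h\<alpha>[OF q] hm[OF q] has_partials_intros)+,
          simp add: a2 algebra_simps)+
    have p4: "partial 1 N4 q = 0"
      unfolding N4_def
      by (rule trans[OF partial_eq(1)], (rule h\<alpha>[OF q] hw[OF q] h[OF sm(2) q] has_partials_intros)+)
        (simp add: A[OF q] e1[OF q] ey[OF q] a2 algebra_simps power2_eq_square power3_eq_cube)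
    have p4': "partial 2 N4 q = - m q * N4 q"
      unfolding N4_def
      by (rule trans[OF partial_eq(2)], (rule h\<alpha>[OF q] hw[OF q] h[OF sm(2) q] has_partials_intros)+)
        (use zw[OF q] in \<open>simp add: B[OF q] e1[OF q] algebra_simps power3_eq_cube\<close>)
    have sm\<alpha>: "smooth_on U \<alpha>" unfolding \<alpha>_def by (intro smooth_on_intros V sms) auto
    have "smooth_on U N1" "smooth_on U N2" "smooth_on U N4"
      unfolding N1_def N2_def N4_def by (intro smooth_on_intros V sms sm smw sm\<alpha>)+
    from h[OF this(1) q] h[OF this(2) q] h[OF this(3) q] h\<alpha>[OF q] show ?thesis
      unfolding p2 p4 p4' using exhaust_4[of i] by (auto simp: N)
  qed
  have norm: "N q $ 3 * (q $ 2)\<^sup>2 - N q $ 2 * q $ 2 + N q $ 1 = 1" for q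
    by (simp add: N N1_def N2_def power2_eq_square algebra_simps)
  have slope: "2 * N q $ 3 * q $ 2 - N q $ 2 = m q" for q by (simp add: N N2_def)
  have N0: "N q \<noteq> 0" for q
  proof
    assume "N q = 0"
    then show False using norm[of q] by simp
  qed
  have on: "N q \<bullet> dual_vector \<epsilon> q (vector [S q, 1]) = 0 \<and> N q \<bullet> dual_vector \<epsilon> q (vector [R q, 1]) = 0" if q: "q \<in> U" for q
  proof -
    have e: "m q * q $ 1 = S q + R q" using e1[OF q] by (simp add: e1_def mult.commute)
    show ?thesis
      unfolding inner_dual_vector_slope norm slope e
      by (simp add: N N4_def e2_def w_def power2_eq_square algebra_simps)
  qed
  obtain p where p: "p \<in> U" using U by blast
  have "N p \<bullet> dual_vector \<epsilon> q (vector [S q, 1]) = 0 \<and> N p \<bullet> dual_vector \<epsilon> q (vector [R q, 1]) = 0" if q: "q \<in> U" for q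
  proof -
    have "span {N p} = span {N q}"
      by (rule span_const_on_connected[where U = U and a = "\<lambda>q. 0" and b = "\<lambda>q. - m q"]) (use V U p q N0 hN in auto)
    then obtain k where "N p = k *\<^sub>R N q" using span_singleton_eqD[OF _ N0] by metis
    then show ?thesis using on[OF q] by simp
  qed
  moreover have "N p $ 1 \<noteq> 0 \<or> N p $ 2 \<noteq> 0 \<or> N p $ 3 \<noteq> 0" using norm[of p] by auto
  ultimately show ?thesis by blast
qed

section \<open>First integrals of two foliations with a common plane\<close>

lemma real_antiderivative:
  fixes f :: "real \<Rightarrow> real"
  assumes "continuous_on {a..b} f"
  obtains F where "\<And>x. x \<in> {a<..<b} \<Longrightarrow> (F has_real_derivative f x) (at x)"
proof -
  obtain F where F: "\<And>x. x \<in> {a..b} \<Longrightarrow> (F has_vector_derivative f x) (at x within {a..b})"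
    using antiderivative_continuous[OF assms] by blast
  have "(F has_real_derivative f x) (at x)" if "x \<in> {a<..<b}" for x
    using F[of x] that at_within_Icc_at[of a x b] by (simp add: has_real_derivative_iff_has_vector_derivative)
  then show ?thesis using that by blast
qed

text \<open>Here \<open>\<rho>\<close> is the quadratic polynomial of the plane, and in terms of \<open>v = z\<^sup>2 / \<rho>\<close> the form
  \<open>(dz - S dy) / (\<rho> (S - R))\<close> becomes \<open>\<plusminus>dv / (4 sqrt (\<kappa> v\<^sup>2 + n\<^sub>4 v + \<epsilon>)) - dy / (2 \<rho>)\<close>, hence is closed.\<close>

lemma common_plane_first_integrals:
  fixes n :: "real^4"
  assumes U: "open U" "\<forall>q\<in>U. q $ 1 \<noteq> 0" and p: "p \<in> U"
    and sm: "smooth_on U S" "smooth_on U R" and ne: "\<And>q. q \<in> U \<Longrightarrow> S q \<noteq> R q"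
    and n0: "n $ 1 \<noteq> 0 \<or> n $ 2 \<noteq> 0 \<or> n $ 3 \<noteq> 0"
    and n: "\<And>q. q \<in> U \<Longrightarrow> n \<bullet> dual_vector \<epsilon> q (vector [S q, 1]) = 0"
      "\<And>q. q \<in> U \<Longrightarrow> n \<bullet> dual_vector \<epsilon> q (vector [R q, 1]) = 0"
  shows "\<exists>V f r u0 u1 u2. open V \<and> p \<in> V \<and> V \<subseteq> U \<and> smooth_on V u0 \<and> smooth_on V u1 \<and> smooth_on V u2 \<and>
    (\<forall>q\<in>V. u0 q + u1 q + u2 q = 0 \<and> f q \<noteq> 0 \<and> r q \<noteq> 0 \<and> has_partials u0 0 (r q) q \<and>
      has_partials u1 (f q) (- S q * f q) q \<and> has_partials u2 (- f q) (R q * f q) q)"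
proof -
  define \<rho> where "\<rho> y = n $ 3 * y\<^sup>2 - n $ 2 * y + n $ 1" for y
  define \<rho>' where "\<rho>' y = 2 * n $ 3 * y - n $ 2" for y
  have quad: "\<rho> (q $ 2) * ((S q)\<^sup>2 - \<epsilon> * (inverse (q $ 1))\<^sup>2) - \<rho>' (q $ 2) * q $ 1 * S q + n $ 3 * (q $ 1)\<^sup>2 - n $ 4 = 0"
    "\<rho> (q $ 2) * ((R q)\<^sup>2 - \<epsilon> * (inverse (q $ 1))\<^sup>2) - \<rho>' (q $ 2) * q $ 1 * R q + n $ 3 * (q $ 1)\<^sup>2 - n $ 4 = 0"
    if "q \<in> U" for q
    using n[OF that] unfolding inner_dual_vector_slope \<rho>_def \<rho>'_def by auto
  \<comment> \<open>At a zero of \<open>\<rho>\<close> the quadratic equation becomes linear but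
    still has two distinct roots, so its coefficients vanish.\<close>
  have deg: "\<rho>' (q $ 2) = 0 \<and> n $ 3 * (q $ 1)\<^sup>2 = n $ 4" if q: "q \<in> U" and z: "\<rho> (q $ 2) = 0" for q
  proof -
    have "\<rho>' (q $ 2) * q $ 1 * (S q - R q) = 0" using quad[OF q] z by (simp add: algebra_simps)
    then have "\<rho>' (q $ 2) = 0" using ne[OF q] U(2) q by simp
    then show ?thesis using quad(1)[OF q] z by simp
  qed
  have \<rho>0: "\<rho> (q $ 2) \<noteq> 0" if q: "q \<in> U" for q
  proof
    assume z: "\<rho> (q $ 2) = 0"
    obtain r where r: "r > 0" "ball q r \<subseteq> U" using openE[OF U(1) q] .
    have q1: "q $ 1 \<noteq> 0" using U(2) q by blast
    \<comment> \<open>A shift in \<open>z\<close> keeps \<open>\<rho> = 0\<close>. The bound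
      \<open>d \<le> \<bar>q $ 1\<bar>\<close> ensures that \<open>z\<^sup>2\<close> really changes,
      so that \<open>n $ 3 * z\<^sup>2 = n $ 4\<close> at both points forces
      \<open>n $ 3 = 0\<close>.\<close>
    define d where "d = min (r / 2) \<bar>q $ 1\<bar>"
    have d: "0 < d" "d < r" "d \<le> \<bar>q $ 1\<bar>" using r q1 by (auto simp: d_def)
    define q' where "q' = q + d *\<^sub>R axis 1 1"
    have "dist q' q = d" using d by (simp add: q'_def dist_norm)
    then have "q' \<in> U" using r d by (auto simp: dist_commute)
    moreover have "q' $ 1 = q $ 1 + d" "q' $ 2 = q $ 2" by (simp_all add: q'_def axis_def)
    ultimately have "n $ 3 * (q $ 1 + d)\<^sup>2 = n $ 4" using deg[of q'] z by simp
    moreover have "n $ 3 * (q $ 1)\<^sup>2 = n $ 4" using deg[OF q z] by blast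
    ultimately have "n $ 3 * (d * (2 * q $ 1 + d)) = 0" by (simp add: power2_eq_square algebra_simps)
    moreover have "2 * q $ 1 + d \<noteq> 0" using d q1 by auto
    ultimately have "n $ 3 = 0" using d by simp
    moreover from this have "n $ 2 = 0" using deg[OF q z] by (simp add: \<rho>'_def)
    ultimately show False using n0 z by (simp add: \<rho>_def)
  qed
  \<comment> \<open>A quarter of the discriminant of \<open>\<rho>\<close>. It equals
    \<open>(\<rho>'\<^sup>2 - 2 \<rho> \<rho>'') / 4\<close> at every \<open>y\<close>, which is why
    \<open>disc\<close> depends on the point only through \<open>v\<close>.\<close>
  define \<kappa> where "\<kappa> = (n $ 2)\<^sup>2 / 4 - n $ 1 * n $ 3"
  define P where "P v = \<kappa> * v\<^sup>2 + n $ 4 * v + \<epsilon>" for v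
  define v where "v = (\<lambda>q :: real^2. q $ 1 * q $ 1 / \<rho> (q $ 2))"
  define s where "s = (\<lambda>q. q $ 1 * (S q - R q))"
  have sum: "\<rho> (q $ 2) * (S q + R q) = \<rho>' (q $ 2) * q $ 1" if q: "q \<in> U" for q
  proof -
    have "(S q - R q) * (\<rho> (q $ 2) * (S q + R q) - \<rho>' (q $ 2) * q $ 1) = 0"
      using quad[OF q] by (simp add: power2_eq_square algebra_simps)
    then show ?thesis using ne[OF q] by simp
  qed
  have disc: "(s q)\<^sup>2 = 4 * P (v q)" if q: "q \<in> U" for q
  proof -
    define z w a b where "z = q $ 1" and "w = inverse (q $ 1)" and "a = \<rho> (q $ 2)" and "b = \<rho>' (q $ 2)"
    have zw: "z * w = 1" using U(2) q by (simp add: z_def w_def)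
    have a0: "a \<noteq> 0" using \<rho>0[OF q] by (simp add: a_def)
    have ab: "b\<^sup>2 = 4 * \<kappa> + 4 * n $ 3 * a" by (simp add: a_def b_def \<rho>_def \<rho>'_def \<kappa>_def power2_eq_square algebra_simps)
    have "a * (S q + R q) = b * z" using sum[OF q] by (simp add: a_def b_def z_def)
    moreover have "a * ((S q)\<^sup>2 - \<epsilon> * w\<^sup>2) - b * z * S q + n $ 3 * z\<^sup>2 - n $ 4 = 0"
      using quad(1)[OF q] by (simp add: a_def b_def z_def w_def)
    ultimately have "a\<^sup>2 * (z * (S q - R q))\<^sup>2 = 4 * (\<kappa> * z ^ 4 + n $ 4 * a * z\<^sup>2 + \<epsilon> * a\<^sup>2)"
      using ab zw by algebra
    then have "(z * (S q - R q))\<^sup>2 = 4 * (\<kappa> * z ^ 4 + n $ 4 * a * z\<^sup>2 + \<epsilon> * a\<^sup>2) / a\<^sup>2"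
      using a0 by (simp add: field_simps)
    also have "\<dots> = 4 * P (z * z / a)"
      using a0 by (simp add: P_def field_simps power2_eq_square power4_eq_xxxx)
    finally show ?thesis by (simp add: s_def v_def z_def a_def)
  qed
  have s0: "s q \<noteq> 0" if "q \<in> U" for q using U(2) ne[OF that] that by (simp add: s_def)
  have Pp: "P (v p) > 0" using disc[OF p] s0[OF p] by (metis mult_pos_pos zero_less_mult_pos zero_less_numeral zero_less_power2)
  have sm\<rho>: "smooth_on U (\<lambda>q. \<rho> (q $ 2))" unfolding \<rho>_def by (intro smooth_on_intros U(1))
  have smv: "smooth_on U v" unfolding v_def using \<rho>0 by (intro smooth_on_intros U(1) sm\<rho>)
  have sms: "smooth_on U s" unfolding s_def by (intro smooth_on_intros U(1) sm)
  have nbhd: "\<exists>a b. a < x \<and> x < b \<and> (\<forall>y\<in>{a..b}. y \<in> T)" if T: "open T" "x \<in> T" for x :: real and T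
  proof -
    obtain r where r: "r > 0" "ball x r \<subseteq> T" using openE[OF T] .
    then show ?thesis by (intro exI[of _ "x - r / 2"] exI[of _ "x + r / 2"]) (auto simp: dist_real_def subset_iff)
  qed
  have "open {x. 0 < P x}" unfolding P_def by (intro open_Collect_less continuous_intros)
  then obtain a b where ab: "a < v p" "v p < b" "\<And>x. x \<in> {a..b} \<Longrightarrow> 0 < P x" using nbhd[of "{x. 0 < P x}" "v p"] Pp by auto
  have "continuous_on {a..b} (\<lambda>x. 1 / (4 * sqrt (P x)))"
    using ab(3) unfolding P_def by (intro continuous_intros) (auto simp: less_imp_neq[symmetric])
  then obtain F where F: "\<And>x. x \<in> {a<..<b} \<Longrightarrow> (F has_real_derivative 1 / (4 * sqrt (P x))) (at x)"
    using real_antiderivative by blast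
  have "open {y. \<rho> y \<noteq> 0}" unfolding \<rho>_def by (intro open_Collect_neq continuous_intros)
  then obtain c d where cd: "c < p $ 2" "p $ 2 < d" "\<And>y. y \<in> {c..d} \<Longrightarrow> \<rho> y \<noteq> 0" using nbhd[of "{y. \<rho> y \<noteq> 0}" "p $ 2"] \<rho>0[OF p] by auto
  have "continuous_on {c..d} (\<lambda>y. 1 / \<rho> y)" using cd(3) unfolding \<rho>_def by (intro continuous_intros) auto
  then obtain G where G: "\<And>y. y \<in> {c<..<d} \<Longrightarrow> (G has_real_derivative 1 / \<rho> y) (at y)"
    using real_antiderivative by blast
  \<comment> \<open>Small enough for both antiderivatives to apply and for \<open>s\<close> to keep
    the sign it has at \<open>p\<close>.\<close>
  define V where "V = U \<inter> v -` {a<..<b} \<inter> (U \<inter> (\<lambda>q. q $ 2) -` {c<..<d}) \<inter> (U \<inter> (\<lambda>q. s p * s q) -` {0<..})"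
  have "open V"
    unfolding V_def
    by (intro open_Int continuous_open_preimage U(1) smooth_on_continuous_on smv smooth_on_intros sms) auto
  have VU: "V \<subseteq> U" by (auto simp: V_def)
  have "p \<in> V" using p ab cd s0[OF p] by (auto simp: V_def zero_less_mult_iff linorder_neq_iff)
  define \<sigma> where "\<sigma> = sgn (s p)"
  have \<sigma>\<sigma>: "\<sigma> * \<sigma> = 1" using s0[OF p] by (simp add: \<sigma>_def sgn_if)
  \<comment> \<open>The integrating factor: \<open>du1 = f (dz - S dy)\<close>,
    \<open>du2 = - f (dz - R dy)\<close> and \<open>du0 = (S - R) f dy\<close>. Splitting
    \<open>u0\<close> into halves makes the sum zero by definition.\<close>
  define f where "f = (\<lambda>q. 1 / (\<rho> (q $ 2) * (S q - R q)))"
  define u0 where "u0 = (\<lambda>q :: real^2. G (q $ 2))"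
  define u1 where "u1 = (\<lambda>q. \<sigma> * F (v q) - 1 / 2 * u0 q)"
  define u2 where "u2 = (\<lambda>q. - (\<sigma> * F (v q)) - 1 / 2 * u0 q)"
  have part: "has_partials u0 0 (1 / \<rho> (q $ 2)) q \<and> has_partials u1 (f q) (- S q * f q) q \<and> has_partials u2 (- f q) (R q * f q) q"
    if q: "q \<in> V" for q
  proof -
    have qU: "q \<in> U" using q VU by blast
    have z: "q $ 1 \<noteq> 0" using U(2) qU by blast
    have \<rho>q: "\<rho> (q $ 2) \<noteq> 0" by (rule \<rho>0[OF qU])
    have SR: "S q - R q \<noteq> 0" using ne[OF qU] by simp
    have hu0: "has_partials u0 0 (1 / \<rho> (q $ 2)) q"
      unfolding u0_def using has_partials_compose[OF has_partials_coord2 G[of "q $ 2"]] q by (simp add: V_def)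
    have h\<rho>: "has_partials (\<lambda>q. \<rho> (q $ 2)) 0 (\<rho>' (q $ 2)) q"
    proof -
      have "(\<rho> has_real_derivative \<rho>' (q $ 2)) (at (q $ 2))"
        unfolding \<rho>_def[abs_def] \<rho>'_def by (auto intro!: derivative_eq_intros)
      from has_partials_compose[OF has_partials_coord2 this] show ?thesis by simp
    qed
    have hv: "has_partials v (2 * q $ 1 / \<rho> (q $ 2)) (- (q $ 1)\<^sup>2 * \<rho>' (q $ 2) / (\<rho> (q $ 2))\<^sup>2) q"
    proof -
      have "has_partials v (((q $ 1 * 1 + 1 * q $ 1) * \<rho> (q $ 2) - q $ 1 * q $ 1 * 0) / (\<rho> (q $ 2))\<^sup>2)
        (((q $ 1 * 0 + 0 * q $ 1) * \<rho> (q $ 2) - q $ 1 * q $ 1 * \<rho>' (q $ 2)) / (\<rho> (q $ 2))\<^sup>2) q"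
        unfolding v_def by (intro has_partials_intros h\<rho> \<rho>q)
      then show ?thesis using \<rho>q by (simp add: power2_eq_square)
    qed
    have sp: "s p * s q > 0" using q by (simp add: V_def)
    have "sqrt (P (v q)) = \<bar>s q\<bar> / 2"
    proof (rule real_sqrt_unique)
      show "(\<bar>s q\<bar> / 2)\<^sup>2 = P (v q)" using disc[OF qU] by (simp add: power_divide)
    qed simp
    also have "\<bar>s q\<bar> = \<sigma> * s q" using sp by (auto simp: \<sigma>_def sgn_if zero_less_mult_iff abs_if split: if_splits)
    finally have sq: "sqrt (P (v q)) = \<sigma> * s q / 2" .
    have "v q \<in> {a<..<b}" using q by (simp add: V_def)
    from has_partials_compose[OF hv F[OF this]]
    have hF: "has_partials (\<lambda>q. F (v q)) (1 / (4 * (\<sigma> * s q / 2)) * (2 * q $ 1 / \<rho> (q $ 2)))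
      (1 / (4 * (\<sigma> * s q / 2)) * (- (q $ 1)\<^sup>2 * \<rho>' (q $ 2) / (\<rho> (q $ 2))\<^sup>2)) q"
      unfolding sq .
    have "\<sigma> \<noteq> 0" using \<sigma>\<sigma> by auto
    have \<sigma>1: "\<sigma> * (1 / (4 * (\<sigma> * s q / 2)) * x) = x / (2 * s q)" for x
      using \<open>\<sigma> \<noteq> 0\<close> s0[OF qU] by (simp add: field_simps)
    have Fz: "2 * q $ 1 / \<rho> (q $ 2) / (2 * s q) = f q"
      using z \<rho>q SR by (simp add: f_def s_def field_simps)
    have Fy: "- (q $ 1)\<^sup>2 * \<rho>' (q $ 2) / (\<rho> (q $ 2))\<^sup>2 / (2 * s q) = - (S q + R q) * f q / 2"
    proof -
      have "- (q $ 1)\<^sup>2 * \<rho>' (q $ 2) / (\<rho> (q $ 2))\<^sup>2 / (2 * s q) = - q $ 1 * (\<rho> (q $ 2) * (S q + R q)) / (\<rho> (q $ 2))\<^sup>2 / (2 * s q)"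
        unfolding sum[OF qU] by (simp add: power2_eq_square)
      also have "\<dots> = - (S q + R q) * f q / 2"
        using z \<rho>q SR by (simp add: f_def s_def divide_simps power2_eq_square) (simp add: algebra_simps)
      finally show ?thesis .
    qed
    have r: "1 / \<rho> (q $ 2) = (S q - R q) * f q" using SR by (simp add: f_def)
    have hsF: "has_partials (\<lambda>q. \<sigma> * F (v q)) (f q) (- (S q + R q) * f q / 2) q"
      using has_partials_mult[OF has_partials_const[of \<sigma>] hF] unfolding \<sigma>1 Fz Fy by simp
    have hu: "has_partials (\<lambda>q. 1 / 2 * u0 q) 0 ((S q - R q) * f q / 2) q"
      using has_partials_mult[OF has_partials_const[of "1 / 2"] hu0] unfolding r by simp
    have "has_partials u1 (f q) (- S q * f q) q"
      using has_partials_diff[OF hsF hu] unfolding u1_def by (simp add: field_simps)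
    moreover have "has_partials u2 (- f q) (R q * f q) q"
      using has_partials_diff[OF has_partials_uminus[OF hsF] hu] unfolding u2_def by (simp add: field_simps)
    ultimately show ?thesis using hu0 by blast
  qed
  have smV: "smooth_on V S" "smooth_on V R" "smooth_on V (\<lambda>q. \<rho> (q $ 2))"
    using sm sm\<rho> smooth_on_subset[OF _ VU] by blast+
  have smf: "smooth_on V f"
    unfolding f_def using \<rho>0 ne VU by (intro smooth_on_intros \<open>open V\<close> smV) auto
  have "smooth_on V (\<lambda>q. 1 / \<rho> (q $ 2))" using \<rho>0 VU by (intro smooth_on_intros \<open>open V\<close> smV) auto
  then have smu0: "smooth_on V u0"
    by (intro smooth_on_from_partials[OF \<open>open V\<close>, of u0 "\<lambda>q. 0"] smooth_on_const) (use part in auto)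
  have smu1: "smooth_on V u1"
    by (rule smooth_on_from_partials[OF \<open>open V\<close>, of u1 f "\<lambda>q. - S q * f q"])
      (use part in \<open>auto intro!: smooth_on_intros \<open>open V\<close> smV smf\<close>)
  have smu2: "smooth_on V u2"
    by (rule smooth_on_from_partials[OF \<open>open V\<close>, of u2 "\<lambda>q. - f q" "\<lambda>q. R q * f q"])
      (use part in \<open>auto intro!: smooth_on_intros \<open>open V\<close> smV smf\<close>)
  have sum0: "u0 q + u1 q + u2 q = 0" for q by (simp add: u1_def u2_def)
  have nz: "f q \<noteq> 0" "1 / \<rho> (q $ 2) \<noteq> 0" if "q \<in> V" for q
    using \<rho>0[of q] ne[of q] VU that by (auto simp: f_def)
  have "\<forall>q\<in>V. u0 q + u1 q + u2 q = 0 \<and> f q \<noteq> 0 \<and> 1 / \<rho> (q $ 2) \<noteq> 0 \<and> has_partials u0 0 (1 / \<rho> (q $ 2)) q \<and>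
      has_partials u1 (f q) (- S q * f q) q \<and> has_partials u2 (- f q) (R q * f q) q"
    using sum0 nz part by blast
  with \<open>open V\<close> \<open>p \<in> V\<close> VU smu0 smu1 smu2 show ?thesis
    by (intro exI[of _ V] exI[of _ f] exI[of _ "\<lambda>q. 1 / \<rho> (q $ 2)"] exI[of _ u0] exI[of _ u1] exI[of _ u2] conjI)
qed

section \<open>Hexagonal geodesic webs\<close>

text \<open>The value \<open>dz/dy\<close>, well determined as soon as the line at \<open>p\<close>
  is not tangent to \<open>y = const\<close>; it is used only in that case.\<close>

definition slope :: "(real^2 \<Rightarrow> (real^2) set) \<Rightarrow> real^2 \<Rightarrow> real" where
  "slope L p = (SOME s. vector [s, 1] \<in> L p)"

lemma slope_eq:
  assumes L: "L q = span {X}" and X: "X $ 2 \<noteq> 0"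
  shows "slope L q = X $ 1 / X $ 2" "L q = span {vector [slope L q, 1]}"
proof -
  have Xs: "X = X $ 2 *\<^sub>R vector [X $ 1 / X $ 2, 1]" using X by (simp add: vec_eq_iff forall_2)
  have L': "L q = span {vector [X $ 1 / X $ 2, 1]}"
    using span_singleton_scale[OF X, of "vector [X $ 1 / X $ 2, 1] :: real^2"] by (simp only: L Xs[symmetric])
  then have "vector [X $ 1 / X $ 2, 1] \<in> L q" by (auto intro: span_base)
  then have "vector [slope L q, 1] \<in> L q" unfolding slope_def by (rule someI)
  then obtain k where k: "vector [slope L q, 1] = k *\<^sub>R (vector [X $ 1 / X $ 2, 1] :: real^2)"
    unfolding L' by (auto simp: span_singleton)
  from arg_cong[OF k, of "\<lambda>v. v $ 2"] have "k = 1" by simp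
  with arg_cong[OF k, of "\<lambda>v. v $ 1"] show "slope L q = X $ 1 / X $ 2" by simp
  then show "L q = span {vector [slope L q, 1]}" using L' by simp
qed

text \<open>\<open>axis 1 1\<close> is tangent to the lines \<open>y = const\<close>, so
  \<open>axis 1 1 \<in> L p\<close> is how being special at \<open>p\<close> is expressed from here
  on.\<close>

lemma axis_in_span_iff:
  fixes X :: "real^2"
  assumes "X \<noteq> 0"
  shows "axis 1 1 \<in> span {X} \<longleftrightarrow> X $ 2 = 0"
proof
  assume "axis 1 1 \<in> span {X}"
  then obtain k where k: "axis 1 1 = k *\<^sub>R X" by (auto simp: span_singleton)
  have "k \<noteq> 0" using k by (auto simp: axis_eq_0_iff)
  moreover have "k * X $ 2 = 0" using arg_cong[OF k, of "\<lambda>v. v $ 2"] by (simp add: axis_def)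
  ultimately show "X $ 2 = 0" by simp
next
  assume "X $ 2 = 0"
  then have "X $ 1 \<noteq> 0" using assms by (simp add: vec2_nonzero)
  then have "axis 1 1 = (1 / X $ 1) *\<^sub>R X" using \<open>X $ 2 = 0\<close> by (simp add: vec_eq_iff forall_2 axis_def)
  then show "axis 1 1 \<in> span {X}" by (simp add: span_mul span_base)
qed

lemma foliation_line_special:
  assumes fol: "geodesic_foliation \<epsilon> U L" and p: "p \<in> U" and ax: "axis 1 1 \<in> L p"
  shows "L p = span {axis 1 1}"
proof -
  obtain X where X: "X \<noteq> 0" "L p = span {X}" by (rule dual_point_nonzero_rep[OF fol p])
  obtain k where k: "axis 1 1 = k *\<^sub>R X" using ax unfolding X(2) by (auto simp: span_singleton)
  then have "k \<noteq> 0" by (auto simp: axis_eq_0_iff)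
  then show ?thesis unfolding X(2) k by (rule span_singleton_scale[symmetric])
qed

lemma foliation_line_slope:
  assumes fol: "geodesic_foliation \<epsilon> U L" and p: "p \<in> U" and ax: "axis 1 1 \<notin> L p"
  shows "L p = span {vector [slope L p, 1]}"
proof -
  obtain X where X: "X \<noteq> 0" "L p = span {X}" by (rule dual_point_nonzero_rep[OF fol p])
  have "X $ 2 \<noteq> 0" using ax axis_in_span_iff[OF X(1)] unfolding X(2) by blast
  with slope_eq(2)[where L = L and q = p, OF X(2)] show ?thesis by blast
qed

lemma open_nonspecial:
  assumes fol: "geodesic_foliation \<epsilon> U L"
  shows "open {p \<in> U. axis 1 1 \<notin> L p}"
proof (rule openI)
  fix p assume "p \<in> {p \<in> U. axis 1 1 \<notin> L p}"
  then have p: "p \<in> U" "axis 1 1 \<notin> L p" by auto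
  obtain V X where V: "p \<in> V" "V \<subseteq> U" "geodesic_field \<epsilon> V L X" by (rule geodesic_foliation_field[OF fol p(1)])
  note X = geodesic_fieldD[OF V(3)]
  have iff: "axis 1 1 \<in> L q \<longleftrightarrow> X q $ 2 = 0" if "q \<in> V" for q
    unfolding X(6)[OF that] by (rule axis_in_span_iff[OF X(5)[OF that]])
  have "open (V \<inter> (\<lambda>q. X q $ 2) -` (- {0}))"
    by (rule continuous_open_preimage[OF smooth_on_continuous_on[OF X(3)] X(1)]) (simp add: open_Compl)
  moreover have "p \<in> V \<inter> (\<lambda>q. X q $ 2) -` (- {0})" using p(2) iff[OF V(1)] V(1) by simp
  ultimately obtain r where r: "r > 0" "ball p r \<subseteq> V \<inter> (\<lambda>q. X q $ 2) -` (- {0})" by (rule openE)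
  have "ball p r \<subseteq> {p \<in> U. axis 1 1 \<notin> L p}"
  proof
    fix q assume "q \<in> ball p r"
    then have "q \<in> V" "X q $ 2 \<noteq> 0" using r(2) by auto
    then show "q \<in> {p \<in> U. axis 1 1 \<notin> L p}" using iff[of q] V(2) by auto
  qed
  with r(1) show "\<exists>e>0. ball p e \<subseteq> {p \<in> U. axis 1 1 \<notin> L p}" by blast
qed

text \<open>The chosen slope agrees locally with \<open>X $ 1 / X $ 2\<close>, hence is smooth, and
  the quotient rule turns the homogeneous geodesic equation for \<open>X\<close> into the slope
  equation.\<close>

lemma slope_on_foliation:
  assumes fol: "geodesic_foliation \<epsilon> U L" and V: "open V" "V \<subseteq> U" and ax: "\<And>p. p \<in> V \<Longrightarrow> axis 1 1 \<notin> L p"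
  shows "slope_on \<epsilon> V (slope L)"
proof -
  have loc: "\<exists>T. open T \<and> p \<in> T \<and> p $ 1 \<noteq> 0 \<and> smooth_on T (slope L) \<and>
      partial 2 (slope L) p = - slope L p * partial 1 (slope L) p - \<epsilon> * inverse (p $ 1) ^ 3" if p: "p \<in> V" for p
  proof -
    have pU: "p \<in> U" using p V by blast
    obtain V' X where V': "p \<in> V'" "V' \<subseteq> U" "geodesic_field \<epsilon> V' L X" by (rule geodesic_foliation_field[OF fol pU])
    note X = geodesic_fieldD[OF V'(3)]
    define T where "T = V \<inter> V'"
    have T: "open T" "p \<in> T" "T \<subseteq> V'" "T \<subseteq> V" using V X(1) p V' by (auto simp: T_def)
    have X2: "X q $ 2 \<noteq> 0" if "q \<in> T" for q
    proof -
      have q: "q \<in> V'" "q \<in> V" using that T by auto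
      show ?thesis using ax[OF q(2)] axis_in_span_iff[OF X(5)[OF q(1)]] unfolding X(6)[OF q(1)] by blast
    qed
    have sl: "slope L q = X q $ 1 / X q $ 2" if q: "q \<in> T" for q
    proof -
      have "L q = span {X q}" using X(6)[of q] q T(3) by blast
      from slope_eq(1)[where L = L and q = q, OF this X2[OF q]] show ?thesis .
    qed
    have smX: "smooth_on T (\<lambda>q. X q $ k)" for k by (rule smooth_on_subset[OF X(3) T(3)])
    have smq: "smooth_on T (\<lambda>q. X q $ 1 / X q $ 2)" using X2 by (intro smooth_on_intros T(1) smX)
    have sm: "smooth_on T (slope L)"
      by (rule smooth_on_cong[OF T(1) _ smq]) (simp add: sl)
    define a where "a k i = partial i (\<lambda>q. X q $ k) p" for k i
    have hX: "has_partials (\<lambda>q. X q $ k) (a k 1) (a k 2) p" for k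
      unfolding a_def by (rule smooth_on_has_partials[OF smX T(2)])
    have hS: "has_partials (slope L) ((a 1 1 * X p $ 2 - X p $ 1 * a 2 1) / (X p $ 2)\<^sup>2)
        ((a 1 2 * X p $ 2 - X p $ 1 * a 2 2) / (X p $ 2)\<^sup>2) p"
      by (rule has_partials_cong[OF has_partials_divide[OF hX[of 1] hX[of 2] X2[OF T(2)]] T(1,2)]) (simp add: sl)
    have E: "X p $ 1 * (a 2 1 * X p $ 1 + a 2 2 * X p $ 2) - X p $ 2 * (a 1 1 * X p $ 1 + a 1 2 * X p $ 2)
      = \<epsilon> * (X p $ 2) ^ 3 * inverse (p $ 1) ^ 3"
      using X(7)[OF V'(1)] by (simp add: field_deriv_def a_def divide_inverse power_inverse)
    define x1 x2 where "x1 = X p $ 1" and "x2 = X p $ 2"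
    have x2: "x2 \<noteq> 0" using X2[OF T(2)] by (simp add: x2_def)
    have "partial 2 (slope L) p + slope L p * partial 1 (slope L) p
      = (x2 * (a 1 1 * x1 + a 1 2 * x2) - x1 * (a 2 1 * x1 + a 2 2 * x2)) / x2 ^ 3"
      unfolding partial_eq[OF hS] sl[OF T(2)] x1_def[symmetric] x2_def[symmetric] using x2
      by (simp add: divide_simps power2_eq_square power3_eq_cube) (simp add: algebra_simps)
    also have "\<dots> = - (\<epsilon> * x2 ^ 3 * inverse (p $ 1) ^ 3) / x2 ^ 3"
      unfolding E[folded x1_def x2_def, symmetric] by simp
    also have "\<dots> = - \<epsilon> * inverse (p $ 1) ^ 3" using x2 by simp
    finally have "partial 2 (slope L) p = - slope L p * partial 1 (slope L) p - \<epsilon> * inverse (p $ 1) ^ 3" by simp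
    then show ?thesis using T(1,2) X(4)[OF V'(1)] sm by blast
  qed
  have "smooth_on V (slope L)" by (rule smooth_on_local) (use loc in blast)
  then show ?thesis unfolding slope_on_def using V(1) loc by blast
qed

section \<open>Functions constant on leaves\<close>

text \<open>Constancy on leaves says something about derivatives only along tangent paths of nonzero
  velocity. If the derivative of \<open>u\<close> along the foliation were nonzero at
  \<open>q\<close>, it would be so near \<open>q\<close>, where \<open>geodesic_foliation\<close>
  supplies a regular arc on which \<open>u\<close> is constant.\<close>

lemma constant_on_leaves_derivative:
  assumes fol: "geodesic_foliation \<epsilon> U L" and V: "open V" "V \<subseteq> U" and u: "smooth_on V u"
    and const: "\<And>q r. q \<in> V \<Longrightarrow> r \<in> leaf V L q \<Longrightarrow> u r = u q" and q: "q \<in> V" and L: "L q = span {Y}"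
  shows "partial 1 u q * Y $ 1 + partial 2 u q * Y $ 2 = 0"
proof -
  have qU: "q \<in> U" using q V by blast
  obtain V' X where V': "q \<in> V'" "V' \<subseteq> U" "geodesic_field \<epsilon> V' L X" by (rule geodesic_foliation_field[OF fol qU])
  note X = geodesic_fieldD[OF V'(3)]
  define T where "T = V \<inter> V'"
  have T: "open T" "q \<in> T" "T \<subseteq> V'" "T \<subseteq> V" using V X(1) q V' by (auto simp: T_def)
  define H where "H r = partial 1 u r * X r $ 1 + partial 2 u r * X r $ 2" for r
  have "smooth_on T H"
    unfolding H_def
    by (intro smooth_on_intros T(1) smooth_on_subset[OF X(3) T(3)] smooth_on_partial smooth_on_subset[OF u T(4)])
  then have opn: "open (T \<inter> H -` (- {0}))"
    by (intro continuous_open_preimage smooth_on_continuous_on T(1)) (auto simp: open_Compl)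
  have "H q = 0"
  proof (rule ccontr)
    assume "H q \<noteq> 0"
    then have qN: "q \<in> T \<inter> H -` (- {0})" using T(2) by simp
    obtain c \<alpha> \<beta> where c: "tangent_path U L q c" "0 \<le> \<alpha>" "\<alpha> < \<beta>" "\<beta> \<le> 1" "c ` {0..\<beta>} \<subseteq> T \<inter> H -` (- {0})"
      "\<forall>t\<in>{\<alpha>..\<beta>}. vector_derivative c (at t) \<noteq> 0"
      by (rule geodesic_foliation_path[OF fol qU opn qN])
    define t where "t = (\<alpha> + \<beta>) / 2"
    have t: "t \<in> {\<alpha>..\<beta>}" "t \<in> {0<..<\<beta>}" "t \<in> {0..1}" "t \<in> {0..\<beta>}" using c by (auto simp: t_def)
    have cT: "c s \<in> T" "H (c s) \<noteq> 0" if "s \<in> {0..\<beta>}" for s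
    proof -
      have "c s \<in> T \<inter> H -` (- {0})" using c(5) that by blast
      then show "c s \<in> T" "H (c s) \<noteq> 0" by auto
    qed
    have uc: "u (c s) = u q" if s: "s \<in> {0..\<beta>}" for s
    proof (rule const[OF q], rule tangent_path_in_leaf[OF c(1)])
      show "c ` {0..s} \<subseteq> V" using cT(1) T(4) s by fastforce
      show "0 \<le> s" "s \<le> 1" using s c(4) by auto
      show "subspace (L r)" if "r \<in> V" for r using geodesic_foliation_subspace[OF fol] V(2) that by blast
    qed
    have ctV: "c t \<in> V" "c t \<in> V'" using cT(1)[OF t(4)] T by auto
    have "vector_derivative c (at t) \<in> span {X (c t)}" using tangent_pathD(3)[OF c(1) t(3)] X(6)[OF ctV(2)] by simp
    then obtain r where r: "vector_derivative c (at t) = r *\<^sub>R X (c t)" by (auto simp: span_singleton)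
    have r0: "r \<noteq> 0" using c(6) t(1) r by auto
    have "((\<lambda>s. u (c s)) has_real_derivative r * H (c t)) (at t)"
      by (rule DERIV_cong[OF has_partials_curve[OF smooth_on_has_partials[OF u ctV(1)] tangent_pathD(1)[OF c(1) t(3)]]])
        (simp add: r H_def algebra_simps)
    moreover have "((\<lambda>s. u (c s)) has_real_derivative 0) (at t)"
      by (rule has_field_derivative_transform_within_open[OF DERIV_const[of "u q"] _ t(2)]) (use uc in auto)
    ultimately have "r * H (c t) = 0" by (rule DERIV_unique)
    then show False using r0 cT(2)[OF t(4)] by simp
  qed
  moreover have "Y \<in> span {X q}" using L X(6)[OF V'(1)] span_base[of Y "{Y}"] by simp
  then obtain k where "Y = k *\<^sub>R X q" by (auto simp: span_singleton)
  moreover have "partial 1 u q * (k * X q $ 1) + partial 2 u q * (k * X q $ 2) = k * H q" for k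
    by (simp add: H_def algebra_simps)
  ultimately show ?thesis by simp
qed

lemma constant_on_leaf:
  assumes u: "\<And>q. q \<in> V \<Longrightarrow> has_partials u (a q) (b q) q" and L: "\<And>q. q \<in> V \<Longrightarrow> L q = span {X q}"
    and zero: "\<And>q. q \<in> V \<Longrightarrow> a q * X q $ 1 + b q * X q $ 2 = 0" and r: "r \<in> leaf V L q"
  shows "u r = u q"
proof -
  obtain c where c: "tangent_path V L q c" "c 1 = r" using r unfolding leaf_altdef pathfinish_def by blast
  have "\<exists>k. \<forall>t\<in>{0..1}. u (c t) = k"
  proof (rule has_field_derivative_zero_constant[where f = "\<lambda>t. u (c t)" and s = "{0..1}"])
    fix t :: real assume t: "t \<in> {0..1}"
    have V: "c t \<in> V" by (rule tangent_pathD(2)[OF c(1) t])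
    have "vector_derivative c (at t) \<in> span {X (c t)}" using tangent_pathD(3)[OF c(1) t] L[OF V] by simp
    then obtain k where k: "vector_derivative c (at t) = k *\<^sub>R X (c t)" by (auto simp: span_singleton)
    have "a (c t) * (k * X (c t) $ 1) + b (c t) * (k * X (c t) $ 2) = k * (a (c t) * X (c t) $ 1 + b (c t) * X (c t) $ 2)"
      by (simp add: algebra_simps)
    then have "a (c t) * (k * X (c t) $ 1) + b (c t) * (k * X (c t) $ 2) = 0" using zero[OF V] by simp
    then show "((\<lambda>t. u (c t)) has_real_derivative 0) (at t within {0..1})"
      by (intro DERIV_cong[OF has_partials_curve[OF u[OF V] has_vector_derivative_at_within[OF tangent_pathD(1)[OF c(1) t]]]])
        (simp add: k)
  qed simp
  then show ?thesis using c tangent_pathD(6)[OF c(1), of 0] by force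
qed

lemma frechet_derivative_nonzero_iff:
  assumes "has_partials u a b q"
  shows "frechet_derivative u (at q) \<noteq> (\<lambda>v. 0) \<longleftrightarrow> a \<noteq> 0 \<or> b \<noteq> 0"
proof -
  have fd: "frechet_derivative u (at q) = (\<lambda>h. a * h $ 1 + b * h $ 2)"
    using frechet_derivative_at[OF assms[unfolded has_partials_def]] by simp
  show ?thesis
  proof
    assume "frechet_derivative u (at q) \<noteq> (\<lambda>v. 0)"
    then show "a \<noteq> 0 \<or> b \<noteq> 0" unfolding fd by auto
  next
    assume ab: "a \<noteq> 0 \<or> b \<noteq> 0"
    show "frechet_derivative u (at q) \<noteq> (\<lambda>v. 0)"
    proof
      assume "frechet_derivative u (at q) = (\<lambda>v. 0)"
      then have "(\<lambda>h. a * h $ 1 + b * h $ 2) = (\<lambda>v :: real^2. 0)" using fd by simp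
      from fun_cong[OF this, of "axis 1 1"] fun_cong[OF this, of "axis 2 1"] ab show False by (auto simp: axis_def)
    qed
  qed
qed

lemma proj_plane_eq_plane_D0_iff:
  assumes "n \<noteq> 0"
  shows "proj_plane n = plane_D0 \<longleftrightarrow> n $ 1 = 0 \<and> n $ 2 = 0 \<and> n $ 3 = 0"
proof
  assume eq: "proj_plane n = plane_D0"
  \<comment> \<open>The projection of \<open>n\<close> to \<open>D = 0\<close>; if the planes agree,
    \<open>n \<bullet> v\<close> is both zero and the square of the length of
    \<open>v\<close>.\<close>
  define v :: "real^4" where "v = (\<chi> i. if i = 4 then 0 else n $ i)"
  show "n $ 1 = 0 \<and> n $ 2 = 0 \<and> n $ 3 = 0"
  proof (cases "v = 0")
    case True
    then have "v $ i = 0" for i by simp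
    from this[of 1] this[of 2] this[of 3] show ?thesis by (simp add: v_def)
  next
    case False
    have "span {v} \<in> plane_D0"
      unfolding plane_D0_def proj_plane_span_iff[OF False] by (simp add: inner_axis' v_def)
    then have "n \<bullet> v = 0" using eq proj_plane_span_iff[OF False] by blast
    then have "n $ 1 * n $ 1 + n $ 2 * n $ 2 + n $ 3 * n $ 3 = 0" by (simp add: inner_vec_def sum_4 v_def)
    then have "n $ 1 * n $ 1 = 0" "n $ 2 * n $ 2 = 0" "n $ 3 * n $ 3 = 0"
      using zero_le_square[of "n $ 1"] zero_le_square[of "n $ 2"] zero_le_square[of "n $ 3"] by linarith+
    then show ?thesis by simp
  qed
next
  assume z: "n $ 1 = 0 \<and> n $ 2 = 0 \<and> n $ 3 = 0"
  then have n4: "n $ 4 \<noteq> 0" using assms by (auto simp: vec_eq_iff forall_4)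
  have "n \<bullet> v = 0 \<longleftrightarrow> axis 4 1 \<bullet> v = 0" for v
    using z n4 by (simp add: inner_axis' inner_vec_def sum_4 axis_def)
  then show "proj_plane n = plane_D0" by (simp add: proj_plane_def plane_D0_def)
qed

lemma three_indices:
  fixes i :: 3
  obtains j k where "i \<noteq> j" "i \<noteq> k" "j \<noteq> k" "UNIV = {i, j, k}"
proof -
  have "i = 1 \<or> i = 2 \<or> i = 3" by (rule exhaust_3)
  then show ?thesis
  proof (elim disjE)
    assume i: "i = 1"
    show ?thesis
    proof (rule that)
      show "i \<noteq> 2" "i \<noteq> 3" "(2::3) \<noteq> 3" unfolding i by simp_all
      show "UNIV = {i, 2, 3}" unfolding i by (rule UNIV_3)
    qed
  next
    assume i: "i = 2"
    show ?thesis
    proof (rule that)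
      show "i \<noteq> 1" "i \<noteq> 3" "(1::3) \<noteq> 3" unfolding i by simp_all
      show "UNIV = {i, 1, 3}" unfolding i UNIV_3 by (rule insert_commute)
    qed
  next
    assume i: "i = 3"
    show ?thesis
    proof (rule that)
      show "i \<noteq> 1" "i \<noteq> 2" "(1::3) \<noteq> 2" unfolding i by simp_all
      show "UNIV = {i, 1, 2}" unfolding i UNIV_3 by blast
    qed
  qed
qed

lemma hexagonalD:
  assumes "hexagonal U W" "p \<in> U"
  obtains V and u :: "3 \<Rightarrow> real^2 \<Rightarrow> real" where "open V" "p \<in> V" "V \<subseteq> U" "\<And>i. smooth_on V (u i)"
    "\<And>i q. q \<in> V \<Longrightarrow> partial 1 (u i) q \<noteq> 0 \<or> partial 2 (u i) q \<noteq> 0"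
    "\<And>i q r. q \<in> V \<Longrightarrow> r \<in> leaf V (W i) q \<Longrightarrow> u i r = u i q" "\<And>q. q \<in> V \<Longrightarrow> (\<Sum>i\<in>UNIV. u i q) = 0"
proof -
  from bspec[OF assms(1)[unfolded hexagonal_def] assms(2)] obtain V and u :: "3 \<Rightarrow> real^2 \<Rightarrow> real" where
    V: "open V" "p \<in> V" "V \<subseteq> U" and u: "\<forall>i. smooth_on V (u i) \<and>
             (\<forall>q\<in>V. frechet_derivative (u i) (at q) \<noteq> (\<lambda>v. 0)) \<and>
             (\<forall>q\<in>V. \<forall>r\<in>leaf V (W i) q. u i r = u i q)" and s: "\<forall>q\<in>V. (\<Sum>i\<in>UNIV. u i q) = 0"
    by (elim exE conjE) (rule that, assumption+)
  show ?thesis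
  proof (rule that[OF V])
    show sm: "smooth_on V (u i)" for i using u by simp
    show "partial 1 (u i) q \<noteq> 0 \<or> partial 2 (u i) q \<noteq> 0" if q: "q \<in> V" for i q
    proof -
      have "frechet_derivative (u i) (at q) \<noteq> (\<lambda>v. 0)" using u q by simp
      then show ?thesis using frechet_derivative_nonzero_iff[OF smooth_on_has_partials[OF sm q]] by simp
    qed
    show "u i r = u i q" if "q \<in> V" "r \<in> leaf V (W i) q" for i q r using u that by simp
    show "(\<Sum>i\<in>UNIV. u i q) = 0" if "q \<in> V" for q using s that by simp
  qed
qed

lemma slope_vector_nonzero: "(vector [s, 1] :: real^2) \<noteq> 0"
  by (simp add: vec2_nonzero)

lemma slopes_distinct:
  assumes "L p = span {vector [slope L p, 1]}" "M p = span {vector [slope M p, 1]}" "L p \<inter> M p = {0}"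
  shows "slope L p \<noteq> slope M p"
proof
  assume eq: "slope L p = slope M p"
  have "vector [slope L p, 1] \<in> L p" by (subst assms(1)) (simp add: span_base)
  moreover have "vector [slope L p, 1] \<in> M p" unfolding eq by (subst assms(2)) (simp add: span_base)
  ultimately have "(vector [slope L p, 1] :: real^2) = 0" using assms(3) by blast
  then show False using slope_vector_nonzero by blast
qed

section \<open>Isolating the special foliation\<close>

text \<open>Being non-special is an open condition, so if it held for all three foliations at
  \<open>p\<close> it would hold on a neighbourhood, where three finite slopes contradict
  hexagonality. The index obtained may still depend on \<open>p\<close>.\<close>

lemma hexagonal_imp_special:
  assumes fol: "\<And>i. geodesic_foliation \<epsilon> U (W i)" and trans: "\<And>i j p. i \<noteq> j \<Longrightarrow> p \<in> U \<Longrightarrow> W i p \<inter> W j p = {0}"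
    and eps: "\<epsilon> * \<epsilon> = 1" and hex: "hexagonal U W" and p: "p \<in> U"
  shows "\<exists>i. axis 1 1 \<in> W i p"
proof (rule ccontr)
  assume "\<not> ?thesis"
  then have no: "axis 1 1 \<notin> W i p" for i by blast
  obtain V and u :: "3 \<Rightarrow> real^2 \<Rightarrow> real" where V: "open V" "p \<in> V" "V \<subseteq> U" and u: "\<And>i. smooth_on V (u i)"
    and nz: "\<And>i q. q \<in> V \<Longrightarrow> partial 1 (u i) q \<noteq> 0 \<or> partial 2 (u i) q \<noteq> 0"
    and const: "\<And>i q r. q \<in> V \<Longrightarrow> r \<in> leaf V (W i) q \<Longrightarrow> u i r = u i q"
    and sum: "\<And>q. q \<in> V \<Longrightarrow> (\<Sum>i\<in>UNIV. u i q) = 0"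
    by (rule hexagonalD[OF hex p]) (rule that)
  define T where "T = V \<inter> {p \<in> U. axis 1 1 \<notin> W 1 p} \<inter> {p \<in> U. axis 1 1 \<notin> W 2 p} \<inter> {p \<in> U. axis 1 1 \<notin> W 3 p}"
  have T: "open T" "T \<subseteq> V" "T \<subseteq> U" "p \<in> T"
    unfolding T_def using open_nonspecial[OF fol] V no p by (auto intro!: open_Int)
  have ax: "axis 1 1 \<notin> W i q" if "q \<in> T" for i q using exhaust_3[of i] that by (auto simp: T_def)
  have sl: "slope_on \<epsilon> T (slope (W i))" for i by (rule slope_on_foliation[OF fol T(1,3) ax])
  have Wq: "W i q = span {vector [slope (W i) q, 1]}" if "q \<in> T" for i q
    by (rule foliation_line_slope[OF fol _ ax]) (use that T in auto)
  have ne: "slope (W i) q \<noteq> slope (W j) q" if "q \<in> T" "i \<noteq> j" for i j q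
    by (rule slopes_distinct[OF Wq[OF that(1)] Wq[OF that(1)]]) (use trans that T in blast)
  have eq: "partial 2 (u i) q = - slope (W i) q * partial 1 (u i) q" if q: "q \<in> T" for i q
  proof -
    have "q \<in> V" using q T by blast
    from constant_on_leaves_derivative[OF fol[of i] V(1,3) u[of i] const[where i = i] this Wq[OF q]] show ?thesis
      by (simp add: eq_neg_iff_add_eq_0 algebra_simps)
  qed
  \<comment> \<open>If \<open>u\<^sub>z\<close> vanished, so would
    \<open>u\<^sub>y = - S u\<^sub>z\<close>, against the nonzero differential.\<close>
  have nz1: "partial 1 (u i) q \<noteq> 0" if q: "q \<in> T" for i q
  proof -
    have "q \<in> V" using q T by blast
    from nz[OF this, of i] eq[OF q, of i] show ?thesis by auto
  qed
  have sum3: "u 1 q + u 2 q + u 3 q = 0" if "q \<in> T" for q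
  proof -
    have "q \<in> V" using that T by blast
    from sum[OF this] show ?thesis by (simp add: sum_3)
  qed
  note su = smooth_on_subset[OF u T(2)]
  show False
    by (rule three_slopes_not_hexagonal[OF sl[of 1] sl[of 2] sl[of 3] T(4) eps _ _ su[of 1] su[of 2] su[of 3] sum3
          eq[of _ 1] eq[of _ 2] eq[of _ 3] nz1[of _ 1]]) (use ne in auto)
qed

text \<open>By transversality at most one foliation is special at a point, so \<open>i\<close> is
  special exactly where neither \<open>j\<close> nor \<open>k\<close> is. That set and its
  complement \<open>D i\<close> are both open in the connected \<open>U\<close>, so the index cannot
  change.\<close>

lemma hexagonal_special_foliation:
  assumes fol: "\<And>i. geodesic_foliation \<epsilon> U (W i)" and trans: "\<And>i j p. i \<noteq> j \<Longrightarrow> p \<in> U \<Longrightarrow> W i p \<inter> W j p = {0}"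
    and eps: "\<epsilon> * \<epsilon> = 1" and hex: "hexagonal U W" and U: "connected U" "U \<noteq> {}"
  shows "\<exists>i. \<forall>p\<in>U. axis 1 1 \<in> W i p"
proof -
  obtain p0 where p0: "p0 \<in> U" using U by blast
  obtain i where i: "axis 1 1 \<in> W i p0" using hexagonal_imp_special[OF fol trans eps hex p0] by blast
  obtain j k where jk: "i \<noteq> j" "i \<noteq> k" "j \<noteq> k" "UNIV = {i, j, k}" by (rule three_indices)
  define D where "D l = {p \<in> U. axis 1 1 \<notin> W l p}" for l
  have oD: "open (D l)" for l unfolding D_def by (rule open_nonspecial[OF fol])
  have uniq: "l = l'" if "p \<in> U" "axis 1 1 \<in> W l p" "axis 1 1 \<in> W l' p" for l l' p
  proof (rule ccontr)
    assume "l \<noteq> l'"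
    then have "(axis 1 1 :: real^2) = 0" using trans[of l l' p] that by blast
    then show False by (simp add: axis_eq_0_iff)
  qed
  have cases: "axis 1 1 \<in> W i p \<or> axis 1 1 \<in> W j p \<or> axis 1 1 \<in> W k p" if p: "p \<in> U" for p
  proof -
    obtain l where l: "axis 1 1 \<in> W l p" using hexagonal_imp_special[OF fol trans eps hex p] by blast
    have "l \<in> {i, j, k}" unfolding jk(4)[symmetric] by simp
    then show ?thesis using l by auto
  qed
  have "D i \<inter> U = {} \<or> (D j \<inter> D k) \<inter> U = {}"
  proof (rule connectedD[OF U(1)])
    show "open (D i)" "open (D j \<inter> D k)" using oD by auto
    show "D i \<inter> (D j \<inter> D k) \<inter> U = {}" using cases by (auto simp: D_def)
    show "U \<subseteq> D i \<union> (D j \<inter> D k)"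
    proof
      fix p assume p: "p \<in> U"
      show "p \<in> D i \<union> (D j \<inter> D k)"
      proof (cases "axis 1 1 \<in> W i p")
        case True
        then have "axis 1 1 \<notin> W j p" "axis 1 1 \<notin> W k p" using uniq[OF p True] jk by blast+
        then show ?thesis using p by (simp add: D_def)
      qed (use p in \<open>simp add: D_def\<close>)
    qed
  qed
  moreover have "p0 \<in> D j \<inter> D k \<inter> U"
  proof -
    have "axis 1 1 \<notin> W j p0" "axis 1 1 \<notin> W k p0" using uniq[OF p0 i] jk by blast+
    then show ?thesis using p0 by (simp add: D_def)
  qed
  ultimately have "D i \<inter> U = {}" by blast
  then show ?thesis by (intro exI[of _ i]) (auto simp: D_def)
qed

theorem theorem10:
  fixes U :: "(real^2) set"
    and g :: "real^2 \<Rightarrow> real^2^2"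
    and W :: "3 \<Rightarrow> real^2 \<Rightarrow> (real^2) set"
    and \<epsilon> :: real
  assumes "open U" and "connected U" and "U \<noteq> {}" and "\<forall>p\<in>U. p $ 1 \<noteq> 0"
    and "\<epsilon> = 1 \<or> \<epsilon> = -1"
    and "metric_on U g"
    and "dim_projective g U = 3"
    and "geodesics_given_by_ode \<epsilon> g U"
    and "geodesic_web g U W"
  shows "hexagonal U W \<longleftrightarrow>
    (\<exists>i. arc_of (dual_focal_curve \<epsilon> U (W i)) (conic_c0 \<epsilon>) \<and>
         (\<exists>n. n \<noteq> 0 \<and> proj_plane n \<noteq> plane_D0 \<and>
              (\<forall>j. j \<noteq> i \<longrightarrow>
                 arc_of (dual_focal_curve \<epsilon> U (W j)) (quadric \<epsilon> \<inter> proj_plane n))))"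
    (is "_ \<longleftrightarrow> ?planar")
proof -
  note U = assms(1,2,3,4)
  have fol: "geodesic_foliation \<epsilon> U (W i)" for i by (rule geodesic_web_foliation[OF U(1,4) assms(8,5,9)])
  have trans: "W i p \<inter> W j p = {0}" if "i \<noteq> j" "p \<in> U" for i j p
    using assms(9) that unfolding geodesic_web_def three_web_def by simp
  have eps: "\<epsilon> * \<epsilon> = 1" using assms(5) by auto
  note arc = arc_of_dual_focal_curve_iff[OF fol U(2,3)]
  have quad: "dual_point \<epsilon> (W i) p \<in> quadric \<epsilon>" if p: "p \<in> U" for i p
  proof -
    obtain X where X: "dual_point \<epsilon> (W i) p = span {dual_vector \<epsilon> p X}" "dual_vector \<epsilon> p X \<noteq> 0" "p $ 1 \<noteq> 0"
      by (rule dual_point_nonzero_rep[OF fol p])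
    show ?thesis unfolding X(1) quadric_span_iff[OF X(2)] by (rule dual_vector_quadric[OF X(3)])
  qed
  \<comment> \<open>The last coordinate of the dual vector is \<open>- (X $ 2)\<^sup>2\<close>, so
    the plane \<open>D = 0\<close> singles out the direction of \<open>y = const\<close>.\<close>
  have special: "dual_point \<epsilon> (W i) p \<in> plane_D0 \<longleftrightarrow> axis 1 1 \<in> W i p" if p: "p \<in> U" for i p
  proof -
    obtain X where X: "X \<noteq> 0" "W i p = span {X}" "dual_point \<epsilon> (W i) p = span {dual_vector \<epsilon> p X}" "dual_vector \<epsilon> p X \<noteq> 0"
      by (rule dual_point_nonzero_rep[OF fol p])
    show ?thesis
      unfolding X(2,3) plane_D0_def proj_plane_span_iff[OF X(4)] axis_in_span_iff[OF X(1)]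
      by (simp add: inner_axis' dual_vector_nth)
  qed
  have nonspecial: "axis 1 1 \<notin> W j p" if "i \<noteq> j" "p \<in> U" "axis 1 1 \<in> W i p" for i j p
  proof
    assume "axis 1 1 \<in> W j p"
    then have "(axis 1 1 :: real^2) = 0" using trans[OF that(1,2)] that(3) by blast
    then show False by (simp add: axis_eq_0_iff)
  qed
  have slopes: "slope_on \<epsilon> U (slope (W j))" "\<And>p. p \<in> U \<Longrightarrow> W j p = span {vector [slope (W j) p, 1]}"
    if "\<And>p. p \<in> U \<Longrightarrow> axis 1 1 \<notin> W j p" for j
    using slope_on_foliation[OF fol U(1) order_refl that] foliation_line_slope[OF fol _ that] by blast+
  have plane: "dual_point \<epsilon> (W j) p \<in> proj_plane n \<longleftrightarrow> n \<bullet> dual_vector \<epsilon> p (vector [slope (W j) p, 1]) = 0"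
    if p: "p \<in> U" and ax: "\<And>p. p \<in> U \<Longrightarrow> axis 1 1 \<notin> W j p" for j p n
  proof -
    have "W j p = span {vector [slope (W j) p, 1]}" by (rule slopes(2)[OF ax p])
    note dp = dual_point_eq[where L = "W j" and p = p, OF this]
    show ?thesis unfolding dp by (rule proj_plane_span_iff[OF dual_vector_nonzero[OF slope_vector_nonzero]])
  qed
  show ?thesis
  proof
    assume hex: "hexagonal U W"
    obtain i where i: "\<And>p. p \<in> U \<Longrightarrow> axis 1 1 \<in> W i p"
      using hexagonal_special_foliation[OF fol trans eps hex U(2,3)] by auto
    obtain j k where jk: "i \<noteq> j" "i \<noteq> k" "j \<noteq> k" "UNIV = {i, j, k}" by (rule three_indices)
    have axj: "axis 1 1 \<notin> W j p" and axk: "axis 1 1 \<notin> W k p" if "p \<in> U" for p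
      using nonspecial[OF jk(1) that i[OF that]] nonspecial[OF jk(2) that i[OF that]] by auto
    have sj: "slope_on \<epsilon> U (slope (W j))" by (rule slopes(1)[OF axj])
    have Wj: "W j p = span {vector [slope (W j) p, 1]}" if "p \<in> U" for p by (rule slopes(2)[OF axj that])
    have planej: "dual_point \<epsilon> (W j) p \<in> proj_plane n \<longleftrightarrow> n \<bullet> dual_vector \<epsilon> p (vector [slope (W j) p, 1]) = 0"
      if "p \<in> U" for p n by (rule plane[OF that axj])
    have sk: "slope_on \<epsilon> U (slope (W k))" by (rule slopes(1)[OF axk])
    have Wk: "W k p = span {vector [slope (W k) p, 1]}" if "p \<in> U" for p by (rule slopes(2)[OF axk that])
    have planek: "dual_point \<epsilon> (W k) p \<in> proj_plane n \<longleftrightarrow> n \<bullet> dual_vector \<epsilon> p (vector [slope (W k) p, 1]) = 0"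
      if "p \<in> U" for p n by (rule plane[OF that axk])
    have ne: "slope (W j) q \<noteq> slope (W k) q" if "q \<in> U" for q
      by (rule slopes_distinct[OF Wj[OF that] Wk[OF that] trans[OF jk(3) that]])
    \<comment> \<open>Hexagonality gives first integrals only near each point, but this consequence
      is free of them and so holds on all of \<open>U\<close>, which is what a single plane for the
      whole web requires.\<close>
    have zz: "partial 1 (partial 1 (\<lambda>q. slope (W j) q + slope (W k) q)) p = 0" if p: "p \<in> U" for p
    proof -
      obtain V and u :: "3 \<Rightarrow> real^2 \<Rightarrow> real" where V: "open V" "p \<in> V" "V \<subseteq> U" and u: "\<And>i. smooth_on V (u i)"
        and nz: "\<And>i q. q \<in> V \<Longrightarrow> partial 1 (u i) q \<noteq> 0 \<or> partial 2 (u i) q \<noteq> 0"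
        and const: "\<And>i q r. q \<in> V \<Longrightarrow> r \<in> leaf V (W i) q \<Longrightarrow> u i r = u i q"
        and sum: "\<And>q. q \<in> V \<Longrightarrow> (\<Sum>i\<in>UNIV. u i q) = 0"
        by (rule hexagonalD[OF hex p]) (rule that)
      have VU: "q \<in> U" if "q \<in> V" for q using that V by blast
      have d: "partial 1 (u l) q * Y $ 1 + partial 2 (u l) q * Y $ 2 = 0" if "q \<in> V" "W l q = span {Y}" for l q Y
        by (rule constant_on_leaves_derivative[OF fol[of l] V(1,3) u[of l] const[where i = l] that])
      have eqi: "partial 1 (u i) q = 0" if q: "q \<in> V" for q
      proof -
        have "W i q = span {axis 1 1}" by (rule foliation_line_special[OF fol VU[OF q] i[OF VU[OF q]]])
        from d[OF q this] show ?thesis by (simp add: axis_def)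
      qed
      have eqj: "partial 2 (u j) q = - slope (W j) q * partial 1 (u j) q"
        and eqk: "partial 2 (u k) q = - slope (W k) q * partial 1 (u k) q" if q: "q \<in> V" for q
        using d[OF q Wj[OF VU[OF q]]] d[OF q Wk[OF VU[OF q]]] by (simp_all add: eq_neg_iff_add_eq_0 algebra_simps)
      have nzj: "partial 1 (u j) q \<noteq> 0" if q: "q \<in> V" for q using nz[OF q, of j] eqj[OF q] by auto
      have sum3: "u i q + u j q + u k q = 0" if q: "q \<in> V" for q
        using sum[OF q] jk(1-3) unfolding jk(4) by (simp add: add.assoc)
      show ?thesis
        by (rule two_slopes_hexagonal_sum[OF slope_on_subset[OF sj V(1,3)] slope_on_subset[OF sk V(1,3)] V(2)
              ne[OF VU] u u u sum3 eqi eqj eqk nzj])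
    qed
    have "\<exists>n :: real^4. (n $ 1 \<noteq> 0 \<or> n $ 2 \<noteq> 0 \<or> n $ 3 \<noteq> 0) \<and>
      (\<forall>q\<in>U. n \<bullet> dual_vector \<epsilon> q (vector [slope (W j) q, 1]) = 0 \<and> n \<bullet> dual_vector \<epsilon> q (vector [slope (W k) q, 1]) = 0)"
      by (rule two_slopes_common_plane[OF sj sk U(2,3) eps zz])
    then obtain n :: "real^4" where n: "n $ 1 \<noteq> 0 \<or> n $ 2 \<noteq> 0 \<or> n $ 3 \<noteq> 0"
      "\<forall>q\<in>U. n \<bullet> dual_vector \<epsilon> q (vector [slope (W j) q, 1]) = 0 \<and> n \<bullet> dual_vector \<epsilon> q (vector [slope (W k) q, 1]) = 0"
      by (elim exE conjE)
    have n0: "n \<noteq> 0" using n(1) by auto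
    have "arc_of (dual_focal_curve \<epsilon> U (W l)) (quadric \<epsilon> \<inter> proj_plane n)" if "l \<noteq> i" for l
    proof -
      have "l \<in> {i, j, k}" unfolding jk(4)[symmetric] by simp
      then consider "l = j" | "l = k" using \<open>l \<noteq> i\<close> by blast
      then have "dual_point \<epsilon> (W l) p \<in> proj_plane n" if p: "p \<in> U" for p
      proof cases
        case 1
        show ?thesis unfolding 1 planej[OF p] using n(2) p by simp
      next
        case 2
        show ?thesis unfolding 2 planek[OF p] using n(2) p by simp
      qed
      then show ?thesis unfolding arc using quad by blast
    qed
    moreover have "arc_of (dual_focal_curve \<epsilon> U (W i)) (conic_c0 \<epsilon>)"
      unfolding arc conic_c0_def using quad special i by blast
    moreover have "proj_plane n \<noteq> plane_D0" using n(1) proj_plane_eq_plane_D0_iff[OF n0] by simp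
    ultimately show ?planar using n0 by (intro exI[of _ i] exI[of _ n] conjI allI impI)
  next
    assume ?planar
    then obtain i n where i: "arc_of (dual_focal_curve \<epsilon> U (W i)) (conic_c0 \<epsilon>)" and n: "n \<noteq> 0" "proj_plane n \<noteq> plane_D0"
      "\<forall>j. j \<noteq> i \<longrightarrow> arc_of (dual_focal_curve \<epsilon> U (W j)) (quadric \<epsilon> \<inter> proj_plane n)"
      by (elim exE conjE)
    have axi: "axis 1 1 \<in> W i p" if p: "p \<in> U" for p
      using i special[OF p, of i] p unfolding arc conic_c0_def by blast
    obtain j k where jk: "i \<noteq> j" "i \<noteq> k" "j \<noteq> k" "UNIV = {i, j, k}" by (rule three_indices)
    have axj: "axis 1 1 \<notin> W j p" and axk: "axis 1 1 \<notin> W k p" if "p \<in> U" for p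
      using nonspecial[OF jk(1) that axi[OF that]] nonspecial[OF jk(2) that axi[OF that]] by auto
    have sj: "slope_on \<epsilon> U (slope (W j))" by (rule slopes(1)[OF axj])
    have Wj: "W j p = span {vector [slope (W j) p, 1]}" if "p \<in> U" for p by (rule slopes(2)[OF axj that])
    have planej: "dual_point \<epsilon> (W j) p \<in> proj_plane n \<longleftrightarrow> n \<bullet> dual_vector \<epsilon> p (vector [slope (W j) p, 1]) = 0"
      if "p \<in> U" for p n by (rule plane[OF that axj])
    have sk: "slope_on \<epsilon> U (slope (W k))" by (rule slopes(1)[OF axk])
    have Wk: "W k p = span {vector [slope (W k) p, 1]}" if "p \<in> U" for p by (rule slopes(2)[OF axk that])
    have planek: "dual_point \<epsilon> (W k) p \<in> proj_plane n \<longleftrightarrow> n \<bullet> dual_vector \<epsilon> p (vector [slope (W k) p, 1]) = 0"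
      if "p \<in> U" for p n by (rule plane[OF that axk])
    have ne: "slope (W j) q \<noteq> slope (W k) q" if "q \<in> U" for q
      by (rule slopes_distinct[OF Wj[OF that] Wk[OF that] trans[OF jk(3) that]])
    \<comment> \<open>As the plane is not \<open>D = 0\<close>, the polynomial \<open>\<rho>\<close>
      formed from \<open>n\<close> is not the zero polynomial.\<close>
    have n0: "n $ 1 \<noteq> 0 \<or> n $ 2 \<noteq> 0 \<or> n $ 3 \<noteq> 0" using n(2) proj_plane_eq_plane_D0_iff[OF n(1)] by blast
    have inP: "dual_point \<epsilon> (W l) q \<in> proj_plane n" if "l \<noteq> i" "q \<in> U" for l q
      using n(3) that unfolding arc by simp
    have nj: "n \<bullet> dual_vector \<epsilon> q (vector [slope (W j) q, 1]) = 0" if q: "q \<in> U" for q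
      using inP[OF jk(1)[symmetric] q] unfolding planej[OF q] .
    have nk: "n \<bullet> dual_vector \<epsilon> q (vector [slope (W k) q, 1]) = 0" if q: "q \<in> U" for q
      using inP[OF jk(2)[symmetric] q] unfolding planek[OF q] .
    show "hexagonal U W"
      unfolding hexagonal_def
    proof
      fix p assume p: "p \<in> U"
      have "\<exists>V f r u0 u1 u2. open V \<and> p \<in> V \<and> V \<subseteq> U \<and> smooth_on V u0 \<and> smooth_on V u1 \<and> smooth_on V u2 \<and>
        (\<forall>q\<in>V. u0 q + u1 q + u2 q = 0 \<and> f q \<noteq> 0 \<and> r q \<noteq> 0 \<and> has_partials u0 0 (r q) q \<and>
          has_partials u1 (f q) (- slope (W j) q * f q) q \<and> has_partials u2 (- f q) (slope (W k) q * f q) q)"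
        by (rule common_plane_first_integrals[OF U(1,4) p slope_onD(3)[OF sj] slope_onD(3)[OF sk] ne n0 nj nk])
      then obtain V f r u0 u1 u2 where V: "open V" "p \<in> V" "V \<subseteq> U" and sm: "smooth_on V u0" "smooth_on V u1" "smooth_on V u2"
        and on: "\<forall>q\<in>V. u0 q + u1 q + u2 q = 0 \<and> f q \<noteq> 0 \<and> r q \<noteq> 0 \<and> has_partials u0 0 (r q) q \<and>
          has_partials u1 (f q) (- slope (W j) q * f q) q \<and> has_partials u2 (- f q) (slope (W k) q * f q) q"
        by (elim exE conjE)
      have VU: "q \<in> U" if "q \<in> V" for q using that V by blast
      have h0: "has_partials u0 0 (r q) q" and h1: "has_partials u1 (f q) (- slope (W j) q * f q) q"
        and h2: "has_partials u2 (- f q) (slope (W k) q * f q) q" and nz: "f q \<noteq> 0" "r q \<noteq> 0"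
        and sum: "u0 q + u1 q + u2 q = 0" if "q \<in> V" for q
        using on that by simp_all
      \<comment> \<open>The integral of \<open>dy / \<rho>\<close> goes with the special foliation,
        the other two with the two roots of the slope equation.\<close>
      define u where "u l = (if l = i then u0 else if l = j then u1 else u2)" for l
      have u: "u i = u0" "u j = u1" "u k = u2" using jk by (auto simp: u_def)
      have fi: "\<forall>q\<in>V. frechet_derivative u0 (at q) \<noteq> (\<lambda>v. 0)"
        "\<forall>q\<in>V. frechet_derivative u1 (at q) \<noteq> (\<lambda>v. 0)" "\<forall>q\<in>V. frechet_derivative u2 (at q) \<noteq> (\<lambda>v. 0)"
        using frechet_derivative_nonzero_iff[OF h0] frechet_derivative_nonzero_iff[OF h1]
          frechet_derivative_nonzero_iff[OF h2] nz by auto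
      have c0: "u0 s = u0 q" if "s \<in> leaf V (W i) q" for q s
        by (rule constant_on_leaf[OF h0 foliation_line_special[OF fol VU axi[OF VU]] _ that]) (auto simp: axis_def)
      have c1: "u1 s = u1 q" if "s \<in> leaf V (W j) q" for q s
        by (rule constant_on_leaf[OF h1 Wj[OF VU] _ that]) auto
      have c2: "u2 s = u2 q" if "s \<in> leaf V (W k) q" for q s
        by (rule constant_on_leaf[OF h2 Wk[OF VU] _ that]) auto
      have all: "smooth_on V (u l) \<and> (\<forall>q\<in>V. frechet_derivative (u l) (at q) \<noteq> (\<lambda>v. 0)) \<and>
          (\<forall>q\<in>V. \<forall>s\<in>leaf V (W l) q. u l s = u l q)" for l
      proof -
        have "l \<in> {i, j, k}" unfolding jk(4)[symmetric] by simp
        then consider "l = i" | "l = j" | "l = k" by blast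
        then show ?thesis
        proof cases
          case 1
          show ?thesis unfolding 1 u using sm(1) fi(1) c0 by (intro conjI ballI) auto
        next
          case 2
          show ?thesis unfolding 2 u using sm(2) fi(2) c1 by (intro conjI ballI) auto
        next
          case 3
          show ?thesis unfolding 3 u using sm(3) fi(3) c2 by (intro conjI ballI) auto
        qed
      qed
      have "(\<Sum>l\<in>UNIV. u l q) = 0" if "q \<in> V" for q
        using sum[OF that] jk(1-3) unfolding jk(4) by (simp add: u add.assoc)
      then show "\<exists>V (u :: 3 \<Rightarrow> real^2 \<Rightarrow> real). open V \<and> p \<in> V \<and> V \<subseteq> U \<and>
        (\<forall>i. smooth_on V (u i) \<and> (\<forall>q\<in>V. frechet_derivative (u i) (at q) \<noteq> (\<lambda>v. 0)) \<and>
             (\<forall>q\<in>V. \<forall>r\<in>leaf V (W i) q. u i r = u i q)) \<and> (\<forall>q\<in>V. (\<Sum>i\<in>UNIV. u i q) = 0)"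
        using all V by (intro exI[of _ V] exI[of _ u] conjI allI ballI) simp_all
    qed
  qed
qed

end
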